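(* Let $n\ge 3$, let $T=(\{\alpha\},\{\beta\},\alpha\mapsto\beta)$ with $1\le\alpha<\beta\le n-1$, let $k_T=n-2$, and let $\mathcal{C}_T=\mathcal{C}_{\alpha\beta}$ be the cluster structure in $\mathbb{C}(SL_n)$ defined by the initial seed $(\mathcal{B}_{\alpha\beta},Q_{\alpha\beta}(n))$. Then the global toric action of $(\mathbb{C}^* )^{2k_T}$ on $\mathbb{C}(SL_n)$ (with respect to $\mathcal{C}_T$) is generated by the action of $\mathcal{H}_T\times\mathcal{H}_T$ on $SL_n$ given by $(H_1,H_2)(X)=H_1XH_2$.
   Context: All varieties are over $\mathbb{C}$; $[a,b]=\{a,a+1,\dots,b\}$, $[m]=[1,m]$. $X=(x_{ij})_{i,j=1}^n$ is the matrix of coordinate functions on $SL_n$, and $X_R^C$ is its submatrix with rows $R$ and columns $C$. The simple root $\alpha_i$ of $\mathfrak{sl}_n$ is identified with its index $i\in[n-1]$. Let $\mathfrak{h}$ be the diagonal Cartan subalgebra of $\mathfrak{sl}_n$, $\alpha_i(\mathrm{diag}(d_1,\dots,d_n))=d_i-d_{i+1}$. $\mathfrak{h}_T=\{h\in\mathfrak{h}:\alpha(h)=\beta(h)\}$ and $\mathcal{H}_T=\exp\mathfrak{h}_T\subset SL_n$, a torus of dimension $k_T=n-2$. Seeds and cluster structures. A seed in $\mathbb{C}(SL_n)$ consists of an extended cluster $(y_1,\dots,y_N)$, $N=p+q=n^2-1$, which is a transcendence basis generating $\mathbb{C}(SL_n)$ over $\mathbb{C}$, and a $p\times N$ integer matrix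 $\tilde B=(b_{ij})$ whose first $p$ columns form a skew-symmetric matrix; $y_1,\dots,y_p$ are cluster (mutable) variables and $y_{p+1},\dots,y_N$ are stable (frozen) variables. $\tilde B$ is encoded by a quiver with $N$ nodes having $b_{ij}$ arrows $i\to j$ whenever $b_{ij}>0$; arrows between two frozen vertices are ignored. Mutation in direction $k\in[p]$ replaces $y_k$ by $y_k'$, where $y_ky_k'=\prod_{b_{kj}>0}y_j^{b_{kj}}+\prod_{b_{kj}<0}y_j^{-b_{kj}}$, and $\tilde B$ by $b'_{ij}=-b_{ij}$ if $i=k$ or $j=k$, $b'_{ij}=b_{ij}+\frac12(|b_{ik}|b_{kj}+b_{ik}|b_{kj}|)$ otherwise. The cluster structure $\mathcal{C}$ is the set of all seeds obtained from the initial one by sequences of mutations. Toric actions. A global toric action of $(\mathbb{C}^* )^r$ on $\mathbb{C}(SL_n)$ with respect to $\mathcal{C}$ is an action by $\mathbb{C}$-algebra automorphisms of the field such that for every extended cluster $(y_1,\dots,y_N)$ of $\mathcal{C}$ there is an integer $N\times r$ matrix $(w_{ia})$ of rank $r$ with $d\cdot y_i=\bigl(\prod_{a=1}^r d_a^{w_{ia}}\bigr)y_i$ for all $i$ and all $d\in(\mathbb{C}^* )^r$. That it is generated by the action of $\mathcal{H}_T\times\mathcal{H}_T$ means that the action $f(X)\mapsto f(H_1XH_2)$ of $\mathcal{H}_T\times\mathcal{H}_T$ on $\mathbb{C}(SL_n)$, with $\mathcal{H}_T\times\mathcal{H}_T$ identified with $(\mathbb{C}^* )^{2k_T}$, is a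 global toric action of rank $2k_T$. Initial cluster $\mathcal{B}_{\alpha\beta}$. For $i,j\in[n]$ let $M_{ij}(X)=X_{[i,n-j+i]}^{[j,n]}$ if $j>i$ and $M_{ij}(X)=X_{[i,n]}^{[j,n-i+j]}$ otherwise. For $1\le j\le\alpha$, $i=n+j-\alpha$, with $\mu=n-\beta$, set $$\tilde M_{ij}(X)=\begin{bmatrix}X_{[i,n]}^{[j,\alpha+1]}&0_{(n-i+1)\times(\mu-1)}\\0_{\mu\times(n-i)}&X_{[1,\mu]}^{[\beta,n]}\end{bmatrix};$$ for $1\le i\le\beta$, $j=n+i-\beta$, with $\mu=n-\alpha$, set $$\tilde M_{ij}(X)=\begin{bmatrix}X_{[i,\beta+1]}^{[j,n]}&0_{(n-j)\times\mu}\\0_{(\mu-1)\times(n-j+1)}&X_{[\alpha,n]}^{[1,\mu]}\end{bmatrix}.$$ (The left and right parts of each array are stacked separately: in the first case the two nonzero blocks share two columns, in the second case they share two rows; both matrices are square.) Let $\overline M_{ij}=\tilde M_{ij}$ when $i=n+j-\alpha$ or $j=n+i-\beta$, and $\overline M_{ij}=M_{ij}$ otherwise; $\varphi_{ij}=\det\overline M_{ij}$. Then $\mathcal{B}_{\alpha\beta}=\{\varphi_{ij}:i,j\in[n]\}\setminus\{\varphi_{11}\}$ (note $\varphi_{11}=\det X=1$ on $SL_n$). Initial quiver $Q_{\alpha\beta}(n)$. Vertices are the pairs $(i,j)\in[n]\times[n]$, $(i,j)\neq(1,1)$, vertex $(i,j)$ carrying $\varphi_{ij}$. Start with arrows from $(i,j)$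 to $(i+1,j)$ (if $i\ne n$), to $(i,j+1)$ (if $j\neq n$) and to $(i-1,j-1)$ (if $i,j\neq1$), the vertices of the first row and first column being frozen and arrows between frozen vertices (and arrows at $(1,1)$) omitted. Then: vertices $(\alpha+1,1)$ and $(1,\beta+1)$ are made mutable; the arrows $(\alpha,1)\to(\alpha+1,1)$ and $(1,\beta)\to(1,\beta+1)$ are added (omitted if they involve $(1,1)$); the arrows $(n,\alpha+1)\to(1,\beta+1)$, $(1,\beta+1)\to(n,\alpha)$, $(\beta+1,n)\to(\alpha+1,1)$, $(\alpha+1,1)\to(\beta,n)$ are added.
   Formalization: The cases n = 2α and n = 2β are excluded: there, with the given functions and quiver, the vertex (α+1,1) or (1,β+1) lies on a modified diagonal, an exchange relation is not homogeneous under H_T×H_T, and the claim fails (e.g. n=4, α=1, β=2 at vertex (4,2)). *)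

theory Defs
  imports
    "Jordan_Normal_Form.DL_Rank"
    "HOL-Computational_Algebra.Fraction_Field"
    "HOL-Library.FuncSet"
    "HOL-Library.Cardinality"
begin

text \<open>
  The size \<open>n\<close> of the matrices is \<open>CARD('n)\<close>; the type \<open>'n\<close> serves only to make the function
  field of \<open>SL\<^sub>n\<close> a type. Matrix entries are indexed from 0 by the matrix library, whereas row
  and column numbers, simple roots and quiver vertices are numbered from 1.
\<close>

section \<open>Regular and rational functions on \<open>SL\<^sub>n\<close>\<close>

inductive_set fun_algebra :: "('x \<Rightarrow> complex) set \<Rightarrow> ('x \<Rightarrow> complex) set"
  for G :: "('x \<Rightarrow> complex) set" where
  gen: "g \<in> G \<Longrightarrow> g \<in> fun_algebra G"
| const: "(\<lambda>_. c) \<in> fun_algebra G"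
| add: "f \<in> fun_algebra G \<Longrightarrow> g \<in> fun_algebra G \<Longrightarrow> (\<lambda>x. f x + g x) \<in> fun_algebra G"
| mult: "f \<in> fun_algebra G \<Longrightarrow> g \<in> fun_algebra G \<Longrightarrow> (\<lambda>x. f x * g x) \<in> fun_algebra G"

definition entry_polynomials :: "nat \<Rightarrow> (complex mat \<Rightarrow> complex) set" where
  "entry_polynomials n = fun_algebra {(\<lambda>X. X $$ (i, j)) | i j. i < n \<and> j < n}"

definition SL :: "nat \<Rightarrow> complex mat set" where
  "SL n = {X \<in> carrier_mat n n. det X = 1}"

lemma fun_algebra_sum:
  assumes "\<And>i. i \<in> I \<Longrightarrow> f i \<in> fun_algebra G"
  shows "(\<lambda>x. \<Sum>i\<in>I. f i x) \<in> fun_algebra G"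
  using assms
  by (induction I rule: infinite_finite_induct)
     (auto intro: fun_algebra.const fun_algebra.add)

lemma SL_mult: "A \<in> SL n \<Longrightarrow> B \<in> SL n \<Longrightarrow> A * B \<in> SL n"
  by (auto simp: SL_def det_mult)

lemma one_SL: "1\<^sub>m n \<in> SL n"
  by (auto simp: SL_def)

lemma entry_polynomials_translate:
  assumes f: "f \<in> entry_polynomials n" and A: "A \<in> carrier_mat n n" and B: "B \<in> carrier_mat n n"
  shows "\<exists>g\<in>entry_polynomials n. \<forall>X\<in>carrier_mat n n. f (A * X * B) = g X"
  using f unfolding entry_polynomials_def
proof (induction rule: fun_algebra.induct)
  case (gen g)
  then obtain i j where ij: "i < n" "j < n" and g: "g = (\<lambda>X. X $$ (i, j))" by auto
  let ?h = "\<lambda>X. \<Sum>l<n. A $$ (i, l) * (\<Sum>k<n. X $$ (l, k) * B $$ (k, j))"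
  have "?h \<in> fun_algebra {(\<lambda>X. X $$ (i, j)) | i j. i < n \<and> j < n}"
    by (intro fun_algebra_sum fun_algebra.mult fun_algebra.const fun_algebra.gen) auto
  moreover have "g (A * X * B) = ?h X" if "X \<in> carrier_mat n n" for X
    using that A B ij
    by (simp add: g scalar_prod_def atLeast0LessThan)
  ultimately show ?case by (intro bexI[of _ ?h]) simp_all
next
  case (const c)
  show ?case by (rule bexI[OF _ fun_algebra.const[of c]]) simp
next
  case (add f g)
  then obtain f' g' where
    "f' \<in> fun_algebra {(\<lambda>X. X $$ (i, j)) | i j. i < n \<and> j < n}"
    "\<forall>X\<in>carrier_mat n n. f (A * X * B) = f' X"
    "g' \<in> fun_algebra {(\<lambda>X. X $$ (i, j)) | i j. i < n \<and> j < n}"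
    "\<forall>X\<in>carrier_mat n n. g (A * X * B) = g' X"
    by blast
  then show ?case by (intro bexI[OF _ fun_algebra.add[of f' _ g']]) auto
next
  case (mult f g)
  then obtain f' g' where
    "f' \<in> fun_algebra {(\<lambda>X. X $$ (i, j)) | i j. i < n \<and> j < n}"
    "\<forall>X\<in>carrier_mat n n. f (A * X * B) = f' X"
    "g' \<in> fun_algebra {(\<lambda>X. X $$ (i, j)) | i j. i < n \<and> j < n}"
    "\<forall>X\<in>carrier_mat n n. g (A * X * B) = g' X"
    by blast
  then show ?case by (intro bexI[OF _ fun_algebra.mult[of f' _ g']]) auto
qed

lemma det_line_poly:
  assumes A: "A \<in> carrier_mat n n" and D: "D \<in> carrier_mat n n"
  shows "\<exists>p :: complex poly. \<forall>t. det (A + t \<cdot>\<^sub>m D) = poly p t"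
proof -
  let ?M = "mat n n (\<lambda>(i, j). [: A $$ (i, j), D $$ (i, j) :])"
  have "det (A + t \<cdot>\<^sub>m D) = poly (det ?M) t" for t
  proof -
    interpret comm_ring_hom "\<lambda>p :: complex poly. poly p t"
      by unfold_locales auto
    have "A + t \<cdot>\<^sub>m D = map_mat (\<lambda>p. poly p t) ?M"
      using A D by (intro eq_matI) auto
    then show ?thesis by (simp only: hom_det)
  qed
  then show ?thesis by blast
qed

lemma entry_polynomials_on_curve:
  assumes f: "f \<in> entry_polynomials n"
    and Q: "\<And>i j. i < n \<Longrightarrow> j < n \<Longrightarrow>
      \<exists>q :: complex poly. \<forall>t. poly p t \<noteq> 0 \<longrightarrow> Q t $$ (i, j) * poly p t = poly q t"
  shows "\<exists>k (F :: complex poly). \<forall>t. poly p t \<noteq> 0 \<longrightarrow> f (Q t) * poly p t ^ k = poly F t"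
  using f unfolding entry_polynomials_def
proof (induction rule: fun_algebra.induct)
  case (gen g)
  then obtain i j where "i < n" "j < n" "g = (\<lambda>X. X $$ (i, j))" by auto
  then show ?case using Q[of i j] by (metis power_one_right)
next
  case (const c)
  show ?case by (rule exI[of _ 0], rule exI[of _ "[:c:]"]) auto
next
  case (add f g)
  then obtain k F l G where
    FG: "\<And>t. poly p t \<noteq> 0 \<Longrightarrow> poly F t = f (Q t) * poly p t ^ k"
    "\<And>t. poly p t \<noteq> 0 \<Longrightarrow> poly G t = g (Q t) * poly p t ^ l" by metis
  have "\<forall>t. poly p t \<noteq> 0 \<longrightarrow>
      (f (Q t) + g (Q t)) * poly p t ^ (k + l) = poly (F * p ^ l + G * p ^ k) t"
    by (simp add: FG power_add algebra_simps)
  then show ?case by blast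
next
  case (mult f g)
  then obtain k F l G where
    FG: "\<And>t. poly p t \<noteq> 0 \<Longrightarrow> poly F t = f (Q t) * poly p t ^ k"
    "\<And>t. poly p t \<noteq> 0 \<Longrightarrow> poly G t = g (Q t) * poly p t ^ l" by metis
  have "\<forall>t. poly p t \<noteq> 0 \<longrightarrow>
      (f (Q t) * g (Q t)) * poly p t ^ (k + l) = poly (F * G) t"
    by (simp add: FG power_add algebra_simps)
  then show ?case by blast
qed

lemma SL_irreducible:
  assumes n: "n > 0"
    and f: "f \<in> entry_polynomials n" and g: "g \<in> entry_polynomials n"
    and A: "A \<in> SL n" "f A \<noteq> 0" and B: "B \<in> SL n" "g B \<noteq> 0"
  shows "\<exists>X\<in>SL n. f X * g X \<noteq> 0"
proof -
  have cA: "A \<in> carrier_mat n n" "det A = 1" and cB: "B \<in> carrier_mat n n" "det B = 1"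
    using A B by (auto simp: SL_def)
  let ?D = "B - A"
  have D: "?D \<in> carrier_mat n n" using cA cB by (auto intro: minus_carrier_mat)
  define P where "P t = A + t \<cdot>\<^sub>m ?D" for t
  have cP: "P t \<in> carrier_mat n n" for t using cA D by (auto simp: P_def)
  obtain p :: "complex poly" where p: "\<And>t. det (P t) = poly p t"
    using det_line_poly[OF cA(1) D] unfolding P_def by blast
  have P0: "P 0 = A" and P1: "P 1 = B"
    using cA cB by (auto simp: P_def intro!: eq_matI)
  have p01: "poly p 0 = 1" "poly p 1 = 1"
    using p[of 0] p[of 1] P0 P1 cA cB by auto
  define Q where "Q t = multrow_mat n 0 (1 / poly p t) * P t" for t
  have Q_entry: "Q t = multrow 0 (1 / poly p t) (P t)" for t
    unfolding Q_def by (rule multrow_mat[OF cP, symmetric])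
  have Q_SL: "Q t \<in> SL n" if "poly p t \<noteq> 0" for t
    using that n p[of t] cP[of t] unfolding SL_def Q_def
    by (auto simp: det_mult[OF _ cP] det_multrow_mat[OF n] intro!: mult_carrier_mat)
  have Qpoly: "\<exists>q :: complex poly. \<forall>t. poly p t \<noteq> 0 \<longrightarrow> Q t $$ (i, j) * poly p t = poly q t"
    if ij: "i < n" "j < n" for i j
  proof -
    define l where "l = [: A $$ (i, j), ?D $$ (i, j) :]"
    have Pij: "P t $$ (i, j) = poly l t" for t
      using ij cA cB by (auto simp: P_def l_def)
    have "poly p t \<noteq> 0 \<longrightarrow> Q t $$ (i, j) * poly p t = poly (if i = 0 then l else l * p) t" for t
      using ij carrier_matD[OF cP] Pij[of t] by (cases "i = 0") (auto simp: Q_entry)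
    then show ?thesis by blast
  qed
  obtain k F where F: "\<And>t. poly p t \<noteq> 0 \<Longrightarrow> f (Q t) * poly p t ^ k = poly F t"
    using entry_polynomials_on_curve[OF f Qpoly] by blast
  obtain l G where G: "\<And>t. poly p t \<noteq> 0 \<Longrightarrow> g (Q t) * poly p t ^ l = poly G t"
    using entry_polynomials_on_curve[OF g Qpoly] by blast
  have "Q 0 = A" "Q 1 = B"
    using cA cB cP by (auto simp: Q_entry P0 P1 p01 intro!: eq_matI)
  then have "poly F 0 \<noteq> 0" "poly G 1 \<noteq> 0"
    using F[of 0] G[of 1] A B by (auto simp: p01)
  then have "F * G * p \<noteq> 0" using p01 by auto
  then obtain t where t: "poly (F * G * p) t \<noteq> 0"
    using poly_all_0_iff_0 by blast
  then have pt: "poly p t \<noteq> 0" and "poly F t \<noteq> 0" "poly G t \<noteq> 0" by auto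
  then have "f (Q t) * g (Q t) \<noteq> 0" using F[OF pt] G[OF pt] by auto
  then show ?thesis using Q_SL[OF pt] by blast
qed

text \<open>
  A regular function on \<open>SL\<^sub>n\<close> is the restriction of a polynomial in the matrix entries; it is
  represented by its extension by zero.
\<close>

typedef ('n::finite) regfun =
  "{f. \<exists>g\<in>entry_polynomials CARD('n). f = (\<lambda>X. if X \<in> SL CARD('n) then g X else 0)}"
  unfolding entry_polynomials_def by (auto intro!: exI[of _ "\<lambda>_. 0"] bexI[OF _ fun_algebra.const[of 0]])

setup_lifting type_definition_regfun

instantiation regfun :: (finite) idom
begin

lift_definition zero_regfun :: "'a regfun" is "\<lambda>_. 0"
  unfolding entry_polynomials_def by (auto intro!: bexI[OF _ fun_algebra.const[of 0]])

lift_definition one_regfun :: "'a regfun" is "\<lambda>X. if X \<in> SL CARD('a) then 1 else 0"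
  unfolding entry_polynomials_def by (auto intro!: bexI[OF _ fun_algebra.const[of 1]])

lift_definition plus_regfun :: "'a regfun \<Rightarrow> 'a regfun \<Rightarrow> 'a regfun" is "\<lambda>f g X. f X + g X"
  unfolding entry_polynomials_def by (force intro!: bexI[OF _ fun_algebra.add])

lift_definition times_regfun :: "'a regfun \<Rightarrow> 'a regfun \<Rightarrow> 'a regfun" is "\<lambda>f g X. f X * g X"
  unfolding entry_polynomials_def by (force intro!: bexI[OF _ fun_algebra.mult])

lift_definition uminus_regfun :: "'a regfun \<Rightarrow> 'a regfun" is "\<lambda>f X. - f X"
  unfolding entry_polynomials_def
  by (force intro!: bexI[OF _ fun_algebra.mult[OF fun_algebra.const[of "- 1"]]])

definition minus_regfun :: "'a regfun \<Rightarrow> 'a regfun \<Rightarrow> 'a regfun" where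
  "minus_regfun f g = f + - g"

instance
proof
  fix a b c :: "'a regfun"
  show "a + b + c = a + (b + c)" by transfer (simp add: add.assoc)
  show "a + b = b + a" by transfer (simp add: add.commute)
  show "0 + a = a" by transfer simp
  show "- a + a = 0" by transfer simp
  show "a - b = a + - b" by (simp add: minus_regfun_def)
  show "a * b * c = a * (b * c)" by transfer (simp add: mult.assoc)
  show "a * b = b * a" by transfer (simp add: mult.commute)
  show "1 * a = a" by transfer auto
  show "(a + b) * c = a * c + b * c" by transfer (simp add: distrib_right)
  show "(0 :: 'a regfun) \<noteq> 1"
    using one_SL[of "CARD('a)"] by transfer (metis zero_neq_one)
  show "0 * a = 0" by transfer simp
  show "a * 0 = 0" by transfer simp
  show "a * (b + c) = a * b + a * c" by transfer (simp add: distrib_left)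
  show "a * b \<noteq> 0" if "a \<noteq> 0" "b \<noteq> 0"
    using that
  proof transfer
    fix a b :: "complex mat \<Rightarrow> complex"
    assume "\<exists>g\<in>entry_polynomials CARD('a). a = (\<lambda>X. if X \<in> SL CARD('a) then g X else 0)"
      "\<exists>g\<in>entry_polynomials CARD('a). b = (\<lambda>X. if X \<in> SL CARD('a) then g X else 0)"
      and ne: "a \<noteq> (\<lambda>_. 0)" "b \<noteq> (\<lambda>_. 0)"
    then obtain f g where f: "f \<in> entry_polynomials CARD('a)"
        "a = (\<lambda>X. if X \<in> SL CARD('a) then f X else 0)"
      and g: "g \<in> entry_polynomials CARD('a)"
        "b = (\<lambda>X. if X \<in> SL CARD('a) then g X else 0)" by blast
    from ne obtain A B where "A \<in> SL CARD('a)" "f A \<noteq> 0" "B \<in> SL CARD('a)" "g B \<noteq> 0"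
      unfolding f(2) g(2) by (metis (no_types, lifting))
    from SL_irreducible[OF _ f(1) g(1) this]
    obtain X where "X \<in> SL CARD('a)" "f X * g X \<noteq> 0" by auto
    then have "a X * b X \<noteq> 0" by (simp add: f(2) g(2))
    then show "(\<lambda>X. a X * b X) \<noteq> (\<lambda>_. 0)" by metis
  qed
qed

end

type_synonym 'n ratfun = "'n regfun fract"

lift_definition reg_const :: "complex \<Rightarrow> ('n::finite) regfun"
  is "\<lambda>c X. if X \<in> SL CARD('n) then c else 0"
  unfolding entry_polynomials_def by (auto intro!: bexI[OF _ fun_algebra.const])

lift_definition reg_entry :: "nat \<Rightarrow> nat \<Rightarrow> ('n::finite) regfun"
  is "\<lambda>i j X. if X \<in> SL CARD('n) \<and> i < CARD('n) \<and> j < CARD('n) then X $$ (i, j) else 0"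
  subgoal for i j
    unfolding entry_polynomials_def
    by (intro bexI[of _ "if i < CARD('n) \<and> j < CARD('n) then (\<lambda>X. X $$ (i, j)) else (\<lambda>_. 0)"])
      (auto intro: fun_algebra.gen fun_algebra.const)
  done

lift_definition reg_translate ::
  "complex mat \<Rightarrow> complex mat \<Rightarrow> ('n::finite) regfun \<Rightarrow> 'n regfun"
  is "\<lambda>A B f X. if A \<in> SL CARD('n) \<and> B \<in> SL CARD('n) \<and> X \<in> SL CARD('n) then f (A * X * B) else 0"
  subgoal premises prems for A B f
  proof (cases "A \<in> SL CARD('n) \<and> B \<in> SL CARD('n)")
    case True
    obtain h where h: "h \<in> entry_polynomials CARD('n)"
      "f = (\<lambda>X. if X \<in> SL CARD('n) then h X else 0)" using prems by blast
    obtain g where g: "g \<in> entry_polynomials CARD('n)"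
      "\<forall>X\<in>carrier_mat CARD('n) CARD('n). h (A * X * B) = g X"
      using entry_polynomials_translate[OF h(1), of A B] True by (auto simp: SL_def)
    have "(\<lambda>X. if A \<in> SL CARD('n) \<and> B \<in> SL CARD('n) \<and> X \<in> SL CARD('n) then f (A * X * B) else 0)
      = (\<lambda>X. if X \<in> SL CARD('n) then g X else 0)"
    proof
      fix X
      show "(if A \<in> SL CARD('n) \<and> B \<in> SL CARD('n) \<and> X \<in> SL CARD('n) then f (A * X * B) else 0)
        = (if X \<in> SL CARD('n) then g X else 0)"
      proof (cases "X \<in> SL CARD('n)")
        case X: True
        then have "A * X * B \<in> SL CARD('n)" using True by (intro SL_mult) auto
        moreover have "X \<in> carrier_mat CARD('n) CARD('n)" using X by (auto simp: SL_def)
        ultimately show ?thesis using True X g(2) by (simp add: h(2))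
      qed simp
    qed
    then show ?thesis using g(1) by blast
  next
    case False
    then show ?thesis
      unfolding entry_polynomials_def by (intro bexI[OF _ fun_algebra.const[of 0]]) auto
  qed
  done

definition const :: "complex \<Rightarrow> ('n::finite) ratfun" where
  "const c = Fract (reg_const c) 1"

definition coord_matrix :: "('n::finite) ratfun mat" where
  "coord_matrix = mat CARD('n) CARD('n) (\<lambda>(i, j). Fract (reg_entry i j) 1)"

text \<open>\<open>f(X) \<mapsto> f(AXB)\<close> on rational functions; the lemma \<open>translate_Fract\<close> shows that the
  description below determines the result.\<close>

definition translate :: "complex mat \<Rightarrow> complex mat \<Rightarrow> ('n::finite) ratfun \<Rightarrow> 'n ratfun" where
  "translate A B q =
    (THE q'. \<exists>f g. g \<noteq> 0 \<and> q = Fract f g \<and> q' = Fract (reg_translate A B f) (reg_translate A B g))"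

lemma reg_translate_mult:
  "reg_translate A B (f * g) = reg_translate A B f * reg_translate A B (g :: ('n::finite) regfun)"
  by transfer auto

lemma SL_inverse:
  assumes "A \<in> SL n"
  shows "\<exists>A'\<in>SL n. A * A' = 1\<^sub>m n \<and> A' * A = 1\<^sub>m n"
proof -
  have A: "A \<in> carrier_mat n n" "det A = 1" using assms by (auto simp: SL_def)
  have "det A \<noteq> 0" using A(2) by simp
  from det_non_zero_imp_unit[OF A(1) this, where b = "()"]
  obtain A' where A': "A' \<in> carrier_mat n n" "A' * A = 1\<^sub>m n" "A * A' = 1\<^sub>m n"
    unfolding Units_def ring_mat_def by auto
  have "det A' = 1" using det_mult[OF A(1) A'(1)] A'(3) A(2) by simp
  then show ?thesis using A' by (auto simp: SL_def)
qed

lemma translate_fun_eq_0: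
  assumes A: "A \<in> SL n" and B: "B \<in> SL n" and Y: "Y \<in> SL n"
    and eq: "\<And>X. X \<in> SL n \<Longrightarrow> f (A * X * B) = (0 :: complex)"
  shows "f Y = 0"
proof -
  obtain A' where A': "A' \<in> SL n" "A * A' = 1\<^sub>m n" using SL_inverse[OF A] by blast
  obtain B' where B': "B' \<in> SL n" "B' * B = 1\<^sub>m n" using SL_inverse[OF B] by blast
  have c: "A \<in> carrier_mat n n" "A' \<in> carrier_mat n n" "B \<in> carrier_mat n n"
    "B' \<in> carrier_mat n n" "Y \<in> carrier_mat n n"
    using A B Y A' B' by (auto simp: SL_def)
  have AY: "A' * Y \<in> carrier_mat n n" using c by auto
  have "A * (A' * Y * B') * B = A * (A' * Y) * B' * B"
    using assoc_mult_mat[OF c(1) AY c(4)] by simp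
  also have "\<dots> = (A * A') * Y * B' * B"
    using assoc_mult_mat[OF c(1,2,5)] by simp
  also have "\<dots> = Y * B' * B" using A'(2) c by simp
  also have "\<dots> = Y * (B' * B)" using assoc_mult_mat[OF c(5,4,3)] by simp
  also have "\<dots> = Y" using B'(2) c by simp
  finally have "A * (A' * Y * B') * B = Y" .
  moreover have "A' * Y * B' \<in> SL n" using A' B' Y by (intro SL_mult)
  ultimately show ?thesis using eq[of "A' * Y * B'"] by simp
qed

lemma reg_translate_eq_0_iff:
  fixes f :: "('n::finite) regfun"
  assumes A: "A \<in> SL CARD('n)" and B: "B \<in> SL CARD('n)"
  shows "reg_translate A B f = 0 \<longleftrightarrow> f = 0"
proof
  assume "reg_translate A B f = 0"
  then have "Rep_regfun (reg_translate A B f) X = 0" for X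
    by (simp add: zero_regfun.rep_eq)
  then have "Rep_regfun f (A * X * B) = 0" if "X \<in> SL CARD('n)" for X
    using A B that by (simp add: reg_translate.rep_eq) metis
  then have "Rep_regfun f Y = 0" if "Y \<in> SL CARD('n)" for Y
    using translate_fun_eq_0[OF A B that] by blast
  moreover have "Rep_regfun f Y = 0" if "Y \<notin> SL CARD('n)" for Y
    using Rep_regfun[of f] that by auto
  ultimately have "Rep_regfun f = Rep_regfun 0"
    by (auto simp: zero_regfun.rep_eq fun_eq_iff)
  then show "f = 0" by (metis Rep_regfun_inverse)
next
  assume "f = 0"
  then show "reg_translate A B f = 0" by transfer auto
qed

lemma translate_Fract:
  fixes f g :: "('n::finite) regfun"
  assumes A: "A \<in> SL CARD('n)" and B: "B \<in> SL CARD('n)" and g: "g \<noteq> 0"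
  shows "translate A B (Fract f g) = Fract (reg_translate A B f) (reg_translate A B g)"
  unfolding translate_def
proof (rule the_equality)
  fix q' assume "\<exists>f' g'. g' \<noteq> 0 \<and> Fract f g = Fract f' g' \<and>
    q' = Fract (reg_translate A B f') (reg_translate A B g')"
  then obtain f' g' where g': "g' \<noteq> 0" and "Fract f g = Fract f' g'"
    and q': "q' = Fract (reg_translate A B f') (reg_translate A B g')" by blast
  then have "reg_translate A B (f * g') = reg_translate A B (f' * g)"
    using g by (simp add: eq_fract)
  then show "q' = Fract (reg_translate A B f) (reg_translate A B g)"
    using g g' by (simp add: q' eq_fract reg_translate_mult reg_translate_eq_0_iff[OF A B])
qed (use g in blast)

definition field_automorphism :: "(('n::finite) ratfun \<Rightarrow> 'n ratfun) \<Rightarrow> bool" where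
  "field_automorphism \<phi> \<longleftrightarrow> bij \<phi> \<and>
    (\<forall>f g. \<phi> (f + g) = \<phi> f + \<phi> g) \<and> (\<forall>f g. \<phi> (f * g) = \<phi> f * \<phi> g) \<and>
    (\<forall>c. \<phi> (const c) = const c)"


section \<open>Seeds and cluster structures\<close>

text \<open>
  A seed is given by its extended cluster, indexed by the vertices of the quiver, and by its
  exchange matrix, whose rows at frozen vertices are zero. No algebraic independence is imposed
  on the extended cluster, so \<open>cluster_structure\<close> contains every pair that arises by iterated
  mutation.
\<close>

type_synonym ('v, 'k) seed = "('v \<Rightarrow> 'k) \<times> ('v \<Rightarrow> 'v \<Rightarrow> int)"

definition mutation :: "'v set \<Rightarrow> 'v set \<Rightarrow> 'v \<Rightarrow> ('v, 'k::field) seed \<Rightarrow> ('v, 'k) seed" where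
  "mutation V Mut k = (\<lambda>(y, b).
    (y(k := ((\<Prod>j\<in>{j\<in>V. b k j > 0}. y j ^ nat (b k j)) +
              (\<Prod>j\<in>{j\<in>V. b k j < 0}. y j ^ nat (- b k j))) / y k),
     \<lambda>i j. if i \<notin> Mut then 0
       else if i = k \<or> j = k then - b i j
       else b i j + (\<bar>b i k\<bar> * b k j + b i k * \<bar>b k j\<bar>) div 2))"

inductive_set cluster_structure ::
  "'v set \<Rightarrow> 'v set \<Rightarrow> ('v, 'k::field) seed \<Rightarrow> ('v, 'k) seed set"
  for V Mut :: "'v set" and S :: "('v, 'k) seed" where
  initial: "S \<in> cluster_structure V Mut S"
| mutate: "S' \<in> cluster_structure V Mut S \<Longrightarrow> k \<in> Mut \<Longrightarrow>
    mutation V Mut k S' \<in> cluster_structure V Mut S"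


section \<open>Toric actions\<close>

definition torus :: "nat \<Rightarrow> (nat \<Rightarrow> complex) set" where
  "torus r = {..<r} \<rightarrow>\<^sub>E (- {0})"

definition torus_one :: "nat \<Rightarrow> nat \<Rightarrow> complex" where
  "torus_one r = (\<lambda>a\<in>{..<r}. 1)"

definition torus_mult :: "nat \<Rightarrow> (nat \<Rightarrow> complex) \<Rightarrow> (nat \<Rightarrow> complex) \<Rightarrow> nat \<Rightarrow> complex" where
  "torus_mult r d e = (\<lambda>a\<in>{..<r}. d a * e a)"

text \<open>The list \<open>vs\<close> enumerates the index set of the extended clusters; it fixes the order of the
  rows of the weight matrix.\<close>

definition global_toric_action ::
  "'v list \<Rightarrow> ('v, ('n::finite) ratfun) seed set \<Rightarrow> nat \<Rightarrow>
    ((nat \<Rightarrow> complex) \<Rightarrow> 'n ratfun \<Rightarrow> 'n ratfun) \<Rightarrow> bool" where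
  "global_toric_action vs C r \<rho> \<longleftrightarrow>
    (\<forall>d\<in>torus r. field_automorphism (\<rho> d)) \<and>
    \<rho> (torus_one r) = id \<and>
    (\<forall>d\<in>torus r. \<forall>e\<in>torus r. \<rho> (torus_mult r d e) = \<rho> d \<circ> \<rho> e) \<and>
    (\<forall>(y, b)\<in>C. \<exists>w :: 'v \<Rightarrow> nat \<Rightarrow> int.
      vec_space.rank (length vs)
        (mat_of_rows r (map (\<lambda>v. vec r (\<lambda>a. of_int (w v a))) vs) :: rat mat) = r \<and>
      (\<forall>v\<in>set vs. \<forall>d\<in>torus r. \<rho> d (y v) = const (\<Prod>a<r. d a powi w v a) * y v))"


section \<open>The torus \<open>H\<^sub>T\<close>\<close>

definition cartan :: "nat \<Rightarrow> complex mat set" where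
  "cartan n = {h \<in> carrier_mat n n. diagonal_mat h \<and> (\<Sum>i<n. h $$ (i, i)) = 0}"

definition simple_root :: "nat \<Rightarrow> complex mat \<Rightarrow> complex" where
  "simple_root i h = h $$ (i - 1, i - 1) - h $$ (i, i)"

definition h_T :: "nat \<Rightarrow> nat \<Rightarrow> nat \<Rightarrow> complex mat set" where
  "h_T n \<alpha> \<beta> = {h \<in> cartan n. simple_root \<alpha> h = simple_root \<beta> h}"

text \<open>The exponential of a diagonal matrix.\<close>

definition exp_diag :: "complex mat \<Rightarrow> complex mat" where
  "exp_diag h = mat_diag (dim_row h) (\<lambda>i. exp (h $$ (i, i)))"

definition H_T :: "nat \<Rightarrow> nat \<Rightarrow> nat \<Rightarrow> complex mat set" where
  "H_T n \<alpha> \<beta> = exp_diag ` h_T n \<alpha> \<beta>"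

definition laurent_polynomials :: "nat \<Rightarrow> ((nat \<Rightarrow> complex) \<Rightarrow> complex) set" where
  "laurent_polynomials r =
    fun_algebra ({(\<lambda>d. d a) | a. a < r} \<union> {(\<lambda>d. inverse (d a)) | a. a < r})"

definition pair_polynomials :: "nat \<Rightarrow> (complex mat \<times> complex mat \<Rightarrow> complex) set" where
  "pair_polynomials n =
    fun_algebra ({(\<lambda>P. fst P $$ (i, j)) | i j. i < n \<and> j < n} \<union>
                 {(\<lambda>P. snd P $$ (i, j)) | i j. i < n \<and> j < n})"

text \<open>
  An identification of \<open>(\<complex>\<^sup>*)\<^sup>r\<close> with a group \<open>K\<close> of pairs of matrices is an isomorphism of
  algebraic groups: the entries of \<open>\<iota> d\<close> are regular functions of \<open>d\<close>, and the coordinates of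
  the inverse map are polynomials in the matrix entries. No denominators are needed for the
  latter, since \<open>K\<close> will be a closed subgroup of \<open>SL\<^sub>n \<times> SL\<^sub>n\<close>.
\<close>

definition torus_identification ::
  "nat \<Rightarrow> nat \<Rightarrow> (complex mat \<times> complex mat) set \<Rightarrow>
    ((nat \<Rightarrow> complex) \<Rightarrow> complex mat \<times> complex mat) \<Rightarrow> bool" where
  "torus_identification n r K \<iota> \<longleftrightarrow>
    bij_betw \<iota> (torus r) K \<and>
    (\<forall>d\<in>torus r. \<forall>e\<in>torus r.
      \<iota> (torus_mult r d e) = (fst (\<iota> d) * fst (\<iota> e), snd (\<iota> d) * snd (\<iota> e))) \<and>
    (\<forall>i<n. \<forall>j<n.
      (\<exists>f\<in>laurent_polynomials r. \<forall>d\<in>torus r. fst (\<iota> d) $$ (i, j) = f d) \<and>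
      (\<exists>f\<in>laurent_polynomials r. \<forall>d\<in>torus r. snd (\<iota> d) $$ (i, j) = f d)) \<and>
    (\<forall>a<r. \<exists>g\<in>pair_polynomials n. \<forall>d\<in>torus r. d a = g (\<iota> d))"


section \<open>The initial seed\<close>

text \<open>The submatrix with rows \<open>r\<^sub>1, \<dots>, r\<^sub>2\<close> and columns \<open>c\<^sub>1, \<dots>, c\<^sub>2\<close>, numbered from 1.\<close>

definition block :: "'a mat \<Rightarrow> nat \<Rightarrow> nat \<Rightarrow> nat \<Rightarrow> nat \<Rightarrow> 'a mat" where
  "block X r\<^sub>1 r\<^sub>2 c\<^sub>1 c\<^sub>2 =
    mat (r\<^sub>2 + 1 - r\<^sub>1) (c\<^sub>2 + 1 - c\<^sub>1) (\<lambda>(a, b). X $$ (r\<^sub>1 + a - 1, c\<^sub>1 + b - 1))"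

definition append_cols :: "'a::zero mat \<Rightarrow> 'a mat \<Rightarrow> 'a mat" (infixr \<open>@\<^sub>c\<close> 65) where
  "A @\<^sub>c B = four_block_mat A B (0\<^sub>m 0 (dim_col A)) (0\<^sub>m 0 (dim_col B))"

definition M_matrix :: "nat \<Rightarrow> 'a::zero mat \<Rightarrow> nat \<Rightarrow> nat \<Rightarrow> 'a mat" where
  "M_matrix n X i j =
    (if j > i then block X i (n - j + i) j n else block X i n j (n - i + j))"

text \<open>The first array is assembled from its upper and lower parts, the second one from its left
  and right parts, which is where the zero blocks of each array fit together.\<close>

definition M_bar :: "nat \<Rightarrow> nat \<Rightarrow> nat \<Rightarrow> 'a::zero mat \<Rightarrow> nat \<Rightarrow> nat \<Rightarrow> 'a mat" where
  "M_bar n \<alpha> \<beta> X i j =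
    (if 1 \<le> j \<and> j \<le> \<alpha> \<and> i = n + j - \<alpha> then
       (let \<mu> = n - \<beta> in
         (block X i n j (\<alpha> + 1) @\<^sub>c 0\<^sub>m (n - i + 1) (\<mu> - 1)) @\<^sub>r
         (0\<^sub>m \<mu> (n - i) @\<^sub>c block X 1 \<mu> \<beta> n))
     else if 1 \<le> i \<and> i \<le> \<beta> \<and> j = n + i - \<beta> then
       (let \<mu> = n - \<alpha> in
         (block X i (\<beta> + 1) j n @\<^sub>r 0\<^sub>m (\<mu> - 1) (n - j + 1)) @\<^sub>c
         (0\<^sub>m (n - j) \<mu> @\<^sub>r block X \<alpha> n 1 \<mu>))
     else M_matrix n X i j)"

text \<open>
  If \<open>n = 2 * \<beta>\<close>, the vertex \<open>(1, \<beta> + 1)\<close> lies on the second modified diagonal, and its function is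
  no longer the minor \<open>X\<^bsub>[1,\<mu>]\<^esub>\<^bsup>[\<beta>+1,n]\<^esup>\<close> that occurs in the Laplace expansion of the first array;
  similarly for \<open>n = 2 * \<alpha>\<close> and \<open>(\<alpha> + 1, 1)\<close>. The two terms of some exchange relation then have
  different weights under \<open>H\<^sub>T \<times> H\<^sub>T\<close>. For \<open>n = 4\<close>, \<open>\<alpha> = 1\<close>, \<open>\<beta> = 2\<close> this happens at the vertex
  \<open>(4, 2)\<close>, where with \<open>h = diag(t\<^sub>1, t\<^sub>2, t\<^sub>3, t\<^sub>4)\<close> acting from the right the weights differ by
  \<open>t\<^sub>1 t\<^sub>2 t\<^sub>3\<close>. These two values of \<open>n\<close> must therefore be excluded for the toric action to be global.
\<close>

definition vertices :: "nat \<Rightarrow> (nat \<times> nat) list" where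
  "vertices n = [(i, j). i \<leftarrow> [1..<n + 1], j \<leftarrow> [1..<n + 1], (i, j) \<noteq> (1, 1)]"

definition border :: "nat \<times> nat \<Rightarrow> bool" where
  "border v \<longleftrightarrow> fst v = 1 \<or> snd v = 1"

definition mutable_vertices :: "nat \<Rightarrow> nat \<Rightarrow> nat \<Rightarrow> (nat \<times> nat) set" where
  "mutable_vertices n \<alpha> \<beta> =
    {v \<in> set (vertices n). \<not> border v} \<union> {(\<alpha> + 1, 1), (1, \<beta> + 1)}"

text \<open>
  Arrows between vertices of the first row or column are omitted before \<open>(\<alpha> + 1, 1)\<close> and
  \<open>(1, \<beta> + 1)\<close> become mutable, so of these only the two listed explicitly occur. For \<open>n \<ge> 3\<close>
  no arrow arises twice, so a set of arrows suffices.
\<close>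

definition quiver :: "nat \<Rightarrow> nat \<Rightarrow> nat \<Rightarrow> ((nat \<times> nat) \<times> (nat \<times> nat)) set" where
  "quiver n \<alpha> \<beta> =
    (let V = set (vertices n) in
      ({(v, w). \<not> (border v \<and> border w) \<and>
          (w = (fst v + 1, snd v) \<or> w = (fst v, snd v + 1) \<or> v = (fst w + 1, snd w + 1))} \<union>
       {((\<alpha>, 1), (\<alpha> + 1, 1)), ((1, \<beta>), (1, \<beta> + 1)),
        ((n, \<alpha> + 1), (1, \<beta> + 1)), ((1, \<beta> + 1), (n, \<alpha>)),
        ((\<beta> + 1, n), (\<alpha> + 1, 1)), ((\<alpha> + 1, 1), (\<beta>, n))}) \<inter> V \<times> V)"

definition initial_seed :: "nat \<Rightarrow> nat \<Rightarrow> (nat \<times> nat, ('n::finite) ratfun) seed" where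
  "initial_seed \<alpha> \<beta> =
    (let n = CARD('n) in
      (\<lambda>(i, j). det (M_bar n \<alpha> \<beta> coord_matrix i j),
       \<lambda>v w. if v \<in> mutable_vertices n \<alpha> \<beta>
         then of_bool ((v, w) \<in> quiver n \<alpha> \<beta>) - of_bool ((w, v) \<in> quiver n \<alpha> \<beta>)
         else 0))"

definition C_T :: "nat \<Rightarrow> nat \<Rightarrow> (nat \<times> nat, ('n::finite) ratfun) seed set" where
  "C_T \<alpha> \<beta> =
    cluster_structure (set (vertices CARD('n))) (mutable_vertices CARD('n) \<alpha> \<beta>) (initial_seed \<alpha> \<beta>)"

end

theory Submission
  imports Defs "HOL-Library.Function_Algebras"
begin

text \<open>
  Let \<open>\<iota>\<close> identify \<open>(\<complex>\<^sup>*)\<^sup>r\<close>, \<open>r = 2 (n - 2)\<close>, with \<open>H\<^sub>T \<times> H\<^sub>T\<close>. The diagonal entries of the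
  two components of \<open>\<iota> d\<close> are Laurent polynomials in \<open>d\<close>, multiplicative and nowhere zero, hence
  monomials (\<open>laurent_character_is_monomial\<close>). Write \<open>P\<^sub>1, \<dots>, P\<^sub>n\<close> and \<open>Q\<^sub>1, \<dots>, Q\<^sub>n\<close> for their
  exponent vectors in \<open>\<int>\<^sup>r\<close>. The equations of \<open>H\<^sub>T\<close> become \<open>\<Sum>\<^sub>i P\<^sub>i = 0\<close> and
  \<open>P\<^sub>\<alpha> - P\<^sub>\<alpha>\<^sub>+\<^sub>1 = P\<^sub>\<beta> - P\<^sub>\<beta>\<^sub>+\<^sub>1\<close>, and the same for \<open>Q\<close> (\<open>H_T_exponents\<close>).

  \<^emph>\<open>The initial cluster is semi-invariant.\<close> A minor is multiplied by the monomial whose exponent is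
  the sum of the \<open>P\<^sub>i\<close> over its rows and of the \<open>Q\<^sub>j\<close> over its columns; for the minor \<open>M\<^sub>i\<^sub>j\<close> this is
  a sum \<open>m\<^sub>i\<^sub>j\<close> along a diagonal, so that \<open>m\<^sub>i\<^sub>j = P\<^sub>i + Q\<^sub>j + m\<^sub>i\<^sub>+\<^sub>1\<^sub>,\<^sub>j\<^sub>+\<^sub>1\<close>. The arrays with two
  blocks share two columns that carry \<open>Q\<^sub>\<alpha>, Q\<^sub>\<alpha>\<^sub>+\<^sub>1\<close> in one block and \<open>Q\<^sub>\<beta>, Q\<^sub>\<beta>\<^sub>+\<^sub>1\<close> in the
  other (or two rows, with \<open>P\<close>). By the equation of \<open>H\<^sub>T\<close> these differ by a constant shift, which
  moves to the rows of one block, so the determinant is still semi-invariant; its weight is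
  \<open>m\<^sub>i\<^sub>j + m\<^sub>1\<^sub>,\<^sub>\<beta>\<^sub>+\<^sub>1\<close> or \<open>m\<^sub>i\<^sub>j + m\<^sub>\<alpha>\<^sub>+\<^sub>1\<^sub>,\<^sub>1\<close> (\<open>det_M_bar_scaled\<close>).

  \<^emph>\<open>The initial exchange relations are homogeneous.\<close> Around an inner vertex the recursion for
  \<open>m\<close> makes the weights cancel. The additional summands on the two modified diagonals cancel
  except where a diagonal meets the last row or column, and there the additional arrows at
  \<open>(1, \<beta> + 1)\<close> and \<open>(\<alpha> + 1, 1)\<close> compensate. This uses that these two vertices carry ordinary
  minors, that is, \<open>2 \<beta> \<noteq> n\<close> and \<open>2 \<alpha> \<noteq> n\<close>. At these two vertices themselves the relation is a
  further instance of the equation of \<open>H\<^sub>T\<close> (\<open>exchange_homogeneous\<close>).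

  \<^emph>\<open>Mutation preserves all this.\<close> If both monomials of an exchange relation have the same weight,
  the new variable is semi-invariant, and the mutated exchange matrix annihilates the new weights.
  The new weights arise from the old ones by an invertible integral substitution, so the rank of
  the weight matrix does not change (\<open>compatible_weights_mutation\<close>).

  \<^emph>\<open>The rank is \<open>r\<close>.\<close> The main diagonal and the one below it consist of ordinary minors, and their
  weights already determine all \<open>P\<^sub>i\<close> and \<open>Q\<^sub>j\<close> (\<open>initial_weights_trivial_kernel\<close>). A vector in the
  kernel of the weight matrix would therefore give, after clearing denominators, a one-parameter
  subgroup of the torus that \<open>\<iota>\<close> maps to the identity, contradicting injectivity.

  An identification exists because on \<open>h\<^sub>T\<close> two of the diagonal entries are integral combinations
  of the remaining \<open>n - 2\<close>, which thus serve as coordinates (\<open>h_T_coordinates\<close>).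
\<close>

section \<open>Rank and common denominators\<close>

text \<open>
  The columns of a matrix with trivial kernel are distinct and linearly independent. Triviality of
  the kernel is the form of the rank condition that is easy to carry through a mutation.
\<close>

lemma rank_eq_of_trivial_kernel:
  fixes w :: "'v \<Rightarrow> nat \<Rightarrow> int"
  assumes ker: "\<And>x :: nat \<Rightarrow> rat. (\<And>v. v \<in> set vs \<Longrightarrow> (\<Sum>a<r. of_int (w v a) * x a) = 0) \<Longrightarrow>
    \<forall>a<r. x a = 0"
  shows "vec_space.rank (length vs)
    (mat_of_rows r (map (\<lambda>v. vec r (\<lambda>a. of_int (w v a))) vs) :: rat mat) = r"
proof -
  define A :: "rat mat" where "A = mat_of_rows r (map (\<lambda>v. vec r (\<lambda>a. of_int (w v a))) vs)"
  interpret vec_space "TYPE(rat)" "length vs" .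
  have A: "A \<in> carrier_mat (length vs) r"
    unfolding A_def by (metis length_map mat_of_rows_carrier(1))
  have A_entry: "A $$ (i, a) = of_int (w (vs ! i) a)" if "i < length vs" "a < r" for i a
    using that by (simp add: A_def mat_of_rows_def)
  have dist: "distinct (cols A)"
  proof (rule ccontr)
    assume "\<not> distinct (cols A)"
    then obtain a b where ab: "a < r" "b < r" "a \<noteq> b" "col A a = col A b"
      using A unfolding distinct_conv_nth by auto
    have eq: "w v a = w v b" if "v \<in> set vs" for v
    proof -
      from that obtain i where i: "i < length vs" "v = vs ! i"
        by (metis in_set_conv_nth)
      have "col A a $ i = col A b $ i" using ab by simp
      then have "A $$ (i, a) = A $$ (i, b)" using i ab(1,2) A by simp
      then show ?thesis using i ab(1,2) by (simp only: A_entry of_int_eq_iff)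
    qed
    have "(\<Sum>c<r. of_int (w v c) * (of_bool (c = a) - of_bool (c = b))) = (0 :: rat)"
      if "v \<in> set vs" for v
    proof -
      have "(\<Sum>c<r. of_int (w v c) * of_bool (c = e)) = (of_int (w v e) :: rat)" if "e < r" for e
        using that by (subst sum.remove[of _ e]) auto
      then show ?thesis using eq[OF that] ab(1,2) by (simp add: right_diff_distrib sum_subtractf)
    qed
    from ker[of "\<lambda>c. of_bool (c = a) - of_bool (c = b)", OF this] ab(1,3) show False by force
  qed
  have "lin_indpt (set (cols A))"
  proof
    assume "lin_dep (set (cols A))"
    from lin_depE[OF A this dist] obtain x where
      x: "x \<in> carrier_vec r" "x \<noteq> 0\<^sub>v r" "A *\<^sub>v x = 0\<^sub>v (length vs)" by blast
    have "(\<Sum>a<r. of_int (w v a) * x $ a) = 0" if v: "v \<in> set vs" for v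
    proof -
      from v obtain i where i: "i < length vs" "v = vs ! i"
        by (metis in_set_conv_nth)
      have "(A *\<^sub>v x) $ i = 0" using x i by simp
      then show ?thesis using i A x(1)
        by (simp add: scalar_prod_def A_entry lessThan_atLeast0)
    qed
    from ker[of "\<lambda>a. x $ a", OF this] have "x = 0\<^sub>v r" using x(1) by (intro eq_vecI) auto
    then show False using x(2) by simp
  qed
  from lin_indpt_full_rank[OF A dist this] show ?thesis by (simp add: A_def)
qed

lemma common_denominator:
  fixes x :: "nat \<Rightarrow> rat"
  shows "\<exists>D>0. \<exists>y :: nat \<Rightarrow> int. \<forall>a<r. x a * of_nat D = of_int (y a)"
proof (induction r)
  case 0
  then show ?case by (intro exI[of _ 1]) auto
next
  case (Suc r)
  then obtain D y where Dy: "D > 0" "\<forall>a<r. x a * of_nat D = of_int (y a)" by blast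
  obtain p q where "quotient_of (x r) = (p, q)" by force
  then have pq: "q > 0" "x r = of_int p / of_int q"
    using quotient_of_denom_pos quotient_of_div by blast+
  define y' where "y' a = (if a = r then p * int D else y a * q)" for a
  have q: "(of_nat (nat q) :: rat) = of_int q" using pq(1) by simp
  have "x a * of_nat (D * nat q) = of_int (y' a)" if "a < Suc r" for a
  proof (cases "a = r")
    case True
    have "x r * of_int q = of_int p" using pq by (simp only: pq(2)) simp
    then have "of_nat D * (x r * of_int q) = of_nat D * of_int p" by (rule arg_cong)
    then show ?thesis using True by (simp only: of_nat_mult q y'_def refl if_True of_int_mult of_int_of_nat_eq mult_ac)
  next
    case False
    then have "x a * of_nat D = of_int (y a)" using that Dy(2) by simp
    then have "(x a * of_nat D) * of_int q = of_int (y a) * of_int q" by (rule arg_cong)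
    then show ?thesis using False by (simp only: of_nat_mult q y'_def if_False of_int_mult mult_ac)
  qed
  moreover have "D * nat q > 0" using Dy pq by simp
  ultimately show ?case by blast
qed


section \<open>Characters of the torus\<close>

text \<open>
  The point of the \<open>a\<close>-th one-parameter subgroup \<open>(1, \<dots>, 1, c, 1, \<dots>, 1)\<close>.
\<close>

definition coord_point :: "nat \<Rightarrow> nat \<Rightarrow> complex \<Rightarrow> nat \<Rightarrow> complex" where
  "coord_point r a c = (\<lambda>b\<in>{..<r}. if b = a then c else 1)"

lemma coord_point_torus: "c \<noteq> 0 \<Longrightarrow> coord_point r a c \<in> torus r"
  by (auto simp: coord_point_def torus_def)

lemma torus_one_torus: "torus_one r \<in> torus r"
  by (auto simp: torus_one_def torus_def)

lemma torus_mult_torus: "d \<in> torus r \<Longrightarrow> e \<in> torus r \<Longrightarrow> torus_mult r d e \<in> torus r"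
  by (auto simp: torus_mult_def torus_def PiE_def Pi_def)

lemma torus_nonzero: "d \<in> torus r \<Longrightarrow> a < r \<Longrightarrow> d a \<noteq> 0"
  by (auto simp: torus_def)

lemma torus_apply [simp]:
  "a < r \<Longrightarrow> torus_mult r d e a = d a * e a"
  "a < r \<Longrightarrow> torus_one r a = 1"
  "b < r \<Longrightarrow> coord_point r a c b = (if b = a then c else 1)"
  by (simp_all add: torus_mult_def torus_one_def coord_point_def)

lemma torus_eqI:
  assumes "d \<in> torus r" "e \<in> torus r" "\<And>a. a < r \<Longrightarrow> d a = e a"
  shows "d = e"
  using assms unfolding torus_def by (metis PiE_ext lessThan_iff)

text \<open>
  Clearing denominators reduces a Laurent polynomial in one variable to an ordinary one.
\<close>

lemma laurent_on_coordinate_line: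
  assumes "f \<in> laurent_polynomials r"
  shows "\<exists>k P. \<forall>c. c \<noteq> 0 \<longrightarrow> f (coord_point r a c) * c ^ k = poly P c"
  using assms unfolding laurent_polynomials_def
proof (induction rule: fun_algebra.induct)
  case (gen g)
  then obtain b where b: "b < r" and g: "g = (\<lambda>d. d b) \<or> g = (\<lambda>d. inverse (d b))" by blast
  consider "b \<noteq> a" | "b = a" "g = (\<lambda>d. d b)" | "b = a" "g = (\<lambda>d. inverse (d b))"
    using g by blast
  then show ?case
  proof cases
    case 1
    then show ?thesis using b g by (intro exI[of _ 0] exI[of _ "[:1:]"]) auto
  next
    case 2
    then show ?thesis using b by (intro exI[of _ 0] exI[of _ "[:0, 1:]"]) auto
  next
    case 3
    then show ?thesis using b by (intro exI[of _ 1] exI[of _ "[:1:]"]) auto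
  qed
next
  case (const c)
  show ?case by (intro exI[of _ 0] exI[of _ "[:c:]"]) auto
next
  case (add f g)
  then obtain k F l G where
    FG: "\<And>c. c \<noteq> 0 \<Longrightarrow> poly F c = f (coord_point r a c) * c ^ k"
    "\<And>c. c \<noteq> 0 \<Longrightarrow> poly G c = g (coord_point r a c) * c ^ l" by metis
  then have "\<forall>c. c \<noteq> 0 \<longrightarrow> (f (coord_point r a c) + g (coord_point r a c)) * c ^ (k + l)
      = poly (F * monom 1 l + G * monom 1 k) c"
    by (simp add: FG power_add poly_monom algebra_simps)
  then show ?case by blast
next
  case (mult f g)
  then obtain k F l G where
    FG: "\<And>c. c \<noteq> 0 \<Longrightarrow> poly F c = f (coord_point r a c) * c ^ k"
    "\<And>c. c \<noteq> 0 \<Longrightarrow> poly G c = g (coord_point r a c) * c ^ l" by metis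
  then have "\<forall>c. c \<noteq> 0 \<longrightarrow> (f (coord_point r a c) * g (coord_point r a c)) * c ^ (k + l)
      = poly (F * G) c"
    by (simp add: FG power_add)
  then show ?case by blast
qed

text \<open>
  Comparing coefficients in \<open>P(s t) = P(s) P(t)\<close> as polynomials in \<open>t\<close> gives
  \<open>p\<^sub>i s\<^sup>i = P(s) p\<^sub>i\<close> for every coefficient \<open>p\<^sub>i\<close>; one of them is nonzero.
\<close>

lemma multiplicative_poly_is_power:
  fixes P :: "complex poly"
  assumes mult: "\<And>s t. s \<noteq> 0 \<Longrightarrow> t \<noteq> 0 \<Longrightarrow> poly P (s * t) = poly P s * poly P t"
    and nz: "P \<noteq> 0"
  shows "\<exists>i. \<forall>s. s \<noteq> 0 \<longrightarrow> poly P s = s ^ i"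
proof -
  obtain i where i: "coeff P i \<noteq> 0" using nz by (meson leading_coeff_0_iff)
  have "poly P s = s ^ i" if s: "s \<noteq> 0" for s
  proof -
    \<comment> \<open>The factor \<open>t\<close> in the next step takes care of \<open>t = 0\<close>, where multiplicativity is not assumed.\<close>
    define R where "R = pcompose P [:0, s:] - Polynomial.smult (poly P s) P"
    have "poly (R * [:0, 1:]) t = 0" for t
      using mult[OF s, of t] by (cases "t = 0") (auto simp: R_def poly_pcompose mult.commute)
    then have "R = 0" by (metis mult_eq_0_iff pCons_eq_0_iff poly_all_0_iff_0 zero_neq_one)
    then have "coeff (pcompose P [:0, s:]) i = poly P s * coeff P i"
      by (simp add: R_def)
    then show ?thesis using i by (simp add: coeff_pcompose_linear)
  qed
  then show ?thesis by blast
qed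

text \<open>
  A character is determined by its restrictions to the coordinate subgroups, and each of these is
  a power.
\<close>

lemma laurent_character_is_monomial:
  assumes f: "f \<in> laurent_polynomials r"
    and mult: "\<And>d e. d \<in> torus r \<Longrightarrow> e \<in> torus r \<Longrightarrow> f (torus_mult r d e) = f d * f e"
    and nz: "\<And>d. d \<in> torus r \<Longrightarrow> f d \<noteq> 0"
  shows "\<exists>u :: nat \<Rightarrow> int. \<forall>d\<in>torus r. f d = (\<Prod>a<r. d a powi u a)"
proof -
  have "\<exists>m :: int. \<forall>c. c \<noteq> 0 \<longrightarrow> f (coord_point r a c) = c powi m" for a
  proof -
    obtain k P where P: "\<And>c. c \<noteq> 0 \<Longrightarrow> f (coord_point r a c) * c ^ k = poly P c"
      using laurent_on_coordinate_line[OF f] by metis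
    have "poly P (s * t) = poly P s * poly P t" if "s \<noteq> 0" "t \<noteq> 0" for s t
    proof -
      have "coord_point r a (s * t) = torus_mult r (coord_point r a s) (coord_point r a t)"
        using that by (intro torus_eqI[of _ r] torus_mult_torus coord_point_torus) auto
      then have "f (coord_point r a (s * t)) = f (coord_point r a s) * f (coord_point r a t)"
        using that by (simp add: mult coord_point_torus)
      then show ?thesis using that
        by (simp add: P[symmetric] power_mult_distrib)
    qed
    moreover have "P \<noteq> 0" using P[of 1] nz[OF coord_point_torus[of 1 r a]] by auto
    ultimately obtain i where i: "\<And>s. s \<noteq> 0 \<Longrightarrow> poly P s = s ^ i"
      using multiplicative_poly_is_power by blast
    have "f (coord_point r a c) = c powi (int i - int k)" if "c \<noteq> 0" for c
      using P[OF that] i[OF that] that by (simp add: power_int_diff field_simps)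
    then show ?thesis by blast
  qed
  then obtain u :: "nat \<Rightarrow> int" where
    u: "\<And>a c. c \<noteq> 0 \<Longrightarrow> f (coord_point r a c) = c powi u a" by metis
  have "f d = (\<Prod>a<r. d a powi u a)" if d: "d \<in> torus r" for d
  proof -
    \<comment> \<open>The partial products of \<open>d\<close> over its coordinates.\<close>
    define cut where "cut s = (\<lambda>b\<in>{..<r}. if b < s then d b else 1)" for s
    have cut_torus: "cut s \<in> torus r" for s using torus_nonzero[OF d] by (simp add: cut_def torus_def)
    have "f (cut s) = (\<Prod>a<s. d a powi u a)" if "s \<le> r" for s
      using that
    proof (induction s)
      case 0
      have "torus_mult r (cut 0) (cut 0) = cut 0"
        by (intro torus_eqI[of _ r] torus_mult_torus cut_torus) (auto simp: cut_def)
      then show ?case using mult[OF cut_torus cut_torus, of 0 0] nz[OF cut_torus, of 0] by simp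
    next
      case (Suc s)
      then have ds: "d s \<noteq> 0" using torus_nonzero[OF d] by simp
      have "cut (Suc s) = torus_mult r (cut s) (coord_point r s (d s))"
        using ds by (intro torus_eqI[of _ r] torus_mult_torus cut_torus coord_point_torus)
          (auto simp: cut_def less_Suc_eq)
      then show ?case using Suc ds by (simp add: mult cut_torus coord_point_torus u)
    qed
    moreover have "cut r = d"
      using d cut_torus by (intro torus_eqI[of _ r]) (auto simp: cut_def)
    ultimately show ?thesis by auto
  qed
  then show ?thesis by blast
qed


section \<open>The torus \<open>H\<^sub>T\<close>\<close>

lemma sum_of_bool_mult:
  fixes v :: "'a \<Rightarrow> complex"
  assumes "finite F" "e \<in> F"
  shows "(\<Sum>f\<in>F. of_bool (e = f) * v f) = v e"
  using assms by (subst sum.remove[of F e]) (auto intro!: sum.neutral)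

lemma solve_generic:
  fixes A K S a b B :: complex
  shows "A + K + S = 0 \<and> A - a = b - B \<longleftrightarrow> A = a + b - B \<and> K = - S - (a + b - B)"
proof
  assume eq: "A + K + S = 0 \<and> A - a = b - B"
  then have "A = a + b - B" by (simp add: algebra_simps)
  moreover have "K = (A + K + S) - S - A" by simp
  then have "K = - S - A" unfolding conjunct1[OF eq] by simp
  ultimately show "A = a + b - B \<and> K = - S - (a + b - B)" using eq by simp
qed simp

text \<open>
  Twice the second entry equals the sum of the outer ones, so the trace is three times the second
  entry.
\<close>

lemma solve_3:
  fixes A B C :: complex
  shows "A + (B + C) = 0 \<and> A - B = B - C \<longleftrightarrow> A = - C \<and> B = 0"
proof
  assume eq: "A + (B + C) = 0 \<and> A - B = B - C"
  have "3 * B = (A + (B + C)) - ((A - B) - (B - C))" by simp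
  then have "B = 0" using eq by simp
  moreover have "A = (A + (B + C)) - B - C" by simp
  ultimately show "A = - C \<and> B = 0" using eq by simp
qed simp

lemma solve_4:
  fixes A B C D :: complex
  shows "A + (B + (C + D)) = 0 \<and> A - B = C - D \<longleftrightarrow> A = - D \<and> B = - C"
proof
  assume eq: "A + (B + (C + D)) = 0 \<and> A - B = C - D"
  then have e: "A + (B + (C + D)) = 0" "(A - B) - (C - D) = 0" by simp_all
  have "2 * (A + D) = (A + (B + (C + D))) + ((A - B) - (C - D))" by simp
  then have "2 * (A + D) = 0" unfolding e by simp
  moreover have "2 * (B + C) = (A + (B + (C + D))) - ((A - B) - (C - D))" by simp
  then have "2 * (B + C) = 0" unfolding e by simp
  ultimately have "A + D = 0" "B + C = 0" by (simp_all only: mult_eq_0_iff zero_neq_numeral[symmetric] simp_thms)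
  then show "A = - D \<and> B = - C" by (simp add: eq_neg_iff_add_eq_0)
qed simp

text \<open>
  If some index \<open>k\<close> lies outside \<open>{\<alpha>, \<alpha> + 1, \<beta>, \<beta> + 1}\<close> (counted from 1), the equation
  \<open>\<alpha>(h) = \<beta>(h)\<close> is solved for the entry at \<open>\<alpha>\<close>, with coefficient 1, and the trace for the entry at
  \<open>k\<close>. There is no such index only for \<open>n = 3\<close>, \<open>(\<alpha>, \<beta>) = (1, 2)\<close> and for \<open>n = 4\<close>,
  \<open>(\<alpha>, \<beta>) = (1, 3)\<close>. In these cases the subgroup of \<open>SL\<^sub>n\<close> that the two characters cut out is
  disconnected, but on \<open>h\<^sub>T\<close> its extra factor 3 or 2 can be divided out: the solutions are
  \<open>(-z, 0, z)\<close> and \<open>(-z, -y, y, z)\<close>.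
\<close>

lemma h_T_coordinates:
  fixes n \<alpha> \<beta> :: nat
  assumes n: "3 \<le> n" and \<alpha>\<beta>: "1 \<le> \<alpha>" "\<alpha> < \<beta>" "\<beta> < n"
  obtains p q and Wp Wq :: "nat \<Rightarrow> int" where "p < n" "q < n" "p \<noteq> q"
    "\<And>v :: nat \<Rightarrow> complex. (\<Sum>i<n. v i) = 0 \<and> v (\<alpha> - 1) - v \<alpha> = v (\<beta> - 1) - v \<beta> \<longleftrightarrow>
      v p = (\<Sum>f\<in>{..<n} - {p, q}. of_int (Wp f) * v f) \<and>
      v q = (\<Sum>f\<in>{..<n} - {p, q}. of_int (Wq f) * v f)"
proof (cases "\<exists>k<n. k \<notin> {\<alpha> - 1, \<alpha>, \<beta> - 1, \<beta>}")
  case True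
  then obtain k where k: "k < n" "k \<noteq> \<alpha> - 1" "k \<noteq> \<alpha>" "k \<noteq> \<beta> - 1" "k \<noteq> \<beta>" by auto
  define F where "F = {..<n} - {\<alpha> - 1, k}"
  \<comment> \<open>Matrix entries are counted from 0. For \<open>\<beta> = \<alpha> + 1\<close> the first two summands coincide.\<close>
  define W :: "nat \<Rightarrow> int" where "W f = of_bool (\<alpha> = f) + of_bool (\<beta> - 1 = f) - of_bool (\<beta> = f)" for f
  have F: "finite F" "\<alpha> \<in> F" "\<beta> - 1 \<in> F" "\<beta> \<in> F" using k \<alpha>\<beta> by (auto simp: F_def)
  have W: "(\<Sum>f\<in>F. of_int (W f) * v f) = v \<alpha> + v (\<beta> - 1) - v \<beta>" for v :: "nat \<Rightarrow> complex"
    by (simp only: W_def of_int_diff of_int_add of_int_of_bool left_diff_distrib distrib_right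
        sum_subtractf sum.distrib sum_of_bool_mult F)
  have W1: "(\<Sum>f\<in>F. of_int (- 1 - W f) * v f) = - (\<Sum>f\<in>F. v f) - (v \<alpha> + v (\<beta> - 1) - v \<beta>)"
    for v :: "nat \<Rightarrow> complex"
    unfolding W[symmetric] by (simp add: left_diff_distrib sum_subtractf sum_negf)
  have total: "(\<Sum>i<n. v i) = v (\<alpha> - 1) + v k + (\<Sum>f\<in>F. v f)" for v :: "nat \<Rightarrow> complex"
  proof -
    have "{..<n} = insert (\<alpha> - 1) (insert k F)" using k \<alpha>\<beta> by (auto simp: F_def)
    moreover have "\<alpha> - 1 \<notin> insert k F" "k \<notin> F" using k by (auto simp: F_def)
    ultimately show ?thesis using F(1) by simp
  qed
  have "(\<Sum>i<n. v i) = 0 \<and> v (\<alpha> - 1) - v \<alpha> = v (\<beta> - 1) - v \<beta> \<longleftrightarrow>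
    v (\<alpha> - 1) = (\<Sum>f\<in>F. of_int (W f) * v f) \<and> v k = (\<Sum>f\<in>F. of_int (- 1 - W f) * v f)"
    for v :: "nat \<Rightarrow> complex"
    unfolding W W1 total by (rule solve_generic)
  moreover have "\<alpha> - 1 < n" "\<alpha> - 1 \<noteq> k" using \<alpha>\<beta> k by auto
  ultimately show ?thesis using k(1) unfolding F_def by (intro that[of "\<alpha> - 1" k W "\<lambda>f. - 1 - W f"])
next
  case False
  then have all: "k \<in> {\<alpha> - 1, \<alpha>, \<beta> - 1, \<beta>}" if "k < n" for k using that by blast
  have \<alpha>: "\<alpha> = 1" using all[of 0] \<alpha>\<beta> by auto
  have nb: "n = \<beta> + 1" using all[of "n - 1"] \<alpha>\<beta> by auto
  have "\<beta> = 2 \<or> \<beta> = 3" using all[of 2] n \<alpha>\<beta> by (auto simp: \<alpha>)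
  then show ?thesis
  proof
    assume \<beta>: "\<beta> = 2"
    have n3: "n = 3" using nb \<beta> by simp
    have S: "{..<3::nat} = {0, 1, 2}" by auto
    have F: "{..<3::nat} - {0, 1} = {2}" by auto
    have "(\<Sum>i<3. v i) = 0 \<and> v (1 - 1) - v 1 = v (2 - 1) - v 2 \<longleftrightarrow>
        v 0 = (\<Sum>f\<in>{..<3} - {0, 1}. of_int (- 1) * v f) \<and> v 1 = (\<Sum>f\<in>{..<3} - {0, 1}. of_int 0 * v f)"
      for v :: "nat \<Rightarrow> complex"
      unfolding F S using solve_3[of "v 0" "v 1" "v 2"] by simp
    then show ?thesis
      by (intro that[of 0 1 "\<lambda>_. - 1" "\<lambda>_. 0", unfolded n3 \<alpha> \<beta>]) simp_all
  next
    assume \<beta>: "\<beta> = 3"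
    have n4: "n = 4" using nb \<beta> by simp
    have S: "{..<4::nat} = {0, 1, 2, 3}" by auto
    have F: "{..<4::nat} - {0, 1} = {2, 3}" by auto
    have "(\<Sum>i<4. v i) = 0 \<and> v (1 - 1) - v 1 = v (3 - 1) - v 3 \<longleftrightarrow>
        v 0 = (\<Sum>f\<in>{..<4} - {0, 1}. of_int (- of_bool (f = 3)) * v f) \<and>
        v 1 = (\<Sum>f\<in>{..<4} - {0, 1}. of_int (- of_bool (f = 2)) * v f)"
      for v :: "nat \<Rightarrow> complex"
      unfolding F S using solve_4[of "v 0" "v 1" "v 2" "v 3"] by simp
    then show ?thesis
      by (intro that[of 0 1 "\<lambda>f. - of_bool (f = 3)" "\<lambda>f. - of_bool (f = 2)", unfolded n4 \<alpha> \<beta>]) simp_all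
  qed
qed

text \<open>
  The columns of \<open>w\<close> form a basis of the cocharacter lattice of \<open>H\<^sub>T\<close>, and the entries with
  indices \<open>c a\<close> form the dual coordinates.
\<close>

lemma h_T_lattice_basis:
  fixes n \<alpha> \<beta> :: nat
  assumes "3 \<le> n" "1 \<le> \<alpha>" "\<alpha> < \<beta>" "\<beta> < n"
  obtains w :: "nat \<Rightarrow> nat \<Rightarrow> int" and c :: "nat \<Rightarrow> nat" where
    "\<And>a. a < n - 2 \<Longrightarrow> c a < n"
    "\<And>a b. a < n - 2 \<Longrightarrow> b < n - 2 \<Longrightarrow> w (c a) b = of_bool (a = b)"
    "\<And>v :: nat \<Rightarrow> complex. (\<Sum>i<n. v i) = 0 \<and> v (\<alpha> - 1) - v \<alpha> = v (\<beta> - 1) - v \<beta> \<longleftrightarrow>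
      (\<forall>i<n. v i = (\<Sum>a<n - 2. of_int (w i a) * v (c a)))"
proof -
  obtain p q Wp Wq where pq: "p < n" "q < n" "p \<noteq> q" and
    iff: "\<And>v :: nat \<Rightarrow> complex. (\<Sum>i<n. v i) = 0 \<and> v (\<alpha> - 1) - v \<alpha> = v (\<beta> - 1) - v \<beta> \<longleftrightarrow>
    v p = (\<Sum>f\<in>{..<n} - {p, q}. of_int (Wp f) * v f) \<and>
    v q = (\<Sum>f\<in>{..<n} - {p, q}. of_int (Wq f) * v f)"
    by (rule h_T_coordinates[OF assms]) (rule that)
  define F where "F = {..<n} - {p, q}"
  have "finite F" "card F = n - 2" using pq by (auto simp: F_def card_Diff_subset)
  then obtain c where c: "bij_betw c {..<n - 2} F"
    using ex_bij_betw_nat_finite[of F] by (auto simp: atLeast0LessThan)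
  have cF: "c a \<in> F" if "a < n - 2" for a using c that by (auto simp: bij_betw_def)
  have inj: "c a = c b \<longleftrightarrow> a = b" if "a < n - 2" "b < n - 2" for a b
    using c that by (auto simp: bij_betw_def inj_on_def)
  define w where "w i a = (if i = p then Wp (c a) else if i = q then Wq (c a) else of_bool (i = c a))" for i a
  have sum_c: "(\<Sum>a<n - 2. g (c a)) = (\<Sum>f\<in>F. g f)" for g :: "nat \<Rightarrow> complex"
    by (rule sum.reindex_bij_betw[OF c])
  show ?thesis
  proof (rule that[of c w])
    show "c a < n" if "a < n - 2" for a using cF[OF that] by (simp add: F_def)
    show "w (c a) b = of_bool (a = b)" if "a < n - 2" "b < n - 2" for a b
      using cF[OF that(1)] inj[OF that] by (simp add: w_def F_def)
    fix v :: "nat \<Rightarrow> complex"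
    have wp: "(\<Sum>a<n - 2. of_int (w p a) * v (c a)) = (\<Sum>f\<in>F. of_int (Wp f) * v f)"
      unfolding sum_c[symmetric] by (simp add: w_def)
    have wq: "(\<Sum>a<n - 2. of_int (w q a) * v (c a)) = (\<Sum>f\<in>F. of_int (Wq f) * v f)"
      unfolding sum_c[symmetric] using pq(3) by (simp add: w_def)
    have wF: "(\<Sum>a<n - 2. of_int (w i a) * v (c a)) = v i" if "i \<in> F" for i
    proof -
      have "(\<Sum>a<n - 2. of_int (w i a) * v (c a)) = (\<Sum>a<n - 2. of_bool (i = c a) * v (c a))"
        using that by (simp add: w_def F_def)
      also have "\<dots> = (\<Sum>f\<in>F. of_bool (i = f) * v f)" by (rule sum_c)
      also have "\<dots> = v i" by (rule sum_of_bool_mult[OF \<open>finite F\<close> that])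
      finally show ?thesis .
    qed
    have "(\<forall>i<n. v i = (\<Sum>a<n - 2. of_int (w i a) * v (c a))) \<longleftrightarrow>
      v p = (\<Sum>a<n - 2. of_int (w p a) * v (c a)) \<and> v q = (\<Sum>a<n - 2. of_int (w q a) * v (c a))"
    proof (intro iffI allI impI)
      fix i
      assume "v p = (\<Sum>a<n - 2. of_int (w p a) * v (c a)) \<and> v q = (\<Sum>a<n - 2. of_int (w q a) * v (c a))"
        and "i < n"
      then show "v i = (\<Sum>a<n - 2. of_int (w i a) * v (c a))"
        using wF[of i] by (cases "i = p"; cases "i = q") (simp_all add: F_def)
    qed (use pq in simp)
    then show "(\<Sum>i<n. v i) = 0 \<and> v (\<alpha> - 1) - v \<alpha> = v (\<beta> - 1) - v \<beta> \<longleftrightarrow>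
      (\<forall>i<n. v i = (\<Sum>a<n - 2. of_int (w i a) * v (c a)))"
      unfolding iff wp wq F_def by simp
  qed
qed

lemma complex_log_exists:
  assumes "z \<noteq> 0"
  shows "\<exists>y :: complex. z = exp y"
proof -
  have "z = of_real (cmod z) * cis (Arg z)" using rcis_cmod_Arg[of z] by (simp add: rcis_def)
  also have "\<dots> = exp (of_real (ln (cmod z)) + \<i> * of_real (Arg z))"
    using assms by (simp add: exp_add cis_conv_exp exp_of_real)
  finally show ?thesis by blast
qed

text \<open>
  The homomorphism from a torus of rank \<open>m\<close> to the diagonal matrices whose cocharacters are the
  columns of \<open>w\<close>.
\<close>

definition monomial_diag :: "nat \<Rightarrow> nat \<Rightarrow> (nat \<Rightarrow> nat \<Rightarrow> int) \<Rightarrow> (nat \<Rightarrow> complex) \<Rightarrow> complex mat" where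
  "monomial_diag n m w x = mat_diag n (\<lambda>i. \<Prod>a<m. x a powi w i a)"

text \<open>
  Exponentiating the integral parametrisation of \<open>h\<^sub>T\<close> turns integral combinations into monomials;
  every nonzero complex number is an exponential, so all points of the torus are reached.
\<close>

lemma H_T_eq_monomial_diag:
  assumes \<alpha>\<beta>: "1 \<le> \<alpha>" "\<alpha> < \<beta>" "\<beta> < n"
    and c: "\<And>a. a < m \<Longrightarrow> c a < n"
    and wc: "\<And>a b. a < m \<Longrightarrow> b < m \<Longrightarrow> w (c a) b = of_bool (a = b)"
    and iff: "\<And>v :: nat \<Rightarrow> complex. (\<Sum>i<n. v i) = 0 \<and> v (\<alpha> - 1) - v \<alpha> = v (\<beta> - 1) - v \<beta> \<longleftrightarrow>
      (\<forall>i<n. v i = (\<Sum>a<m. of_int (w i a) * v (c a)))"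
  shows "H_T n \<alpha> \<beta> = monomial_diag n m w ` {x. \<forall>a<m. x a \<noteq> 0}"
proof -
  have exp_char: "(\<Prod>a<m. exp (y a) powi w i a) = exp (\<Sum>a<m. of_int (w i a) * y a)"
    for i and y :: "nat \<Rightarrow> complex"
    by (simp add: exp_sum exp_power_int)
  have mem: "h \<in> h_T n \<alpha> \<beta> \<longleftrightarrow> h \<in> carrier_mat n n \<and> diagonal_mat h \<and>
      (\<forall>i<n. h $$ (i, i) = (\<Sum>a<m. of_int (w i a) * h $$ (c a, c a)))" for h
    using iff[of "\<lambda>i. h $$ (i, i)"] by (auto simp: h_T_def cartan_def simple_root_def)
  show ?thesis
  proof (intro subset_antisym subsetI)
    fix A assume "A \<in> H_T n \<alpha> \<beta>"
    then obtain h where h: "h \<in> h_T n \<alpha> \<beta>" "A = exp_diag h" by (auto simp: H_T_def)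
    then have "A = monomial_diag n m w (\<lambda>a. exp (h $$ (c a, c a)))"
      unfolding monomial_diag_def exp_char by (auto simp: exp_diag_def mem mat_diag_def)
    then show "A \<in> monomial_diag n m w ` {x. \<forall>a<m. x a \<noteq> 0}" by force
  next
    fix A assume "A \<in> monomial_diag n m w ` {x. \<forall>a<m. x a \<noteq> 0}"
    then obtain x where x: "\<And>a. a < m \<Longrightarrow> x a \<noteq> 0" "A = monomial_diag n m w x" by auto
    obtain y where y: "\<And>a. a < m \<Longrightarrow> x a = exp (y a)"
      using bchoice[of "{..<m}" "\<lambda>a z. x a = exp z"] x(1) complex_log_exists by (metis lessThan_iff)
    define h where "h = mat_diag n (\<lambda>i. \<Sum>a<m. of_int (w i a) * y a)"
    have hc: "h $$ (c a, c a) = y a" if "a < m" for a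
    proof -
      have "h $$ (c a, c a) = (\<Sum>b<m. of_bool (a = b) * y b)"
        using c[OF that] wc[OF that] by (simp add: h_def mat_diag_def)
      also have "\<dots> = y a" using that by (intro sum_of_bool_mult) auto
      finally show ?thesis .
    qed
    have "h \<in> h_T n \<alpha> \<beta>"
      unfolding mem using hc by (simp add: h_def mat_diag_def diagonal_mat_def)
    moreover have "A = exp_diag h"
      unfolding x(2) monomial_diag_def
      by (rule eq_matI) (simp_all add: exp_diag_def h_def mat_diag_def y exp_char)
    ultimately show "A \<in> H_T n \<alpha> \<beta>" by (auto simp: H_T_def)
  qed
qed

lemma H_T_properties:
  assumes \<alpha>\<beta>: "1 \<le> \<alpha>" "\<alpha> < \<beta>" "\<beta> < n" and A: "A \<in> H_T n \<alpha> \<beta>"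
  shows "A \<in> SL n" "A = mat_diag n (\<lambda>i. A $$ (i, i))" "\<And>i. i < n \<Longrightarrow> A $$ (i, i) \<noteq> 0"
    "(\<Prod>i<n. A $$ (i, i)) = 1"
    "A $$ (\<alpha> - 1, \<alpha> - 1) * A $$ (\<beta>, \<beta>) = A $$ (\<alpha>, \<alpha>) * A $$ (\<beta> - 1, \<beta> - 1)"
proof -
  obtain h where h: "h \<in> h_T n \<alpha> \<beta>" "A = exp_diag h" using A by (auto simp: H_T_def)
  then have carrier: "h \<in> carrier_mat n n" and total: "(\<Sum>i<n. h $$ (i, i)) = 0"
    and rel: "h $$ (\<alpha> - 1, \<alpha> - 1) - h $$ (\<alpha>, \<alpha>) = h $$ (\<beta> - 1, \<beta> - 1) - h $$ (\<beta>, \<beta>)"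
    by (auto simp: h_T_def cartan_def simple_root_def)
  have A_diag: "A = mat_diag n (\<lambda>i. exp (h $$ (i, i)))"
    using h(2) carrier by (simp add: exp_diag_def)
  have entry: "A $$ (i, i) = exp (h $$ (i, i))" if "i < n" for i
    using that by (simp add: A_diag mat_diag_def)
  show diag: "A = mat_diag n (\<lambda>i. A $$ (i, i))"
    by (rule eq_matI) (auto simp: A_diag mat_diag_def)
  show "A $$ (i, i) \<noteq> 0" if "i < n" for i using entry[OF that] by simp
  show prod: "(\<Prod>i<n. A $$ (i, i)) = 1"
  proof -
    have "(\<Prod>i<n. A $$ (i, i)) = (\<Prod>i<n. exp (h $$ (i, i)))" by (simp add: entry)
    also have "\<dots> = 1" using total by (simp add: exp_sum[symmetric])
    finally show ?thesis .
  qed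
  have "det A = prod_list (diag_mat A)"
    by (intro det_upper_triangular[of _ n]) (auto simp: A_diag mat_diag_def)
  also have "\<dots> = (\<Prod>i<n. A $$ (i, i))"
    using arg_cong[OF A_diag, of dim_row]
    by (simp add: diag_mat_def mat_diag_def prod.distinct_set_conv_list[symmetric] atLeast0LessThan)
  finally show "A \<in> SL n" using prod by (simp add: SL_def) (simp add: A_diag)
  show "A $$ (\<alpha> - 1, \<alpha> - 1) * A $$ (\<beta>, \<beta>) = A $$ (\<alpha>, \<alpha>) * A $$ (\<beta> - 1, \<beta> - 1)"
    using \<alpha>\<beta> rel by (simp add: entry exp_add[symmetric] algebra_simps)
qed

lemma laurent_polynomials_power_int:
  assumes "a < r"
  shows "(\<lambda>d. d a powi k) \<in> laurent_polynomials r"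
proof -
  have pow: "(\<lambda>d. f d ^ e) \<in> laurent_polynomials r" if "f \<in> laurent_polynomials r" for f e
    using that unfolding laurent_polynomials_def
    by (induction e) (auto intro: fun_algebra.const fun_algebra.mult)
  have "(\<lambda>d. d a) \<in> laurent_polynomials r" "(\<lambda>d. inverse (d a)) \<in> laurent_polynomials r"
    using assms unfolding laurent_polynomials_def by (auto intro!: fun_algebra.gen)
  from pow[OF this(1), of "nat k"] pow[OF this(2), of "nat (- k)"] show ?thesis
    by (cases "k \<ge> 0") (simp_all add: power_int_def)
qed

lemma laurent_polynomials_monomial:
  fixes m :: nat
  assumes "\<And>a. a < m \<Longrightarrow> s a < r"
  shows "(\<lambda>d. \<Prod>a<m. d (s a) powi k a) \<in> laurent_polynomials r"
  using assms
proof (induction m)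
  case 0
  then show ?case unfolding laurent_polynomials_def by (simp add: fun_algebra.const)
next
  case (Suc m)
  then have "(\<lambda>d. (\<Prod>a<m. d (s a) powi k a) * d (s m) powi k m) \<in> laurent_polynomials r"
    using laurent_polynomials_power_int[of "s m" r "k m"]
    unfolding laurent_polynomials_def by (intro fun_algebra.mult) auto
  then show ?case by simp
qed

lemma torus_identification_exists:
  assumes n: "3 \<le> n" and \<alpha>\<beta>: "1 \<le> \<alpha>" "\<alpha> < \<beta>" "\<beta> < n"
  shows "\<exists>\<iota>. torus_identification n (2 * (n - 2)) (H_T n \<alpha> \<beta> \<times> H_T n \<alpha> \<beta>) \<iota>"
proof -
  obtain w :: "nat \<Rightarrow> nat \<Rightarrow> int" and c where c: "\<And>a. a < n - 2 \<Longrightarrow> c a < n"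
    and wc: "\<And>a b. a < n - 2 \<Longrightarrow> b < n - 2 \<Longrightarrow> w (c a) b = of_bool (a = b)"
    and iff: "\<And>v :: nat \<Rightarrow> complex. (\<Sum>i<n. v i) = 0 \<and> v (\<alpha> - 1) - v \<alpha> = v (\<beta> - 1) - v \<beta> \<longleftrightarrow>
      (\<forall>i<n. v i = (\<Sum>a<n - 2. of_int (w i a) * v (c a)))"
    by (rule h_T_lattice_basis[OF n \<alpha>\<beta>]) (rule that)
  define m where "m = n - 2"
  note c = c[folded m_def] and wc = wc[folded m_def] and iff = iff[folded m_def]
  note H = H_T_eq_monomial_diag[OF \<alpha>\<beta> c wc iff]
  let ?D = "monomial_diag n m w"
  have D_coord: "?D x $$ (c a, c a) = x a" if "a < m" for x a
  proof -
    have "?D x $$ (c a, c a) = (\<Prod>b<m. if a = b then x b else 1)"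
    proof -
      have "?D x $$ (c a, c a) = (\<Prod>b<m. x b powi w (c a) b)"
        using c[OF that] by (simp add: monomial_diag_def mat_diag_def)
      also have "\<dots> = (\<Prod>b<m. if a = b then x b else 1)"
        by (rule prod.cong[OF refl]) (simp add: wc[OF that])
      finally show ?thesis .
    qed
    then show ?thesis using that by (simp add: prod.delta')
  qed
  have D_mult: "?D (\<lambda>a. x a * y a) = ?D x * ?D y" for x y
    by (simp add: monomial_diag_def power_int_mult_distrib prod.distrib)
  have D_cong: "?D x = ?D y" if "\<And>a. a < m \<Longrightarrow> x a = y a" for x y
    using that by (simp add: monomial_diag_def)
  define \<iota> where "\<iota> d = (?D d, ?D (\<lambda>a. d (m + a)))" for d
  have "torus_identification n (2 * m) (H_T n \<alpha> \<beta> \<times> H_T n \<alpha> \<beta>) \<iota>"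
    unfolding torus_identification_def
  proof (intro conjI allI impI ballI)
    show "bij_betw \<iota> (torus (2 * m)) (H_T n \<alpha> \<beta> \<times> H_T n \<alpha> \<beta>)"
      unfolding bij_betw_def
    proof
      show "inj_on \<iota> (torus (2 * m))"
      proof (rule inj_onI)
        fix d e assume de: "d \<in> torus (2 * m)" "e \<in> torus (2 * m)" "\<iota> d = \<iota> e"
        show "d = e"
        proof (rule torus_eqI[OF de(1,2)])
          fix a assume a: "a < 2 * m"
          show "d a = e a"
          proof (cases "a < m")
            case True
            then show ?thesis using de(3) D_coord[OF True, of d] D_coord[OF True, of e]
              by (simp add: \<iota>_def)
          next
            case False
            then have am: "a - m < m" "m + (a - m) = a" using a by auto
            then show ?thesis using de(3) D_coord[OF am(1), of "\<lambda>a. d (m + a)"]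
                D_coord[OF am(1), of "\<lambda>a. e (m + a)"]
              by (simp add: \<iota>_def)
          qed
        qed
      qed
      show "\<iota> ` torus (2 * m) = H_T n \<alpha> \<beta> \<times> H_T n \<alpha> \<beta>"
      proof (intro subset_antisym subsetI)
        fix P assume "P \<in> \<iota> ` torus (2 * m)"
        then obtain d where "d \<in> torus (2 * m)" "P = \<iota> d" by blast
        then show "P \<in> H_T n \<alpha> \<beta> \<times> H_T n \<alpha> \<beta>"
          using torus_nonzero[of d "2 * m"] by (auto simp: \<iota>_def H)
      next
        fix P assume "P \<in> H_T n \<alpha> \<beta> \<times> H_T n \<alpha> \<beta>"
        then obtain x y where xy: "\<And>a. a < m \<Longrightarrow> x a \<noteq> 0" "\<And>a. a < m \<Longrightarrow> y a \<noteq> 0" "P = (?D x, ?D y)"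
          by (auto simp: H)
        define d where "d = (\<lambda>a\<in>{..<2 * m}. if a < m then x a else y (a - m))"
        have "d \<in> torus (2 * m)" using xy(1,2) by (simp add: d_def torus_def)
        moreover have "\<iota> d = P"
          unfolding \<iota>_def xy(3) by (intro arg_cong2[where f = Pair] D_cong) (auto simp: d_def)
        ultimately show "P \<in> \<iota> ` torus (2 * m)" by blast
      qed
    qed
  next
    fix d e assume "d \<in> torus (2 * m)" "e \<in> torus (2 * m)"
    have "?D (torus_mult (2 * m) d e) = ?D (\<lambda>a. d a * e a)"
      "?D (\<lambda>a. torus_mult (2 * m) d e (m + a)) = ?D (\<lambda>a. d (m + a) * e (m + a))"
      by (intro D_cong; simp)+
    then show "\<iota> (torus_mult (2 * m) d e) = (fst (\<iota> d) * fst (\<iota> e), snd (\<iota> d) * snd (\<iota> e))"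
      by (simp add: \<iota>_def D_mult)
  next
    fix i j assume ij: "i < n" "j < n"
    have zero: "(\<lambda>_. 0) \<in> laurent_polynomials (2 * m)"
      unfolding laurent_polynomials_def by (rule fun_algebra.const)
    show "\<exists>f\<in>laurent_polynomials (2 * m). \<forall>d\<in>torus (2 * m). fst (\<iota> d) $$ (i, j) = f d"
    proof (cases "i = j")
      case True
      show ?thesis
        using ij True by (intro bexI[OF _ laurent_polynomials_monomial[of m "\<lambda>a. a" _ "w j"]])
          (auto simp: \<iota>_def monomial_diag_def mat_diag_def)
    next
      case False
      then show ?thesis using ij
        by (intro bexI[OF _ zero]) (simp add: \<iota>_def monomial_diag_def mat_diag_def)
    qed
    show "\<exists>f\<in>laurent_polynomials (2 * m). \<forall>d\<in>torus (2 * m). snd (\<iota> d) $$ (i, j) = f d"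
    proof (cases "i = j")
      case True
      show ?thesis
        using ij True by (intro bexI[OF _ laurent_polynomials_monomial[of m "\<lambda>a. m + a" _ "w j"]])
          (auto simp: \<iota>_def monomial_diag_def mat_diag_def)
    next
      case False
      then show ?thesis using ij
        by (intro bexI[OF _ zero]) (simp add: \<iota>_def monomial_diag_def mat_diag_def)
    qed
  next
    fix a assume a: "a < 2 * m"
    show "\<exists>g\<in>pair_polynomials n. \<forall>d\<in>torus (2 * m). d a = g (\<iota> d)"
    proof (cases "a < m")
      case True
      have "(\<lambda>P. fst P $$ (c a, c a)) \<in> pair_polynomials n"
        unfolding pair_polynomials_def using c[OF True] by (intro fun_algebra.gen) blast
      then show ?thesis using D_coord[OF True] by (intro bexI) (auto simp: \<iota>_def)
    next
      case False
      then have am: "a - m < m" "m + (a - m) = a" using a by auto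
      have "(\<lambda>P. snd P $$ (c (a - m), c (a - m))) \<in> pair_polynomials n"
        unfolding pair_polynomials_def using c[OF am(1)] by (intro fun_algebra.gen) blast
      then show ?thesis using D_coord[OF am(1)] am(2) by (intro bexI) (auto simp: \<iota>_def)
    qed
  qed
  then show ?thesis unfolding m_def by blast
qed

text \<open>
  The number 2 is not a root of unity, so it detects exponents.
\<close>

lemma two_power_int_eq_1:
  assumes "(2::complex) powi k = 1"
  shows "k = 0"
proof -
  have "norm ((2::complex) powi k) = 2 powi k" by (simp add: norm_power_int)
  then have "(2::real) powi k = 2 powi 0" using assms by simp
  then show ?thesis by (metis less_irrefl linorder_neqE power_int_strict_increasing one_less_numeral_iff semiring_norm(76))
qed

lemma power_int_sum:
  fixes x :: "'a::field"
  assumes "x \<noteq> 0"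
  shows "x powi (\<Sum>i\<in>S. f i) = (\<Prod>i\<in>S. x powi f i)"
  by (induction S rule: infinite_finite_induct) (simp_all add: power_int_add assms)

text \<open>
  The equations of \<open>H\<^sub>T\<close> between monomials become equations between their exponents by evaluation
  at \<open>(1, \<dots>, 1, 2, 1, \<dots>, 1)\<close>. The exponents with index at least \<open>r\<close> are set to 0, so that
  the equations hold between functions on all natural numbers.
\<close>

lemma H_T_exponents:
  fixes A :: "(nat \<Rightarrow> complex) \<Rightarrow> complex mat"
  assumes \<alpha>\<beta>: "1 \<le> \<alpha>" "\<alpha> < \<beta>" "\<beta> < n"
    and A: "\<And>d. d \<in> torus r \<Longrightarrow> A d \<in> H_T n \<alpha> \<beta>"
    and mult: "\<And>d e. d \<in> torus r \<Longrightarrow> e \<in> torus r \<Longrightarrow> A (torus_mult r d e) = A d * A e"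
    and laurent: "\<And>i. i < n \<Longrightarrow> \<exists>f\<in>laurent_polynomials r. \<forall>d\<in>torus r. A d $$ (i, i) = f d"
  obtains P :: "nat \<Rightarrow> nat \<Rightarrow> int" where
    "\<And>d i. d \<in> torus r \<Longrightarrow> i < n \<Longrightarrow> A d $$ (i, i) = (\<Prod>a<r. d a powi P (i + 1) a)"
    "(\<Sum>i=1..n. P i) = 0" "P \<alpha> - P (\<alpha> + 1) = P \<beta> - P (\<beta> + 1)"
proof -
  note HT = H_T_properties[OF \<alpha>\<beta> A]
  have "\<exists>u :: nat \<Rightarrow> int. \<forall>d\<in>torus r. A d $$ (i, i) = (\<Prod>a<r. d a powi u a)" if i: "i < n" for i
  proof -
    obtain f where f: "f \<in> laurent_polynomials r" "\<And>d. d \<in> torus r \<Longrightarrow> A d $$ (i, i) = f d"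
      using laurent[OF i] by blast
    have "f (torus_mult r d e) = f d * f e" if d: "d \<in> torus r" and e: "e \<in> torus r" for d e
    proof -
      have "A d * A e = mat_diag n (\<lambda>i. A d $$ (i, i) * A e $$ (i, i))"
        using HT(2)[OF d] HT(2)[OF e] by (metis mat_diag_diag)
      then have "(A d * A e) $$ (i, i) = A d $$ (i, i) * A e $$ (i, i)"
        using i by (simp add: mat_diag_def)
      then show ?thesis using d e torus_mult_torus[OF d e] by (simp add: f(2)[symmetric] mult)
    qed
    moreover have "f d \<noteq> 0" if "d \<in> torus r" for d
      using HT(3)[OF that i] f(2)[OF that] by simp
    ultimately show ?thesis using laurent_character_is_monomial[OF f(1)] f(2) by metis
  qed
  then obtain u :: "nat \<Rightarrow> nat \<Rightarrow> int" where
    u: "\<And>i d. i < n \<Longrightarrow> d \<in> torus r \<Longrightarrow> A d $$ (i, i) = (\<Prod>a<r. d a powi u i a)" by metis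
  define P where "P i a = (if a < r then u (i - 1) a else 0)" for i a
  have line: "A (coord_point r a 2) $$ (i, i) = 2 powi P (i + 1) a" if "a < r" "i < n" for a i
  proof -
    have "A (coord_point r a 2) $$ (i, i) = (\<Prod>b<r. coord_point r a 2 b powi u i b)"
      using that by (simp add: u coord_point_torus)
    also have "\<dots> = (\<Prod>b<r. if a = b then 2 powi u i b else 1)" by (rule prod.cong) auto
    also have "\<dots> = 2 powi u i a" using that by (simp add: prod.delta')
    finally show ?thesis using that by (simp add: P_def)
  qed
  show ?thesis
  proof (rule that[of P])
    show "A d $$ (i, i) = (\<Prod>a<r. d a powi P (i + 1) a)" if "d \<in> torus r" "i < n" for d i
      using u[OF that(2,1)] by (simp add: P_def)
    show "(\<Sum>i=1..n. P i) = 0"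
    proof
      fix a
      have "(\<Sum>i=1..n. P i) a = (\<Sum>i=1..n. P i a)"
        by (induction n) (simp_all)
      also have "\<dots> = (\<Sum>i<n. P (i + 1) a)" by (simp add: sum.atLeast1_atMost_eq)
      also have "\<dots> = 0"
      proof (cases "a < r")
        case True
        have "(2::complex) powi (\<Sum>i<n. P (i + 1) a) = (\<Prod>i<n. A (coord_point r a 2) $$ (i, i))"
          using line[OF True] by (simp add: power_int_sum)
        also have "\<dots> = 1" by (rule HT(4)) (simp add: coord_point_torus)
        finally show ?thesis by (rule two_power_int_eq_1)
      qed (simp add: P_def)
      finally show "(\<Sum>i=1..n. P i) a = 0 a" by simp
    qed
    show "P \<alpha> - P (\<alpha> + 1) = P \<beta> - P (\<beta> + 1)"
    proof
      fix a
      have "P \<alpha> a + P (\<beta> + 1) a = P (\<alpha> + 1) a + P \<beta> a"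
      proof (cases "a < r")
        case True
        have "(2::complex) powi (P \<alpha> a + P (\<beta> + 1) a) = 2 powi (P (\<alpha> + 1) a + P \<beta> a)"
          using HT(5)[of "coord_point r a 2"] line[OF True, of "\<alpha> - 1"] line[OF True, of \<alpha>]
            line[OF True, of "\<beta> - 1"] line[OF True, of \<beta>] \<alpha>\<beta>
          by (simp add: coord_point_torus power_int_add)
        then have "(2::complex) powi ((P \<alpha> a + P (\<beta> + 1) a) - (P (\<alpha> + 1) a + P \<beta> a)) = 1"
          by (subst power_int_diff) simp_all
        then show ?thesis using two_power_int_eq_1 by fastforce
      qed (simp add: P_def)
      then show "(P \<alpha> - P (\<alpha> + 1)) a = (P \<beta> - P (\<beta> + 1)) a" by simp
    qed
  qed
qed


section \<open>Translations of rational functions\<close>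

lemma reg_const_mult: "reg_const (a * b) = (reg_const a * reg_const b :: ('n::finite) regfun)"
  by transfer auto

lemma reg_const_0: "reg_const 0 = (0 :: ('n::finite) regfun)"
  by transfer auto

lemma reg_const_1: "reg_const 1 = (1 :: ('n::finite) regfun)"
  by transfer auto

lemma const_0: "const 0 = (0 :: ('n::finite) ratfun)"
  by (simp add: const_def reg_const_0 Zero_fract_def)

lemma const_1: "const 1 = (1 :: ('n::finite) ratfun)"
  by (simp add: const_def reg_const_1 One_fract_def)

lemma const_mult: "const (a * b) = (const a * const b :: ('n::finite) ratfun)"
  by (simp add: const_def reg_const_mult)

lemma const_nonzero:
  assumes "c \<noteq> 0"
  shows "const c \<noteq> (0 :: ('n::finite) ratfun)"
proof
  assume "const c = (0 :: 'n ratfun)"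
  moreover have "const c * const (inverse c) = (1 :: 'n ratfun)"
    using assms by (simp add: const_mult[symmetric] const_1)
  ultimately show False by simp
qed

context
  fixes A B :: "complex mat"
  assumes A: "A \<in> SL CARD('n::finite)" and B: "B \<in> SL CARD('n)"
begin

lemma reg_translate_add:
  "reg_translate A B (f + g) = reg_translate A B f + reg_translate A B (g :: 'n regfun)"
  by transfer auto

lemma reg_translate_const: "reg_translate A B (reg_const c) = (reg_const c :: 'n regfun)"
  using A B by transfer (auto intro!: ext SL_mult)

lemma reg_translate_1: "reg_translate A B 1 = (1 :: 'n regfun)"
  using reg_translate_const[of 1] by (simp add: reg_const_1)

lemma translate_const: "translate A B (const c) = (const c :: 'n ratfun)"
  by (simp add: const_def translate_Fract[OF A B] reg_translate_const reg_translate_1)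

lemma translate_add: "translate A B (f + g) = translate A B f + translate A B (g :: 'n ratfun)"
proof (cases f, cases g)
  fix a b c d :: "'n regfun"
  assume "f = Fract a b" "b \<noteq> 0" "g = Fract c d" "d \<noteq> 0"
  then show ?thesis
    by (simp add: translate_Fract[OF A B] reg_translate_add reg_translate_mult
        reg_translate_eq_0_iff[OF A B])
qed

lemma translate_mult: "translate A B (f * g) = translate A B f * translate A B (g :: 'n ratfun)"
proof (cases f, cases g)
  fix a b c d :: "'n regfun"
  assume "f = Fract a b" "b \<noteq> 0" "g = Fract c d" "d \<noteq> 0"
  then show ?thesis
    by (simp add: translate_Fract[OF A B] reg_translate_mult)
qed

lemma translate_comm_ring_hom: "comm_ring_hom (translate A B :: 'n ratfun \<Rightarrow> 'n ratfun)"
proof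
  show "translate A B (0 :: 'n ratfun) = 0" "translate A B (1 :: 'n ratfun) = 1"
    using translate_const[of 0] translate_const[of 1] by (simp_all add: const_0 const_1)
qed (rule translate_add translate_mult)+

end

text \<open>
  The order of the left factors is reversed, because \<open>f(X) \<mapsto> f(A X B)\<close> is a right action in \<open>A\<close>;
  for commuting matrices this makes no difference.
\<close>

lemma translate_translate:
  fixes f :: "('n::finite) ratfun"
  assumes A: "A \<in> SL CARD('n)" and B: "B \<in> SL CARD('n)"
    and A': "A' \<in> SL CARD('n)" and B': "B' \<in> SL CARD('n)"
  shows "translate A B (translate A' B' f) = translate (A' * A) (B * B') f"
proof (cases f)
  case (Fract a b)
  have "reg_translate A B (reg_translate A' B' g) = reg_translate (A' * A) (B * B') g"
    for g :: "'n regfun"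
    using assms
  proof (transfer, intro ext)
    fix A B A' B' g and X :: "complex mat"
    assume SL: "A \<in> SL CARD('n)" "B \<in> SL CARD('n)" "A' \<in> SL CARD('n)" "B' \<in> SL CARD('n)"
    have "A' * (A * X * B) * B' = A' * A * X * (B * B')" if "X \<in> SL CARD('n)"
    proof -
      have c: "A \<in> carrier_mat CARD('n) CARD('n)" "B \<in> carrier_mat CARD('n) CARD('n)"
        "A' \<in> carrier_mat CARD('n) CARD('n)" "B' \<in> carrier_mat CARD('n) CARD('n)"
        "X \<in> carrier_mat CARD('n) CARD('n)"
        using SL that by (auto simp: SL_def)
      have AX: "A * X \<in> carrier_mat CARD('n) CARD('n)" and
        AA: "A' * A \<in> carrier_mat CARD('n) CARD('n)" and
        AAX: "A' * A * X \<in> carrier_mat CARD('n) CARD('n)" using c by auto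
      have "A' * (A * X * B) * B' = A' * (A * X) * B * B'"
        using assoc_mult_mat[OF c(3) AX c(2)] by simp
      also have "\<dots> = A' * A * X * B * B'"
        using assoc_mult_mat[OF c(3) c(1) c(5)] by simp
      also have "\<dots> = A' * A * X * (B * B')"
        using assoc_mult_mat[OF AAX c(2,4)] by simp
      finally show ?thesis .
    qed
    then show "(if A \<in> SL CARD('n) \<and> B \<in> SL CARD('n) \<and> X \<in> SL CARD('n)
        then if A' \<in> SL CARD('n) \<and> B' \<in> SL CARD('n) \<and> A * X * B \<in> SL CARD('n)
          then g (A' * (A * X * B) * B') else 0 else (0 :: complex)) =
      (if A' * A \<in> SL CARD('n) \<and> B * B' \<in> SL CARD('n) \<and> X \<in> SL CARD('n)
        then g (A' * A * X * (B * B')) else 0)"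
      using SL by (auto simp: SL_mult)
  qed
  then show ?thesis using Fract assms
    by (simp add: translate_Fract SL_mult reg_translate_eq_0_iff)
qed

lemma translate_one: "translate (1\<^sub>m CARD('n)) (1\<^sub>m CARD('n)) = (id :: ('n::finite) ratfun \<Rightarrow> _)"
proof
  fix f :: "'n ratfun"
  have "reg_translate (1\<^sub>m CARD('n)) (1\<^sub>m CARD('n)) g = g" for g :: "'n regfun"
  proof (transfer, intro ext)
    fix g and X :: "complex mat"
    assume g: "\<exists>h\<in>entry_polynomials CARD('n). g = (\<lambda>X. if X \<in> SL CARD('n) then h X else 0)"
    have "1\<^sub>m CARD('n) * X * 1\<^sub>m CARD('n) = X" if "X \<in> SL CARD('n)"
      using that by (auto simp: SL_def)
    then show "(if 1\<^sub>m CARD('n) \<in> SL CARD('n) \<and> 1\<^sub>m CARD('n) \<in> SL CARD('n) \<and> X \<in> SL CARD('n)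
      then g (1\<^sub>m CARD('n) * X * 1\<^sub>m CARD('n)) else 0) = g X"
      using g one_SL by auto
  qed
  then show "translate (1\<^sub>m CARD('n)) (1\<^sub>m CARD('n)) f = id f"
    by (cases f) (simp add: translate_Fract one_SL)
qed

lemma field_automorphism_translate:
  assumes A: "A \<in> SL CARD('n)" and B: "B \<in> SL CARD('n)"
  shows "field_automorphism (translate A B :: ('n::finite) ratfun \<Rightarrow> _)"
proof -
  obtain A' where A': "A' \<in> SL CARD('n)" "A * A' = 1\<^sub>m CARD('n)" "A' * A = 1\<^sub>m CARD('n)"
    using SL_inverse[OF A] by blast
  obtain B' where B': "B' \<in> SL CARD('n)" "B * B' = 1\<^sub>m CARD('n)" "B' * B = 1\<^sub>m CARD('n)"
    using SL_inverse[OF B] by blast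
  have "translate A B (translate A' B' f) = f" "translate A' B' (translate A B f) = f"
    for f :: "'n ratfun"
    using A B A' B' by (simp_all add: translate_translate translate_one)
  then have "bij (translate A B :: 'n ratfun \<Rightarrow> _)" by (intro o_bij[of "translate A' B'"]) auto
  then show ?thesis
    by (simp add: field_automorphism_def translate_add[OF A B] translate_mult[OF A B]
        translate_const[OF A B])
qed

lemma translate_coord_matrix:
  fixes p q :: "nat \<Rightarrow> complex"
  assumes P: "mat_diag CARD('n) p \<in> SL CARD('n)" and Q: "mat_diag CARD('n) q \<in> SL CARD('n)"
    and ij: "i < CARD('n)" "j < CARD('n)"
  shows "translate (mat_diag CARD('n) p) (mat_diag CARD('n) q) (coord_matrix $$ (i, j)) =
    const (p i * q j) * (coord_matrix $$ (i, j) :: ('n::finite) ratfun)"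
proof -
  have "reg_translate (mat_diag CARD('n) p) (mat_diag CARD('n) q) (reg_entry i j) =
    reg_const (p i * q j) * (reg_entry i j :: 'n regfun)"
    using P Q ij
  proof (transfer, intro ext)
    fix p q i j and X :: "complex mat"
    assume SL: "mat_diag CARD('n) p \<in> SL CARD('n)" "mat_diag CARD('n) q \<in> SL CARD('n)"
      and ij: "i < CARD('n)" "j < CARD('n)"
    have "(mat_diag CARD('n) p * X * mat_diag CARD('n) q) $$ (i, j) = p i * q j * X $$ (i, j)"
      if "X \<in> SL CARD('n)"
      using that ij by (simp add: SL_def mat_diag_mult_left[of _ "CARD('n)" "CARD('n)"]
          mat_diag_mult_right[of _ "CARD('n)" "CARD('n)"])
    moreover have "mat_diag CARD('n) p * X * mat_diag CARD('n) q \<in> SL CARD('n)"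
      if "X \<in> SL CARD('n)"
      using that SL by (simp add: SL_mult)
    ultimately show "(if mat_diag CARD('n) p \<in> SL CARD('n) \<and> mat_diag CARD('n) q \<in> SL CARD('n) \<and>
         X \<in> SL CARD('n) then
      if mat_diag CARD('n) p * X * mat_diag CARD('n) q \<in> SL CARD('n) \<and> i < CARD('n) \<and> j < CARD('n)
      then (mat_diag CARD('n) p * X * mat_diag CARD('n) q) $$ (i, j) else 0 else 0) =
      (if X \<in> SL CARD('n) then p i * q j else 0) *
      (if X \<in> SL CARD('n) \<and> i < CARD('n) \<and> j < CARD('n) then X $$ (i, j) else 0)"
      using SL ij by auto
  qed
  then show ?thesis using ij
    by (simp add: coord_matrix_def const_def translate_Fract[OF P Q] reg_translate_1[OF P Q])
qed


section \<open>Weights of extended clusters and mutation\<close>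

definition weight_char :: "nat \<Rightarrow> (nat \<Rightarrow> complex) \<Rightarrow> (nat \<Rightarrow> int) \<Rightarrow> ('n::finite) ratfun" where
  "weight_char r d w = const (\<Prod>a<r. d a powi w a)"

context
  fixes r :: nat and d :: "nat \<Rightarrow> complex"
  assumes d: "d \<in> torus r"
begin

lemma weight_char_0: "weight_char r d (\<lambda>_. 0) = (1 :: ('n::finite) ratfun)"
  by (simp add: weight_char_def const_1)

lemma weight_char_add:
  "weight_char r d (\<lambda>a. u a + w a) = (weight_char r d u * weight_char r d w :: ('n::finite) ratfun)"
proof -
  have "(\<Prod>a<r. d a powi (u a + w a)) = (\<Prod>a<r. d a powi u a) * (\<Prod>a<r. d a powi w a)"
    unfolding prod.distrib[symmetric]
    by (rule prod.cong[OF refl], rule power_int_add) (simp add: torus_nonzero[OF d])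
  then show ?thesis by (simp add: weight_char_def const_mult)
qed

lemma weight_char_nonzero: "weight_char r d w \<noteq> (0 :: ('n::finite) ratfun)"
  using torus_nonzero[OF d] unfolding weight_char_def by (intro const_nonzero) auto

lemma weight_char_diff:
  "weight_char r d (\<lambda>a. u a - w a) = (weight_char r d u / weight_char r d w :: ('n::finite) ratfun)"
proof -
  have "weight_char r d w \<noteq> (0 :: 'n ratfun)" by (rule weight_char_nonzero)
  moreover have "weight_char r d (\<lambda>a. u a - w a) * weight_char r d w = (weight_char r d u :: 'n ratfun)"
    by (simp add: weight_char_add[symmetric])
  ultimately show ?thesis by (simp add: nonzero_eq_divide_eq)
qed

lemma weight_char_power:
  "weight_char r d (\<lambda>a. int e * w a) = (weight_char r d w ^ e :: ('n::finite) ratfun)"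
  by (induction e) (simp_all add: weight_char_0 weight_char_add distrib_right)

lemma weight_char_monomial:
  "weight_char r d (\<lambda>a. \<Sum>j\<in>S. int (e j) * w j a) =
    (\<Prod>j\<in>S. weight_char r d (w j) ^ e j :: ('n::finite) ratfun)"
  by (induction S rule: infinite_finite_induct)
    (simp_all add: weight_char_0 weight_char_add weight_char_power)

end

context
  fixes \<phi> :: "('n::finite) ratfun \<Rightarrow> 'n ratfun"
  assumes \<phi>: "field_automorphism \<phi>"
begin

lemma aut_add: "\<phi> (f + g) = \<phi> f + \<phi> g" and aut_mult: "\<phi> (f * g) = \<phi> f * \<phi> g"
  and aut_1: "\<phi> 1 = 1" and aut_0: "\<phi> 0 = 0"
  using \<phi> unfolding field_automorphism_def by (metis const_1 const_0)+

lemma aut_power: "\<phi> (f ^ e) = \<phi> f ^ e"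
  by (induction e) (simp_all add: aut_1 aut_mult)

lemma aut_prod: "\<phi> (\<Prod>j\<in>S. f j) = (\<Prod>j\<in>S. \<phi> (f j))"
  by (induction S rule: infinite_finite_induct) (simp_all add: aut_1 aut_mult)

lemma aut_divide: "\<phi> (f / g) = \<phi> f / \<phi> g"
proof (cases "g = 0")
  case False
  have "\<phi> g * \<phi> (1 / g) = 1" using False by (simp add: aut_mult[symmetric] aut_1)
  then have "\<phi> g \<noteq> 0" by auto
  moreover have "\<phi> (f / g) * \<phi> g = \<phi> f" using False by (simp add: aut_mult[symmetric])
  ultimately show ?thesis by (simp add: field_simps)
qed (simp add: aut_0)

end

text \<open>
  The matrix with rows \<open>w v\<close> has rank \<open>r\<close>.
\<close>

definition separating_weights :: "'v set \<Rightarrow> nat \<Rightarrow> ('v \<Rightarrow> nat \<Rightarrow> int) \<Rightarrow> bool" where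
  "separating_weights V r w \<longleftrightarrow>
    (\<forall>x :: nat \<Rightarrow> rat. (\<forall>v\<in>V. (\<Sum>a<r. of_int (w v a) * x a) = 0) \<longrightarrow> (\<forall>a<r. x a = 0))"

text \<open>
  The invariant of mutation: the extended cluster is semi-invariant with weights \<open>w\<close>, all exchange
  relations are homogeneous for them, the mutable part of the exchange matrix is skew-symmetric,
  and the weights have full rank.
\<close>

definition compatible_weights ::
  "'v set \<Rightarrow> 'v set \<Rightarrow> nat \<Rightarrow> ((nat \<Rightarrow> complex) \<Rightarrow> 'n ratfun \<Rightarrow> 'n ratfun) \<Rightarrow>
    ('v, ('n::finite) ratfun) seed \<Rightarrow> ('v \<Rightarrow> nat \<Rightarrow> int) \<Rightarrow> bool" where
  "compatible_weights V Mut r \<rho> S w \<longleftrightarrow>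
    (\<forall>v\<in>V. \<forall>d\<in>torus r. \<rho> d (fst S v) = weight_char r d (w v) * fst S v) \<and>
    (\<forall>k\<in>Mut. \<forall>a<r. (\<Sum>j\<in>V. snd S k j * w j a) = 0) \<and>
    (\<forall>i\<in>Mut. \<forall>j\<in>Mut. snd S i j = - snd S j i) \<and>
    separating_weights V r w"

text \<open>
  The two summands are equal or opposite, so the division by 2 in the mutation rule is exact.
\<close>

lemma exchange_entry_even: "2 * ((\<bar>x\<bar> * c + x * \<bar>c\<bar>) div 2) = \<bar>x\<bar> * c + x * \<bar>c :: int\<bar>"
  by (cases "x \<ge> 0"; cases "c \<ge> 0") auto

text \<open>
  Both monomials of the exchange relation at \<open>k\<close> have weight \<open>pos\<close>, so the new variable has weight
  \<open>pos - w\<^sub>k\<close>. As \<open>b\<^sub>k\<^sub>k = 0\<close>, the vector \<open>pos\<close> does not involve \<open>w\<^sub>k\<close>, and the substitution of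
  \<open>pos - w\<^sub>k\<close> for \<open>w\<^sub>k\<close> is an involution; in particular it keeps the kernel.
\<close>

lemma compatible_weights_mutation:
  fixes S :: "('v, ('n::finite) ratfun) seed"
  assumes V: "finite V" "Mut \<subseteq> V" and k: "k \<in> Mut"
    and \<rho>: "\<And>d. d \<in> torus r \<Longrightarrow> field_automorphism (\<rho> d)"
    and S: "compatible_weights V Mut r \<rho> S w"
  shows "\<exists>w'. compatible_weights V Mut r \<rho> (mutation V Mut k S) w'"
proof -
  obtain y b where yb: "S = (y, b)" by fastforce
  have semi: "\<rho> d (y v) = weight_char r d (w v) * y v" if "v \<in> V" "d \<in> torus r" for v d
    using S that unfolding compatible_weights_def yb fst_conv by blast
  have hom: "(\<Sum>j\<in>V. b i j * w j a) = 0" if "i \<in> Mut" "a < r" for i a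
    using S that unfolding compatible_weights_def yb snd_conv by blast
  have skew: "b i j = - b j i" if "i \<in> Mut" "j \<in> Mut" for i j
    using S that unfolding compatible_weights_def yb snd_conv by blast
  have sep: "separating_weights V r w"
    using S unfolding compatible_weights_def by blast
  have kV: "k \<in> V" using k V by auto
  have bkk: "b k k = 0" using skew[OF k k] by simp
  define pos where "pos a = (\<Sum>j\<in>{j\<in>V. b k j > 0}. int (nat (b k j)) * w j a)" for a
  define neg where "neg a = (\<Sum>j\<in>{j\<in>V. b k j < 0}. int (nat (- b k j)) * w j a)" for a
  define w' where "w' = w(k := \<lambda>a. pos a - w k a)"
  define b' where "b' = (\<lambda>i j. if i \<notin> Mut then 0 else if i = k \<or> j = k then - b i j
     else b i j + (\<bar>b i k\<bar> * b k j + b i k * \<bar>b k j\<bar>) div 2)"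
  define y' where "y' = y(k := ((\<Prod>j\<in>{j\<in>V. b k j > 0}. y j ^ nat (b k j)) +
     (\<Prod>j\<in>{j\<in>V. b k j < 0}. y j ^ nat (- b k j))) / y k)"
  have S': "mutation V Mut k S = (y', b')"
    by (simp add: mutation_def yb y'_def b'_def)
  have pos_alt: "pos a = (\<Sum>j\<in>V. (if b k j > 0 then b k j else 0) * w j a)" for a
    unfolding pos_def by (intro sum.mono_neutral_cong_left) (auto simp: V)
  have neg_alt: "neg a = (\<Sum>j\<in>V. (if b k j < 0 then - b k j else 0) * w j a)" for a
    unfolding neg_def by (intro sum.mono_neutral_cong_left) (auto simp: V)
  have pos_neg: "pos a = neg a" if "a < r" for a
  proof -
    have "pos a - neg a = (\<Sum>j\<in>V. b k j * w j a)"
      unfolding pos_alt neg_alt sum_subtractf[symmetric] by (intro sum.cong) auto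
    then show ?thesis using hom[OF k that] by simp
  qed
  have abs_sum: "(\<Sum>j\<in>V. \<bar>b k j\<bar> * w j a) = 2 * pos a" if "a < r" for a
  proof -
    have "(\<Sum>j\<in>V. \<bar>b k j\<bar> * w j a) = pos a + neg a"
      unfolding pos_alt neg_alt sum.distrib[symmetric] by (intro sum.cong) auto
    then show ?thesis using pos_neg[OF that] by simp
  qed
  have "\<rho> d (y' v) = weight_char r d (w' v) * y' v" if v: "v \<in> V" and d: "d \<in> torus r" for v d
  proof (cases "v = k")
    case False
    then show ?thesis using semi[OF v d] by (simp add: y'_def w'_def)
  next
    case True
    note aut = \<rho>[OF d]
    have mono: "\<rho> d (\<Prod>j\<in>J. y j ^ e j) =
        weight_char r d (\<lambda>a. \<Sum>j\<in>J. int (e j) * w j a) * (\<Prod>j\<in>J. y j ^ e j)"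
      if "J \<subseteq> V" for J and e :: "'v \<Rightarrow> nat"
    proof -
      have "\<rho> d (\<Prod>j\<in>J. y j ^ e j) = (\<Prod>j\<in>J. (weight_char r d (w j) * y j) ^ e j)"
        using that semi d by (auto simp: aut_prod[OF aut] aut_power[OF aut] intro!: prod.cong)
      then show ?thesis
        by (simp add: weight_char_monomial[OF d] power_mult_distrib prod.distrib)
    qed
    have "(\<Prod>a<r. d a powi neg a) = (\<Prod>a<r. d a powi pos a)"
      by (rule prod.cong[OF refl]) (simp add: pos_neg)
    then have "weight_char r d neg = (weight_char r d pos :: 'n ratfun)"
      by (simp only: weight_char_def)
    then have num: "\<rho> d ((\<Prod>j\<in>{j\<in>V. b k j > 0}. y j ^ nat (b k j)) +
        (\<Prod>j\<in>{j\<in>V. b k j < 0}. y j ^ nat (- b k j))) =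
      weight_char r d pos * ((\<Prod>j\<in>{j\<in>V. b k j > 0}. y j ^ nat (b k j)) +
        (\<Prod>j\<in>{j\<in>V. b k j < 0}. y j ^ nat (- b k j)))"
      unfolding aut_add[OF aut]
      by (simp add: mono pos_def[abs_def] neg_def[abs_def] distrib_left)
    show ?thesis
      unfolding True y'_def w'_def fun_upd_same aut_divide[OF aut] num semi[OF kV d]
      by (simp add: weight_char_diff[OF d])
  qed
  moreover have "(\<Sum>j\<in>V. b' i j * w' j a) = 0" if i: "i \<in> Mut" and a: "a < r" for i a
  proof (cases "i = k")
    case True
    have "(\<Sum>j\<in>V. b' i j * w' j a) = - (\<Sum>j\<in>V. b k j * w j a)"
      unfolding True sum_negf[symmetric] using k bkk
      by (intro sum.cong) (auto simp: b'_def w'_def)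
    then show ?thesis using hom[OF k a] by simp
  next
    case False
    have "2 * (b' i j * w' j a) = 2 * (b i j * w j a) + \<bar>b i k\<bar> * (b k j * w j a) +
        b i k * (\<bar>b k j\<bar> * w j a) - (if j = k then 2 * b i k * pos a else 0)" for j
    proof (cases "j = k")
      case True
      then show ?thesis using False i bkk by (simp add: b'_def w'_def algebra_simps)
    next
      case False
      then have "2 * (b' i j * w' j a) = 2 * (b i j * w j a) +
          (2 * ((\<bar>b i k\<bar> * b k j + b i k * \<bar>b k j\<bar>) div 2)) * w j a"
        using \<open>i \<noteq> k\<close> i by (simp add: b'_def w'_def algebra_simps)
      then show ?thesis using False unfolding exchange_entry_even by (simp add: algebra_simps)
    qed
    then have "2 * (\<Sum>j\<in>V. b' i j * w' j a) = 2 * (\<Sum>j\<in>V. b i j * w j a)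
        + \<bar>b i k\<bar> * (\<Sum>j\<in>V. b k j * w j a) + b i k * (\<Sum>j\<in>V. \<bar>b k j\<bar> * w j a) - 2 * b i k * pos a"
      using V(1) kV
      by (simp only: sum_distrib_left sum.distrib sum_subtractf sum.delta if_True)
    then show ?thesis using hom[OF i a] hom[OF k a] abs_sum[OF a] by simp
  qed
  moreover have "b' i j = - b' j i" if i: "i \<in> Mut" and j: "j \<in> Mut" for i j
  proof (cases "i = k \<or> j = k")
    case True
    then show ?thesis using i j skew[OF i j] by (auto simp: b'_def)
  next
    case False
    then have "b' i j = b i j + (\<bar>b i k\<bar> * b k j + b i k * \<bar>b k j\<bar>) div 2"
      "b' j i = b j i + (\<bar>b j k\<bar> * b k i + b j k * \<bar>b k i\<bar>) div 2"
      using i j by (simp_all add: b'_def)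
    then have "2 * b' i j = 2 * b i j + (\<bar>b i k\<bar> * b k j + b i k * \<bar>b k j\<bar>)"
      "2 * b' j i = 2 * b j i + (\<bar>b j k\<bar> * b k i + b j k * \<bar>b k i\<bar>)"
      using exchange_entry_even[of "b i k" "b k j"] exchange_entry_even[of "b j k" "b k i"]
      by linarith+
    then have "2 * b' i j = - (2 * b' j i)"
      using skew[OF i j] skew[OF i k] skew[OF j k] by simp
    then show ?thesis by simp
  qed
  moreover have "separating_weights V r w'"
    unfolding separating_weights_def
  proof (intro allI impI)
    fix x :: "nat \<Rightarrow> rat" and a
    assume x: "\<forall>v\<in>V. (\<Sum>a<r. of_int (w' v a) * x a) = 0" and a: "a < r"
    have other: "(\<Sum>a<r. of_int (w v a) * x a) = 0" if "v \<in> V" "v \<noteq> k" for v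
      using x that by (auto simp: w'_def)
    have "(\<Sum>a<r. of_int (pos a) * x a) =
        (\<Sum>a<r. \<Sum>j\<in>V. of_int (if b k j > 0 then b k j else 0) * (of_int (w j a) * x a))"
      unfolding pos_alt by (simp add: sum_distrib_right mult.assoc)
    also have "\<dots> = (\<Sum>j\<in>V. of_int (if b k j > 0 then b k j else 0) * (\<Sum>a<r. of_int (w j a) * x a))"
      by (subst sum.swap) (simp add: sum_distrib_left)
    also have "\<dots> = 0"
    proof (intro sum.neutral ballI)
      fix j assume "j \<in> V"
      then show "of_int (if b k j > 0 then b k j else 0) * (\<Sum>a<r. of_int (w j a) * x a) = 0"
        using other[of j] bkk by (cases "j = k") auto
    qed
    finally have "(\<Sum>a<r. of_int (w k a) * x a) = 0"
      using bspec[OF x kV] by (simp add: w'_def left_diff_distrib sum_subtractf)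
    then have "\<forall>v\<in>V. (\<Sum>a<r. of_int (w v a) * x a) = 0" using other by metis
    then show "x a = 0" using sep a by (auto simp: separating_weights_def)
  qed
  ultimately have "compatible_weights V Mut r \<rho> (mutation V Mut k S) w'"
    unfolding compatible_weights_def S' fst_conv snd_conv by blast
  then show ?thesis by blast
qed

lemma compatible_weights_cluster_structure:
  assumes V: "finite V" "Mut \<subseteq> V"
    and \<rho>: "\<And>d. d \<in> torus r \<Longrightarrow> field_automorphism (\<rho> d)"
    and S: "compatible_weights V Mut r \<rho> S w"
    and S': "S' \<in> cluster_structure V Mut S"
  shows "\<exists>w'. compatible_weights V Mut r \<rho> S' w'"
  using S'
proof (induction rule: cluster_structure.induct)
  case initial
  then show ?case using S by blast
next
  case (mutate S' k)
  then show ?case using compatible_weights_mutation[where \<rho> = \<rho> and r = r, OF V mutate.hyps(2) \<rho>] by blast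
qed


section \<open>Semi-invariance of the initial cluster\<close>

text \<open>
  The weight of \<open>M\<^sub>i\<^sub>j\<close> for row weights \<open>p\<close> and column weights \<open>q\<close>. Since \<open>M\<^sub>i\<^sub>j\<close> extends from \<open>(i, j)\<close>
  to the last row or column of \<open>X\<close>, this is a sum along the diagonal through \<open>(i, j)\<close>. Truncated
  subtraction makes it 0 outside the matrix.
\<close>

definition minor_weight ::
  "nat \<Rightarrow> (nat \<Rightarrow> 'g) \<Rightarrow> (nat \<Rightarrow> 'g) \<Rightarrow> nat \<Rightarrow> nat \<Rightarrow> 'g::comm_monoid_add" where
  "minor_weight n p q i j = (\<Sum>t<n + 1 - max i j. p (i + t) + q (j + t))"

text \<open>
  The equations \<open>i + \<alpha> = n + j\<close> and \<open>j + \<beta> = n + i\<close> describe the two diagonals of modified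
  matrices; the bounds on \<open>j\<close> or \<open>i\<close> follow from \<open>i \<le> n\<close> or \<open>j \<le> n\<close>.
\<close>

definition initial_weight ::
  "nat \<Rightarrow> nat \<Rightarrow> nat \<Rightarrow> (nat \<Rightarrow> 'g) \<Rightarrow> (nat \<Rightarrow> 'g) \<Rightarrow> nat \<Rightarrow> nat \<Rightarrow> 'g::comm_monoid_add" where
  "initial_weight n \<alpha> \<beta> p q i j = minor_weight n p q i j
    + (if i + \<alpha> = n + j then minor_weight n p q 1 (\<beta> + 1) else 0)
    + (if j + \<beta> = n + i then minor_weight n p q (\<alpha> + 1) 1 else 0)"

lemma sum_add_split:
  fixes f :: "nat \<Rightarrow> 'g::comm_monoid_add"
  shows "(\<Sum>x<h + k. f x) = (\<Sum>x<h. f x) + (\<Sum>t<k. f (h + t))"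
  by (induction k) (simp_all add: add.assoc)

lemma M_bar_lower:
  assumes "i + h = n + 1" "j + h = \<alpha> + 1" "\<beta> + \<mu> = n" "1 \<le> h" "1 \<le> j" "1 \<le> \<mu>"
  shows "M_bar n \<alpha> \<beta> Z i j = mat (h + \<mu>) (h + \<mu>) (\<lambda>(a, b).
    if a < h then if b \<le> h then Z $$ (i + a - 1, j + b - 1) else 0
    else if b < h - 1 then 0 else Z $$ (a - h, \<beta> + (b - (h - 1)) - 1))"
proof -
  have d: "1 \<le> j \<and> j \<le> \<alpha> \<and> i = n + j - \<alpha>" "n + 1 - i = h" "\<alpha> + 1 + 1 - j = h + 1" "n - i + 1 = h"
    "n - i = h - 1" "n - \<beta> = \<mu>" "n + 1 - \<beta> = \<mu> + 1" "\<mu> + 1 - 1 = \<mu>" "h - 1 + 1 = h"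
    using assms by auto
  have "M_bar n \<alpha> \<beta> Z i j = (block Z i n j (\<alpha> + 1) @\<^sub>c 0\<^sub>m h (\<mu> - 1)) @\<^sub>r
      (0\<^sub>m \<mu> (h - 1) @\<^sub>c block Z 1 \<mu> \<beta> n)"
    unfolding M_bar_def Let_def if_P[OF d(1)] d(4,5,6,9) ..
  also have "\<dots> = mat (h + \<mu>) (h + \<mu>) (\<lambda>(a, b).
    if a < h then if b \<le> h then Z $$ (i + a - 1, j + b - 1) else 0
    else if b < h - 1 then 0 else Z $$ (a - h, \<beta> + (b - (h - 1)) - 1))"
    unfolding append_rows_def append_cols_def block_def d(2,3,7,8)
    using assms(4,6) by (intro eq_matI) auto
  finally show ?thesis .
qed

text \<open>
  The transpose has the same shape as the matrices on the other modified diagonal, so one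
  determinant computation serves both.
\<close>

lemma M_bar_upper:
  assumes "j + h = n + 1" "i + h = \<beta> + 1" "\<alpha> + \<mu> = n" "1 \<le> h" "1 \<le> i" "1 \<le> \<mu>"
    and "i + \<alpha> \<noteq> n + j"
  shows "(M_bar n \<alpha> \<beta> Z i j)\<^sup>T = mat (h + \<mu>) (h + \<mu>) (\<lambda>(a, b).
    if a < h then if b \<le> h then Z $$ (i + b - 1, j + a - 1) else 0
    else if b < h - 1 then 0 else Z $$ (\<alpha> + (b - (h - 1)) - 1, a - h))"
proof -
  have d: "1 \<le> i \<and> i \<le> \<beta> \<and> j = n + i - \<beta>" "n + 1 - j = h" "\<beta> + 1 + 1 - i = h + 1" "n - j + 1 = h"
    "n - j = h - 1" "n - \<alpha> = \<mu>" "n + 1 - \<alpha> = \<mu> + 1" "\<mu> + 1 - 1 = \<mu>" "h - 1 + 1 = h"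
    "\<not> (1 \<le> j \<and> j \<le> \<alpha> \<and> i = n + j - \<alpha>)"
    using assms by auto
  have M: "M_bar n \<alpha> \<beta> Z i j = (block Z i (\<beta> + 1) j n @\<^sub>r 0\<^sub>m (\<mu> - 1) h) @\<^sub>c
      (0\<^sub>m (h - 1) \<mu> @\<^sub>r block Z \<alpha> n 1 \<mu>)"
    unfolding M_bar_def Let_def if_not_P[OF d(10)] if_P[OF d(1)] d(4,5,6,9) ..
  show ?thesis
    unfolding M append_rows_def append_cols_def block_def d(2,3,7,8)
    using assms(4,6) by (intro eq_matI) auto
qed

lemma M_bar_minor:
  assumes "i + \<alpha> \<noteq> n + j" "j + \<beta> \<noteq> n + i" "i \<le> n" "j \<le> n" "\<alpha> < n" "\<beta> < n"
  shows "M_bar n \<alpha> \<beta> Z i j =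
    mat (n + 1 - max i j) (n + 1 - max i j) (\<lambda>(a, b). Z $$ (i + a - 1, j + b - 1))"
proof -
  have d: "\<not> (1 \<le> j \<and> j \<le> \<alpha> \<and> i = n + j - \<alpha>)" "\<not> (1 \<le> i \<and> i \<le> \<beta> \<and> j = n + i - \<beta>)"
    using assms by auto
  show ?thesis
  proof (cases "j > i")
    case True
    then have "n - j + i + 1 - i = n + 1 - max i j" "n + 1 - j = n + 1 - max i j"
      using assms by auto
    with True show ?thesis
      by (simp only: M_bar_def if_not_P[OF d(1)] if_not_P[OF d(2)] M_matrix_def if_P block_def)
  next
    case False
    then have "n + 1 - i = n + 1 - max i j" "n - i + j + 1 - j = n + 1 - max i j"
      using assms by auto
    with False show ?thesis
      by (simp only: M_bar_def if_not_P[OF d(1)] if_not_P[OF d(2)] M_matrix_def if_False block_def)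
  qed
qed

text \<open>
  Weights are written additively and the factors that they stand for multiplicatively; \<open>\<chi>\<close>
  translates.
\<close>

locale character =
  fixes \<chi> :: "'g::ab_group_add \<Rightarrow> 'k::comm_ring_1"
  assumes \<chi>_0: "\<chi> 0 = 1" and \<chi>_add: "\<chi> (g + h) = \<chi> g * \<chi> h"
begin

lemma \<chi>_sum: "\<chi> (\<Sum>x\<in>S. f x) = (\<Prod>x\<in>S. \<chi> (f x))"
  by (induction S rule: infinite_finite_induct) (simp_all add: \<chi>_0 \<chi>_add)

lemma det_scaled:
  assumes A: "A \<in> carrier_mat N N" and B: "B \<in> carrier_mat N N"
    and entry: "\<And>a b. a < N \<Longrightarrow> b < N \<Longrightarrow> B $$ (a, b) = \<chi> (r a + c b) * A $$ (a, b)"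
  shows "det B = \<chi> ((\<Sum>a<N. r a) + (\<Sum>b<N. c b)) * det A"
proof -
  have det_diag: "det (mat_diag N (\<lambda>a. \<chi> (f a))) = \<chi> (\<Sum>a<N. f a)" for f
  proof -
    have "det (mat_diag N (\<lambda>a. \<chi> (f a))) = prod_list (diag_mat (mat_diag N (\<lambda>a. \<chi> (f a))))"
      by (intro det_upper_triangular[of _ N]) (auto simp: mat_diag_def)
    also have "\<dots> = prod_list (map (\<lambda>a. \<chi> (f a)) [0..<N])"
      by (auto simp: diag_mat_def mat_diag_def intro!: arg_cong[where f = prod_list])
    also have "\<dots> = \<chi> (\<Sum>a<N. f a)"
      by (simp add: \<chi>_sum prod.distinct_set_conv_list[symmetric] atLeast0LessThan)
    finally show ?thesis .
  qed
  have "B = mat_diag N (\<lambda>a. \<chi> (r a)) * A * mat_diag N (\<lambda>b. \<chi> (c b))"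
    using A B by (intro eq_matI)
      (auto simp: mat_diag_mult_left[of _ N N] mat_diag_mult_right[of _ N N] entry \<chi>_add mult_ac)
  then have "det B = \<chi> (\<Sum>a<N. r a) * det A * \<chi> (\<Sum>b<N. c b)"
    using A by (simp add: det_mult[of _ N] mult_carrier_mat[of _ N N] det_diag)
  then show ?thesis by (simp add: \<chi>_add mult_ac)
qed

text \<open>
  The upper block has \<open>h\<close> rows and \<open>h + 1\<close> columns, the lower one \<open>\<mu>\<close> rows and \<open>\<mu> + 1\<close> columns, and
  they share the columns \<open>h - 1\<close> and \<open>h\<close> (counted from 0). The weights of the shared columns in
  the two blocks differ by the constant \<open>\<kappa>\<close>. Moving \<open>\<kappa>\<close> from the columns to the rows of the lower
  block, every entry is scaled by a row weight plus a column weight. Since the lower block has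
  \<open>\<mu>\<close> rows and only \<open>\<mu> - 1\<close> columns of its own, one \<open>\<kappa>\<close> survives; it turns \<open>q h\<close> into \<open>q' 1\<close>.
\<close>

lemma det_scaled_overlapping_blocks:
  assumes A: "A \<in> carrier_mat (h + \<mu>) (h + \<mu>)" and B: "B \<in> carrier_mat (h + \<mu>) (h + \<mu>)"
    and h: "h \<ge> 1" and \<mu>: "\<mu> \<ge> 1"
    and up: "\<And>a b. a < h \<Longrightarrow> b \<le> h \<Longrightarrow> B $$ (a, b) = \<chi> (p a + q b) * A $$ (a, b)"
    and up0: "\<And>a b. a < h \<Longrightarrow> h < b \<Longrightarrow> b < h + \<mu> \<Longrightarrow> A $$ (a, b) = 0 \<and> B $$ (a, b) = 0"
    and low: "\<And>a b. a < \<mu> \<Longrightarrow> b \<le> \<mu> \<Longrightarrow>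
      B $$ (h + a, h - 1 + b) = \<chi> (p' a + q' b) * A $$ (h + a, h - 1 + b)"
    and low0: "\<And>a b. a < \<mu> \<Longrightarrow> b < h - 1 \<Longrightarrow> A $$ (h + a, b) = 0 \<and> B $$ (h + a, b) = 0"
    and rel: "q h - q (h - 1) = q' 1 - q' 0"
  shows "det B = \<chi> ((\<Sum>a<h. p a + q a) + (\<Sum>a<\<mu>. p' a + q' (a + 1))) * det A"
proof -
  \<comment> \<open>By assumption this is also \<open>q' 1 - q h\<close>.\<close>
  define \<kappa> where "\<kappa> = q' 0 - q (h - 1)"
  define r where "r a = (if a < h then p a else p' (a - h) + \<kappa>)" for a
  define c where "c b = (if b \<le> h then q b else q' (b - (h - 1)) - \<kappa>)" for b
  have entry: "B $$ (a, b) = \<chi> (r a + c b) * A $$ (a, b)" if a: "a < h + \<mu>" and b: "b < h + \<mu>" for a b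
  proof (cases "a < h")
    case True
    then show ?thesis using up[of a b] up0[of a b] b
      by (cases "b \<le> h") (auto simp: r_def c_def)
  next
    case False
    define a' where "a' = a - h"
    have a': "a = h + a'" "a' < \<mu>" using False a by (auto simp: a'_def)
    show ?thesis
    proof (cases "b < h - 1")
      case True
      then show ?thesis using low0[OF a'(2) True] by (simp add: a'(1))
    next
      case b1: False
      define b' where "b' = b - (h - 1)"
      have b': "b = h - 1 + b'" "b' \<le> \<mu>" using b1 b h by (auto simp: b'_def)
      have "r a + c b = p' a' + q' b'"
      proof -
        consider "b' = 0" | "b' = 1" | "b' \<ge> 2" by linarith
        then show ?thesis
        proof cases
          case 1
          then show ?thesis using h by (simp add: r_def c_def a' b' \<kappa>_def)
        next
          case 2
          then have "b = h" using b' h by simp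
          then show ?thesis using rel 2 by (simp add: r_def c_def a' \<kappa>_def algebra_simps)
        next
          case 3
          then have "\<not> b \<le> h" using b' h by simp
          then show ?thesis using b' by (simp add: r_def c_def a')
        qed
      qed
      then show ?thesis using low[OF a'(2) b'(2)] by (simp add: a' b')
    qed
  qed
  obtain \<nu> where \<nu>: "\<mu> = Suc \<nu>" using \<mu> by (cases \<mu>) auto
  have q1: "q h + \<kappa> = q' 1" using rel by (simp add: \<kappa>_def algebra_simps)
  have r: "(\<Sum>a<h + \<mu>. r a) = (\<Sum>a<h. p a) + (\<Sum>a<\<mu>. p' a) + ((\<Sum>a<\<nu>. \<kappa>) + \<kappa>)"
    unfolding sum_add_split by (simp add: r_def sum.distrib \<nu> add_ac)
  have "(\<Sum>b<h + \<mu>. c b) = (\<Sum>b<Suc h + \<nu>. c b)" by (simp add: \<nu>)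
  also have "\<dots> = (\<Sum>b<Suc h. c b) + (\<Sum>t<\<nu>. c (Suc h + t))"
    by (rule sum_add_split)
  also have "(\<Sum>b<Suc h. c b) = (\<Sum>b<h. q b) + q h" by (simp add: c_def)
  also have "(\<Sum>t<\<nu>. c (Suc h + t)) = (\<Sum>t<\<nu>. q' (t + 2) - \<kappa>)"
  proof (rule sum.cong)
    fix t
    have "Suc h + t - (h - 1) = t + 2" using h by simp
    then show "c (Suc h + t) = q' (t + 2) - \<kappa>" by (simp add: c_def)
  qed simp
  finally have "(\<Sum>a<h + \<mu>. r a) + (\<Sum>b<h + \<mu>. c b) =
      (\<Sum>a<h. p a) + (\<Sum>b<h. q b) + (\<Sum>a<\<mu>. p' a) + ((q h + \<kappa>) + (\<Sum>t<\<nu>. q' (t + 2)))"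
    unfolding r by (simp add: sum_subtractf algebra_simps)
  also have "(q h + \<kappa>) + (\<Sum>t<\<nu>. q' (t + 2)) = (\<Sum>a<\<mu>. q' (a + 1))"
    unfolding q1 \<nu> by (subst sum.lessThan_Suc_shift) simp
  finally have "(\<Sum>a<h + \<mu>. r a) + (\<Sum>b<h + \<mu>. c b) =
      (\<Sum>a<h. p a + q a) + (\<Sum>a<\<mu>. p' a + q' (a + 1))"
    by (simp add: sum.distrib add_ac)
  with det_scaled[of A "h + \<mu>" B r c, OF A B entry] show ?thesis by simp
qed

text \<open>
  For the arrays with two blocks, the weight of the determinant is that of the leading term in the
  Laplace expansion: \<open>M\<^sub>i\<^sub>j\<close> times the minor with weight \<open>m\<^sub>1\<^sub>,\<^sub>\<beta>\<^sub>+\<^sub>1\<close> or \<open>m\<^sub>\<alpha>\<^sub>+\<^sub>1\<^sub>,\<^sub>1\<close>.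
\<close>

lemma det_M_bar_scaled:
  fixes p q :: "nat \<Rightarrow> 'g"
  assumes X: "X \<in> carrier_mat n n" and Y: "Y \<in> carrier_mat n n"
    and entry: "\<And>i j. i < n \<Longrightarrow> j < n \<Longrightarrow> Y $$ (i, j) = \<chi> (p (i + 1) + q (j + 1)) * X $$ (i, j)"
    and p: "p \<alpha> - p (\<alpha> + 1) = p \<beta> - p (\<beta> + 1)"
    and q: "q \<alpha> - q (\<alpha> + 1) = q \<beta> - q (\<beta> + 1)"
    and \<alpha>\<beta>: "1 \<le> \<alpha>" "\<alpha> < \<beta>" "\<beta> < n"
    and ij: "1 \<le> i" "i \<le> n" "1 \<le> j" "j \<le> n"
  shows "det (M_bar n \<alpha> \<beta> Y i j) = \<chi> (initial_weight n \<alpha> \<beta> p q i j) * det (M_bar n \<alpha> \<beta> X i j)"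
proof -
  consider (low) "i + \<alpha> = n + j" | (up) "i + \<alpha> \<noteq> n + j" "j + \<beta> = n + i"
    | (plain) "i + \<alpha> \<noteq> n + j" "j + \<beta> \<noteq> n + i" by blast
  then show ?thesis
  proof cases
    case low
    define h \<mu> where "h = n + 1 - i" and "\<mu> = n - \<beta>"
    have h: "h \<ge> 1" "\<mu> \<ge> 1" and e: "i + h = n + 1" "j + h = \<alpha> + 1" "\<beta> + \<mu> = n"
      and ne: "j + \<beta> \<noteq> n + i" and max: "n + 1 - max i j = h" "n + 1 - max 1 (\<beta> + 1) = \<mu>"
      using low ij \<alpha>\<beta> by (auto simp: h_def \<mu>_def)
    note M = M_bar_lower[OF e h(1) ij(3) h(2)]
    have w: "initial_weight n \<alpha> \<beta> p q i j =
      (\<Sum>a<h. p (i + a) + q (j + a)) + (\<Sum>a<\<mu>. p (1 + a) + q (\<beta> + (a + 1)))"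
      using low ne max by (simp add: initial_weight_def minor_weight_def)
    show ?thesis unfolding w
    proof (rule det_scaled_overlapping_blocks)
      show "M_bar n \<alpha> \<beta> X i j \<in> carrier_mat (h + \<mu>) (h + \<mu>)"
        "M_bar n \<alpha> \<beta> Y i j \<in> carrier_mat (h + \<mu>) (h + \<mu>)"
        by (simp_all add: M)
      show "M_bar n \<alpha> \<beta> Y i j $$ (a, b) = \<chi> (p (i + a) + q (j + b)) * M_bar n \<alpha> \<beta> X i j $$ (a, b)"
        if "a < h" "b \<le> h" for a b
      proof -
        have "i + a - 1 < n" "j + b - 1 < n" "i + a - 1 + 1 = i + a" "j + b - 1 + 1 = j + b"
          using that e h ij(1,3) \<alpha>\<beta> by linarith+
        then show ?thesis using that h(2) entry[of "i + a - 1" "j + b - 1"] by (simp add: M)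
      qed
      show "M_bar n \<alpha> \<beta> Y i j $$ (h + a, h - 1 + b) =
          \<chi> (p (1 + a) + q (\<beta> + b)) * M_bar n \<alpha> \<beta> X i j $$ (h + a, h - 1 + b)"
        if "a < \<mu>" "b \<le> \<mu>" for a b
      proof -
        have "a < n" "\<beta> + b - 1 < n" "\<beta> + b - 1 + 1 = \<beta> + b" "h - 1 + b < h + \<mu>"
          "\<not> h - 1 + b < h - 1" "h - 1 + b - (h - 1) = b"
          using that e h \<alpha>\<beta> by linarith+
        then show ?thesis using that entry[of a "\<beta> + b - 1"]
          by (simp only: M index_mat case_prod_conv add_less_cancel_left not_add_less1 if_False
              add_diff_cancel_left' add.commute[of a 1])
      qed
      show "M_bar n \<alpha> \<beta> X i j $$ (a, b) = 0 \<and> M_bar n \<alpha> \<beta> Y i j $$ (a, b) = 0"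
        if "a < h" "h < b" "b < h + \<mu>" for a b
        using that by (simp add: M)
      show "M_bar n \<alpha> \<beta> X i j $$ (h + a, b) = 0 \<and> M_bar n \<alpha> \<beta> Y i j $$ (h + a, b) = 0"
        if "a < \<mu>" "b < h - 1" for a b
        using that by (simp add: M)
      have "j + (h - 1) = \<alpha>" using e h by simp
      then show "q (j + h) - q (j + (h - 1)) = q (\<beta> + 1) - q (\<beta> + 0)"
        using q unfolding e(2) by (simp add: algebra_simps)
    qed (fact h)+
  next
    case up
    define h \<mu> where "h = n + 1 - j" and "\<mu> = n - \<alpha>"
    have h: "h \<ge> 1" "\<mu> \<ge> 1" and e: "j + h = n + 1" "i + h = \<beta> + 1" "\<alpha> + \<mu> = n"
      using up ij \<alpha>\<beta> unfolding h_def \<mu>_def by linarith+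
    have "i < j" using up(2) \<alpha>\<beta>(3) by linarith
    then have max: "n + 1 - max i j = h" "n + 1 - max (\<alpha> + 1) 1 = \<mu>"
      by (simp_all add: h_def \<mu>_def)
    note M = M_bar_upper[OF e h(1) ij(1) h(2) up(1)]
    have c: "M_bar n \<alpha> \<beta> Z i j \<in> carrier_mat (h + \<mu>) (h + \<mu>)" for Z :: "'k mat"
      using arg_cong[OF M[of Z], of dim_row] arg_cong[OF M[of Z], of dim_col]
      by (intro carrier_matI) simp_all
    have w: "initial_weight n \<alpha> \<beta> p q i j =
      (\<Sum>a<h. q (j + a) + p (i + a)) + (\<Sum>a<\<mu>. q (1 + a) + p (\<alpha> + (a + 1)))"
      using up max by (simp add: initial_weight_def minor_weight_def add.commute)
    have "det ((M_bar n \<alpha> \<beta> Y i j)\<^sup>T) =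
      \<chi> (initial_weight n \<alpha> \<beta> p q i j) * det ((M_bar n \<alpha> \<beta> X i j)\<^sup>T)" unfolding w
    proof (rule det_scaled_overlapping_blocks)
      show "(M_bar n \<alpha> \<beta> X i j)\<^sup>T \<in> carrier_mat (h + \<mu>) (h + \<mu>)"
        "(M_bar n \<alpha> \<beta> Y i j)\<^sup>T \<in> carrier_mat (h + \<mu>) (h + \<mu>)"
        by (simp_all add: M)
      show "(M_bar n \<alpha> \<beta> Y i j)\<^sup>T $$ (a, b) = \<chi> (q (j + a) + p (i + b)) * (M_bar n \<alpha> \<beta> X i j)\<^sup>T $$ (a, b)"
        if "a < h" "b \<le> h" for a b
      proof -
        have "i + b - 1 < n" "j + a - 1 < n" "i + b - 1 + 1 = i + b" "j + a - 1 + 1 = j + a"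
          using that e h ij(1,3) \<alpha>\<beta> by linarith+
        then show ?thesis using that h(2) entry[of "i + b - 1" "j + a - 1"]
          by (simp add: M add.commute[of "q _"])
      qed
      show "(M_bar n \<alpha> \<beta> Y i j)\<^sup>T $$ (h + a, h - 1 + b) =
          \<chi> (q (1 + a) + p (\<alpha> + b)) * (M_bar n \<alpha> \<beta> X i j)\<^sup>T $$ (h + a, h - 1 + b)"
        if "a < \<mu>" "b \<le> \<mu>" for a b
      proof -
        have "a < n" "\<alpha> + b - 1 < n" "\<alpha> + b - 1 + 1 = \<alpha> + b" "h - 1 + b < h + \<mu>"
          "\<not> h - 1 + b < h - 1" "h - 1 + b - (h - 1) = b"
          using that e h \<alpha>\<beta> by linarith+
        then show ?thesis using that entry[of "\<alpha> + b - 1" a]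
          by (simp only: M index_mat case_prod_conv add_less_cancel_left not_add_less1 if_False
              add_diff_cancel_left' add.commute[of a 1] add.commute[of "q _"])
      qed
      show "(M_bar n \<alpha> \<beta> X i j)\<^sup>T $$ (a, b) = 0 \<and> (M_bar n \<alpha> \<beta> Y i j)\<^sup>T $$ (a, b) = 0"
        if "a < h" "h < b" "b < h + \<mu>" for a b
        using that by (simp add: M)
      show "(M_bar n \<alpha> \<beta> X i j)\<^sup>T $$ (h + a, b) = 0 \<and> (M_bar n \<alpha> \<beta> Y i j)\<^sup>T $$ (h + a, b) = 0"
        if "a < \<mu>" "b < h - 1" for a b
        using that by (simp add: M)
      have "i + (h - 1) = \<beta>" using e h by simp
      then show "p (i + h) - p (i + (h - 1)) = p (\<alpha> + 1) - p (\<alpha> + 0)"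
        using p unfolding e(2) by (simp add: algebra_simps)
    qed (fact h)+
    then show ?thesis by (simp add: det_transpose[OF c])
  next
    case plain
    define h where "h = n + 1 - max i j"
    have M: "M_bar n \<alpha> \<beta> Z i j = mat h h (\<lambda>(a, b). Z $$ (i + a - 1, j + b - 1))" for Z :: "'k mat"
      unfolding h_def using plain ij \<alpha>\<beta> by (intro M_bar_minor) auto
    have w: "initial_weight n \<alpha> \<beta> p q i j = (\<Sum>a<h. p (i + a)) + (\<Sum>a<h. q (j + a))"
      using plain by (simp add: initial_weight_def minor_weight_def h_def sum.distrib)
    show ?thesis unfolding w
    proof (rule det_scaled)
      show "M_bar n \<alpha> \<beta> Y i j $$ (a, b) = \<chi> (p (i + a) + q (j + b)) * M_bar n \<alpha> \<beta> X i j $$ (a, b)"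
        if "a < h" "b < h" for a b
      proof -
        have "i + a - 1 < n" "j + b - 1 < n" "i + a - 1 + 1 = i + a" "j + b - 1 + 1 = j + b"
          using that ij(1,3) unfolding h_def by linarith+
        then show ?thesis using that entry[of "i + a - 1" "j + b - 1"] by (simp add: M)
      qed
    qed (simp_all add: M)
  qed
qed

end

text \<open>
  Used both for evaluating exponent vectors at an index and for pairing them with a vector.
\<close>

lemma initial_weight_additive:
  fixes \<phi> :: "'g::comm_monoid_add \<Rightarrow> 'h::comm_monoid_add"
  assumes "\<phi> 0 = 0" and "\<And>u v. \<phi> (u + v) = \<phi> u + \<phi> v"
  shows "initial_weight n \<alpha> \<beta> (\<lambda>i. \<phi> (p i)) (\<lambda>i. \<phi> (q i)) i j = \<phi> (initial_weight n \<alpha> \<beta> p q i j)"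
proof -
  have "\<phi> (\<Sum>t\<in>T. f t) = (\<Sum>t\<in>T. \<phi> (f t))" for T :: "nat set" and f
    by (induction T rule: infinite_finite_induct) (simp_all add: assms)
  then show ?thesis by (simp add: initial_weight_def minor_weight_def assms)
qed

text \<open>
  Entrywise maps commute with the construction of the matrices, as all indices stay inside \<open>X\<close>;
  outside, \<open>map_mat\<close> would not be determined by the entries.
\<close>

lemma M_bar_map_mat:
  assumes h0: "h 0 = 0" and X: "X \<in> carrier_mat n n"
    and \<alpha>\<beta>: "1 \<le> \<alpha>" "\<alpha> < \<beta>" "\<beta> < n" and ij: "1 \<le> i" "i \<le> n" "1 \<le> j" "j \<le> n"
  shows "M_bar n \<alpha> \<beta> (map_mat h X) i j = map_mat h (M_bar n \<alpha> \<beta> X i j)"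
proof -
  have X': "map_mat h X $$ (a, b) = h (X $$ (a, b))" if "a < n" "b < n" for a b
    using X that by simp
  consider (low) "i + \<alpha> = n + j" | (up) "i + \<alpha> \<noteq> n + j" "j + \<beta> = n + i"
    | (plain) "i + \<alpha> \<noteq> n + j" "j + \<beta> \<noteq> n + i" by blast
  then show ?thesis
  proof cases
    case low
    define k \<mu> where "k = n + 1 - i" and "\<mu> = n - \<beta>"
    have k: "k \<ge> 1" "\<mu> \<ge> 1" and e: "i + k = n + 1" "j + k = \<alpha> + 1" "\<beta> + \<mu> = n"
      using low ij \<alpha>\<beta> by (auto simp: k_def \<mu>_def)
    note M = M_bar_lower[OF e k(1) ij(3) k(2)]
    show ?thesis unfolding M
    proof (rule eq_matI)
      fix a b
      assume "a < dim_row (map_mat h (mat (k + \<mu>) (k + \<mu>) (\<lambda>(a, b).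
          if a < k then if b \<le> k then X $$ (i + a - 1, j + b - 1) else 0
          else if b < k - 1 then 0 else X $$ (a - k, \<beta> + (b - (k - 1)) - 1))))"
        "b < dim_col (map_mat h (mat (k + \<mu>) (k + \<mu>) (\<lambda>(a, b).
          if a < k then if b \<le> k then X $$ (i + a - 1, j + b - 1) else 0
          else if b < k - 1 then 0 else X $$ (a - k, \<beta> + (b - (k - 1)) - 1))))"
      then have ab: "a < k + \<mu>" "b < k + \<mu>" by simp_all
      have "a < k \<Longrightarrow> i + a - 1 < n" "b \<le> k \<Longrightarrow> j + b - 1 < n" "a - k < n"
        "\<beta> + (b - (k - 1)) - 1 < n"
        using ab e k \<alpha>\<beta> ij by linarith+
      then show "mat (k + \<mu>) (k + \<mu>) (\<lambda>(a, b).
          if a < k then if b \<le> k then map_mat h X $$ (i + a - 1, j + b - 1) else 0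
          else if b < k - 1 then 0 else map_mat h X $$ (a - k, \<beta> + (b - (k - 1)) - 1)) $$ (a, b) =
        map_mat h (mat (k + \<mu>) (k + \<mu>) (\<lambda>(a, b).
          if a < k then if b \<le> k then X $$ (i + a - 1, j + b - 1) else 0
          else if b < k - 1 then 0 else X $$ (a - k, \<beta> + (b - (k - 1)) - 1))) $$ (a, b)"
        using ab by (simp add: X' h0 del: index_map_mat(1)) (auto simp: X' h0)
    qed simp_all
  next
    case up
    define k \<mu> where "k = n + 1 - j" and "\<mu> = n - \<alpha>"
    have k: "k \<ge> 1" "\<mu> \<ge> 1" and e: "j + k = n + 1" "i + k = \<beta> + 1" "\<alpha> + \<mu> = n"
      using up ij \<alpha>\<beta> unfolding k_def \<mu>_def by linarith+
    note M = M_bar_upper[OF e k(1) ij(1) k(2) up(1)]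
    have "(M_bar n \<alpha> \<beta> (map_mat h X) i j)\<^sup>T = map_mat h ((M_bar n \<alpha> \<beta> X i j)\<^sup>T)" unfolding M
    proof (rule eq_matI)
      fix a b
      assume "a < dim_row (map_mat h (mat (k + \<mu>) (k + \<mu>) (\<lambda>(a, b).
          if a < k then if b \<le> k then X $$ (i + b - 1, j + a - 1) else 0
          else if b < k - 1 then 0 else X $$ (\<alpha> + (b - (k - 1)) - 1, a - k))))"
        "b < dim_col (map_mat h (mat (k + \<mu>) (k + \<mu>) (\<lambda>(a, b).
          if a < k then if b \<le> k then X $$ (i + b - 1, j + a - 1) else 0
          else if b < k - 1 then 0 else X $$ (\<alpha> + (b - (k - 1)) - 1, a - k))))"
      then have ab: "a < k + \<mu>" "b < k + \<mu>" by simp_all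
      have "a < k \<Longrightarrow> j + a - 1 < n" "b \<le> k \<Longrightarrow> i + b - 1 < n" "a - k < n"
        "\<alpha> + (b - (k - 1)) - 1 < n"
        using ab e k \<alpha>\<beta> ij by linarith+
      then show "mat (k + \<mu>) (k + \<mu>) (\<lambda>(a, b).
          if a < k then if b \<le> k then map_mat h X $$ (i + b - 1, j + a - 1) else 0
          else if b < k - 1 then 0 else map_mat h X $$ (\<alpha> + (b - (k - 1)) - 1, a - k)) $$ (a, b) =
        map_mat h (mat (k + \<mu>) (k + \<mu>) (\<lambda>(a, b).
          if a < k then if b \<le> k then X $$ (i + b - 1, j + a - 1) else 0
          else if b < k - 1 then 0 else X $$ (\<alpha> + (b - (k - 1)) - 1, a - k))) $$ (a, b)"
        using ab by (simp add: X' h0 del: index_map_mat(1)) (auto simp: X' h0)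
    qed simp_all
    also have "\<dots> = (map_mat h (M_bar n \<alpha> \<beta> X i j))\<^sup>T" by (rule eq_matI) auto
    finally show ?thesis by (metis transpose_transpose)
  next
    case plain
    show ?thesis
      unfolding M_bar_minor[OF plain ij(2,4) less_trans[OF \<alpha>\<beta>(2,3)] \<alpha>\<beta>(3)]
    proof (rule eq_matI)
      fix a b
      assume "a < dim_row (map_mat h (mat (n + 1 - max i j) (n + 1 - max i j)
          (\<lambda>(a, b). X $$ (i + a - 1, j + b - 1))))"
        "b < dim_col (map_mat h (mat (n + 1 - max i j) (n + 1 - max i j)
          (\<lambda>(a, b). X $$ (i + a - 1, j + b - 1))))"
      then have ab: "a < n + 1 - max i j" "b < n + 1 - max i j" by simp_all
      then have "i + a - 1 < n" "j + b - 1 < n" using ij by linarith+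
      then show "mat (n + 1 - max i j) (n + 1 - max i j)
          (\<lambda>(a, b). map_mat h X $$ (i + a - 1, j + b - 1)) $$ (a, b) =
        map_mat h (mat (n + 1 - max i j) (n + 1 - max i j)
          (\<lambda>(a, b). X $$ (i + a - 1, j + b - 1))) $$ (a, b)"
        using ab by (simp only: index_mat(1) case_prod_conv X' index_map_mat(1) dim_row_mat dim_col_mat)
    qed simp_all
  qed
qed

lemma set_vertices: "set (vertices n) = {1..n} \<times> {1..n} - {(1, 1)}"
  by (auto simp: vertices_def)

lemma weight_char_character:
  assumes "d \<in> torus r"
  shows "character (weight_char r d :: (nat \<Rightarrow> int) \<Rightarrow> ('n::finite) ratfun)"
proof
  show "weight_char r d 0 = (1 :: 'n ratfun)"
    using weight_char_0[OF assms] by (simp add: zero_fun_def)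
  show "weight_char r d (u + w) = (weight_char r d u * weight_char r d w :: 'n ratfun)" for u w
    using weight_char_add[OF assms, of u w] by (simp add: plus_fun_def)
qed

lemma initial_cluster_semi_invariant:
  fixes P Q :: "nat \<Rightarrow> nat \<Rightarrow> int"
  assumes n: "n = CARD('n::finite)" and \<alpha>\<beta>: "1 \<le> \<alpha>" "\<alpha> < \<beta>" "\<beta> < n"
    and d: "d \<in> torus r" and AB: "A \<in> H_T n \<alpha> \<beta>" "B \<in> H_T n \<alpha> \<beta>"
    and P: "\<And>i. i < n \<Longrightarrow> A $$ (i, i) = (\<Prod>a<r. d a powi P (i + 1) a)"
    and Q: "\<And>i. i < n \<Longrightarrow> B $$ (i, i) = (\<Prod>a<r. d a powi Q (i + 1) a)"
    and rel: "P \<alpha> - P (\<alpha> + 1) = P \<beta> - P (\<beta> + 1)" "Q \<alpha> - Q (\<alpha> + 1) = Q \<beta> - Q (\<beta> + 1)"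
    and v: "v \<in> set (vertices n)"
  shows "translate A B (fst (initial_seed \<alpha> \<beta>) v :: 'n ratfun) =
    weight_char r d (initial_weight n \<alpha> \<beta> P Q (fst v) (snd v)) * fst (initial_seed \<alpha> \<beta>) v"
proof -
  obtain i j where v_ij: "v = (i, j)" by fastforce
  then have ij: "1 \<le> i" "i \<le> n" "1 \<le> j" "j \<le> n" using v by (auto simp: set_vertices)
  note A = H_T_properties[OF \<alpha>\<beta> AB(1)] and B = H_T_properties[OF \<alpha>\<beta> AB(2)]
  interpret character "weight_char r d :: (nat \<Rightarrow> int) \<Rightarrow> 'n ratfun"
    by (rule weight_char_character[OF d])
  interpret hom: comm_ring_hom "translate A B :: 'n ratfun \<Rightarrow> 'n ratfun"
    using A(1) B(1) unfolding n by (rule translate_comm_ring_hom)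
  let ?X = "coord_matrix :: 'n ratfun mat"
  have X: "?X \<in> carrier_mat n n" by (simp add: coord_matrix_def n)
  have entry: "map_mat (translate A B) ?X $$ (k, l) =
      weight_char r d (P (k + 1) + Q (l + 1)) * ?X $$ (k, l)" if kl: "k < n" "l < n" for k l
  proof -
    have "translate A B (?X $$ (k, l)) = const (A $$ (k, k) * B $$ (l, l)) * ?X $$ (k, l)"
      using translate_coord_matrix[where ?'n = 'n, of "\<lambda>k. A $$ (k, k)" "\<lambda>l. B $$ (l, l)" k l, folded n, folded A(2) B(2)]
        A(1) B(1) kl by simp
    also have "const (A $$ (k, k) * B $$ (l, l)) = (weight_char r d (P (k + 1) + Q (l + 1)) :: 'n ratfun)"
      unfolding \<chi>_add using kl by (simp add: P Q weight_char_def const_mult)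
    finally show ?thesis using X kl by simp
  qed
  have "translate A B (det (M_bar n \<alpha> \<beta> ?X i j)) = det (map_mat (translate A B) (M_bar n \<alpha> \<beta> ?X i j))"
    by (simp add: hom.hom_det)
  also have "\<dots> = det (M_bar n \<alpha> \<beta> (map_mat (translate A B) ?X) i j)"
    by (subst M_bar_map_mat[OF _ X \<alpha>\<beta> ij]) simp_all
  also have "\<dots> = weight_char r d (initial_weight n \<alpha> \<beta> P Q i j) * det (M_bar n \<alpha> \<beta> ?X i j)"
    by (rule det_M_bar_scaled[OF X _ entry rel \<alpha>\<beta> ij]) (use X in simp_all)
  finally show ?thesis by (simp add: initial_seed_def Let_def v_ij n)
qed


section \<open>Homogeneity of the initial exchange relations\<close>

lemma minor_weight_rec:
  assumes "i \<le> n" "j \<le> n"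
  shows "minor_weight n p q i j = p i + q j + minor_weight n p q (i + 1) (j + 1)"
proof -
  have "n + 1 - max i j = Suc (n + 1 - max (i + 1) (j + 1))" using assms by simp
  then show ?thesis unfolding minor_weight_def by (simp only: sum.lessThan_Suc_shift) simp
qed

lemma minor_weight_outside: "n < i \<or> n < j \<Longrightarrow> minor_weight n p q i j = 0"
  by (auto simp: minor_weight_def)

lemma sum_arrow:
  assumes "finite V"
  shows "(\<Sum>w\<in>V. of_bool (w = c) * f w) = (if c \<in> V then f c else (0::int))"
    and "(\<Sum>w\<in>V. of_bool (P \<and> w = c) * f w) = (if P \<and> c \<in> V then f c else (0::int))"
proof -
  show "(\<Sum>w\<in>V. of_bool (w = c) * f w) = (if c \<in> V then f c else 0)"
    using sum.delta[OF assms, of c f] by (simp add: of_bool_def if_distrib[of "\<lambda>x. x * _"] cong: if_cong)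
  then show "(\<Sum>w\<in>V. of_bool (P \<and> w = c) * f w) = (if P \<and> c \<in> V then f c else 0)"
    by (cases P) simp_all
qed

lemma of_bool_disj_disjoint:
  assumes "\<not> (A \<and> B)" "\<not> (A \<and> C)" "\<not> (A \<and> D)" "\<not> (A \<and> E)" "\<not> (B \<and> C)" "\<not> (B \<and> D)" "\<not> (B \<and> E)"
    "\<not> (C \<and> D)" "\<not> (C \<and> E)" "\<not> (D \<and> E)"
  shows "of_bool (A \<or> B \<or> C \<or> D \<or> E) = (of_bool A + of_bool B + of_bool C + of_bool D + of_bool E :: int)"
  using assms by (cases A; cases B; cases C; cases D) simp_all

text \<open>
  The weights are integers here: the exchange relations are checked for each component of the
  exponent vectors separately.
\<close>

locale initial_quiver =
  fixes n \<alpha> \<beta> :: nat and p q :: "nat \<Rightarrow> int"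
  assumes n: "3 \<le> n" and \<alpha>\<beta>: "1 \<le> \<alpha>" "\<alpha> < \<beta>" "\<beta> < n" and ne: "2 * \<alpha> \<noteq> n" "2 * \<beta> \<noteq> n"
    and p: "p \<alpha> - p (\<alpha> + 1) = p \<beta> - p (\<beta> + 1)"
    and q: "q \<alpha> - q (\<alpha> + 1) = q \<beta> - q (\<beta> + 1)"
    and total: "(\<Sum>i=1..n. p i) = 0" "(\<Sum>i=1..n. q i) = 0"
begin

abbreviation "m \<equiv> minor_weight n p q"

text \<open>
  The weight is 0 outside the quiver, so missing arrows need not be treated separately.
\<close>

definition wt :: "nat \<times> nat \<Rightarrow> int" where
  "wt v = (if v \<in> set (vertices n) then initial_weight n \<alpha> \<beta> p q (fst v) (snd v) else 0)"

lemma m11: "m 1 1 = 0"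
proof -
  have "m 1 1 = (\<Sum>t<n. p (Suc t)) + (\<Sum>t<n. q (Suc t))"
    by (simp add: minor_weight_def sum.distrib)
  also have "(\<Sum>t<n. f (Suc t)) = (\<Sum>i=1..n. f i)" for f :: "nat \<Rightarrow> int"
    by (simp add: sum.atLeast1_atMost_eq)
  ultimately show ?thesis using total by simp
qed

text \<open>
  This also holds at \<open>(1, 1)\<close>, where the weight is that of \<open>det X = 1\<close>, and on the row and the
  column beyond the last ones, where \<open>m\<close> vanishes. Only the summands of the two modified diagonals
  have to be cut off there.
\<close>

lemma wt_eq:
  assumes "1 \<le> i" "1 \<le> j" "i \<le> n + 1" "j \<le> n + 1"
  shows "wt (i, j) = m i j + (if i + \<alpha> = n + j \<and> i \<le> n then m 1 (\<beta> + 1) else 0)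
    + (if j + \<beta> = n + i \<and> j \<le> n then m (\<alpha> + 1) 1 else 0)"
proof (cases "i = 1 \<and> j = 1")
  case True
  then show ?thesis using \<alpha>\<beta> m11 by (simp add: wt_def set_vertices)
next
  case False
  consider "i \<le> n" "j \<le> n" | "n < i" "j \<le> n" | "i \<le> n" "n < j" | "n < i" "n < j" by linarith
  then show ?thesis
  proof cases
    case 1
    then show ?thesis using False assms
      by (auto simp: wt_def set_vertices initial_weight_def)
  next
    case 2
    then have "\<not> (j + \<beta> = n + i \<and> j \<le> n)" using \<alpha>\<beta> by linarith
    with 2 show ?thesis
      by (simp add: wt_def set_vertices minor_weight_outside)
  next
    case 3
    then have "\<not> (i + \<alpha> = n + j \<and> i \<le> n)" using \<alpha>\<beta> by linarith
    with 3 show ?thesis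
      by (simp add: wt_def set_vertices minor_weight_outside)
  next
    case 4
    then show ?thesis by (simp add: wt_def set_vertices minor_weight_outside)
  qed
qed

lemma sum_arrow_wt:
  "(\<Sum>w\<in>set (vertices n). of_bool (w = c) * wt w) = wt c"
  "(\<Sum>w\<in>set (vertices n). of_bool (P \<and> w = c) * wt w) = (if P then wt c else 0)"
  by (simp_all add: sum_arrow) (simp_all add: wt_def)

text \<open>
  This is where the exceptional cases \<open>2 \<alpha> = n\<close> and \<open>2 \<beta> = n\<close> matter: in them one of these
  vertices lies on a modified diagonal itself.
\<close>

lemma wt_corners:
  "wt (1, \<beta> + 1) = m 1 (\<beta> + 1)" "wt (\<alpha> + 1, 1) = m (\<alpha> + 1) 1"
  using ne \<alpha>\<beta> by (subst wt_eq; simp)+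

lemma quiver_iff:
  assumes "v \<in> set (vertices n)" "w \<in> set (vertices n)"
  shows "(v, w) \<in> quiver n \<alpha> \<beta> \<longleftrightarrow>
    \<not> (border v \<and> border w) \<and>
      (w = (fst v + 1, snd v) \<or> w = (fst v, snd v + 1) \<or> v = (fst w + 1, snd w + 1)) \<or>
    v = (\<alpha>, 1) \<and> w = (\<alpha> + 1, 1) \<or> v = (1, \<beta>) \<and> w = (1, \<beta> + 1) \<or>
    v = (n, \<alpha> + 1) \<and> w = (1, \<beta> + 1) \<or> v = (1, \<beta> + 1) \<and> w = (n, \<alpha>) \<or>
    v = (\<beta> + 1, n) \<and> w = (\<alpha> + 1, 1) \<or> v = (\<alpha> + 1, 1) \<and> w = (\<beta>, n)"
  using assms unfolding quiver_def Let_def by (simp add: disj_ac)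

text \<open>
  An arrow that points to or comes from a vertex outside the quiver does no harm on the right-hand
  side, because \<open>w\<close> is a vertex.
\<close>

lemma arrows_interior:
  assumes ij: "1 \<le> i" "i < n" "1 \<le> j" "j < n" and w: "w \<in> set (vertices n)"
  shows "of_bool (((i + 1, j + 1), w) \<in> quiver n \<alpha> \<beta>) =
     of_bool (w = (i + 2, j + 1)) + of_bool (w = (i + 1, j + 2)) + of_bool (w = (i, j))
     + of_bool ((i + 1 = n \<and> j = \<alpha>) \<and> w = (1, \<beta> + 1))
     + (of_bool ((i = \<beta> \<and> j + 1 = n) \<and> w = (\<alpha> + 1, 1)) :: int)"
    and "of_bool ((w, (i + 1, j + 1)) \<in> quiver n \<alpha> \<beta>) =
     of_bool (w = (i, j + 1)) + of_bool (w = (i + 1, j)) + of_bool (w = (i + 2, j + 2))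
     + of_bool ((i + 1 = n \<and> j + 1 = \<alpha>) \<and> w = (1, \<beta> + 1))
     + (of_bool ((i + 1 = \<beta> \<and> j + 1 = n) \<and> w = (\<alpha> + 1, 1)) :: int)"
proof -
  have v: "(i + 1, j + 1) \<in> set (vertices n)" using ij by (simp add: set_vertices)
  have nb: "\<not> border (i + 1, j + 1)" using ij by (simp add: border_def)
  obtain x y where xy: "w = (x, y)" by fastforce
  have z: "i \<noteq> 0" "j \<noteq> 0" "\<alpha> \<noteq> 0" "\<beta> \<noteq> 0" "n \<noteq> 1" "n \<noteq> 2" "n \<noteq> 0" using ij \<alpha>\<beta> n by auto
  have f: "border (i + 1, j + 1) = False" "(i + 1 = 1) = False" "(j + 1 = 1) = False"
    "i + 1 + 1 = i + 2" "j + 1 + 1 = j + 2" "(i + 1 = x + 1) = (x = i)" "(j + 1 = y + 1) = (y = j)"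
    "(i + 1 = x) = (x = i + 1)" "(j + 1 = y) = (y = j + 1)"
    "(j + 1 = \<alpha> + 1) = (j = \<alpha>)" "(i + 1 = \<beta> + 1) = (i = \<beta>)"
    using nb z by auto
  have "((i + 1, j + 1), w) \<in> quiver n \<alpha> \<beta> \<longleftrightarrow> w = (i + 2, j + 1) \<or> w = (i + 1, j + 2) \<or> w = (i, j)
        \<or> (i + 1 = n \<and> j = \<alpha>) \<and> w = (1, \<beta> + 1) \<or> (i = \<beta> \<and> j + 1 = n) \<and> w = (\<alpha> + 1, 1)"
    unfolding xy quiver_iff[OF v w[unfolded xy]] fst_conv snd_conv prod.inject f by (simp only: simp_thms) blast
  then show "of_bool (((i + 1, j + 1), w) \<in> quiver n \<alpha> \<beta>) =
     of_bool (w = (i + 2, j + 1)) + of_bool (w = (i + 1, j + 2)) + of_bool (w = (i, j))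
     + of_bool ((i + 1 = n \<and> j = \<alpha>) \<and> w = (1, \<beta> + 1))
     + (of_bool ((i = \<beta> \<and> j + 1 = n) \<and> w = (\<alpha> + 1, 1)) :: int)"
    by (simp only:, intro of_bool_disj_disjoint) (use z \<alpha>\<beta> in \<open>auto simp: xy\<close>)
  have "(w, (i + 1, j + 1)) \<in> quiver n \<alpha> \<beta> \<longleftrightarrow> w = (i, j + 1) \<or> w = (i + 1, j) \<or> w = (i + 2, j + 2)
        \<or> (i + 1 = n \<and> j + 1 = \<alpha>) \<and> w = (1, \<beta> + 1) \<or> (i + 1 = \<beta> \<and> j + 1 = n) \<and> w = (\<alpha> + 1, 1)"
    unfolding xy quiver_iff[OF w[unfolded xy] v] fst_conv snd_conv prod.inject f by (simp only: simp_thms) blast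
  then show "of_bool ((w, (i + 1, j + 1)) \<in> quiver n \<alpha> \<beta>) =
     of_bool (w = (i, j + 1)) + of_bool (w = (i + 1, j)) + of_bool (w = (i + 2, j + 2))
     + of_bool ((i + 1 = n \<and> j + 1 = \<alpha>) \<and> w = (1, \<beta> + 1))
     + (of_bool ((i + 1 = \<beta> \<and> j + 1 = n) \<and> w = (\<alpha> + 1, 1)) :: int)"
    by (simp only:, intro of_bool_disj_disjoint) (use z \<alpha>\<beta> n in \<open>auto simp: xy\<close>)
qed

text \<open>
  The six neighbours of \<open>(i + 1, j + 1)\<close> pair up along diagonals, and the recursion for \<open>m\<close>
  leaves \<open>(p\<^sub>i + q\<^sub>j) + (p\<^sub>i\<^sub>+\<^sub>1 + q\<^sub>j\<^sub>+\<^sub>1) - (p\<^sub>i + q\<^sub>j\<^sub>+\<^sub>1) - (p\<^sub>i\<^sub>+\<^sub>1 + q\<^sub>j) = 0\<close>. In the last row or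
  column some neighbours are missing, and with them the summands of the modified diagonals there.
  What remains is the weight of \<open>(1, \<beta> + 1)\<close> or \<open>(\<alpha> + 1, 1)\<close>, up to sign, exactly at the end points
  of the additional arrows.
\<close>

lemma exchange_interior:
  assumes ij: "1 \<le> i" "i < n" "1 \<le> j" "j < n"
  shows "(\<Sum>w\<in>set (vertices n). (of_bool (((i + 1, j + 1), w) \<in> quiver n \<alpha> \<beta>)
    - of_bool ((w, (i + 1, j + 1)) \<in> quiver n \<alpha> \<beta>)) * wt w) = 0"
proof -
  have "(\<Sum>w\<in>set (vertices n). (of_bool (((i + 1, j + 1), w) \<in> quiver n \<alpha> \<beta>)
      - of_bool ((w, (i + 1, j + 1)) \<in> quiver n \<alpha> \<beta>)) * wt w) =
    wt (i + 2, j + 1) + wt (i + 1, j + 2) + wt (i, j)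
      + (if i + 1 = n \<and> j = \<alpha> then wt (1, \<beta> + 1) else 0)
      + (if i = \<beta> \<and> j + 1 = n then wt (\<alpha> + 1, 1) else 0)
    - (wt (i, j + 1) + wt (i + 1, j) + wt (i + 2, j + 2)
      + (if i + 1 = n \<and> j + 1 = \<alpha> then wt (1, \<beta> + 1) else 0)
      + (if i + 1 = \<beta> \<and> j + 1 = n then wt (\<alpha> + 1, 1) else 0))"
    by (simp only: arrows_interior[OF ij] left_diff_distrib distrib_right sum_subtractf sum.distrib
        sum_arrow_wt cong: sum.cong)
  also have "\<dots> = 0"
  proof -
    have m: "m i j = p i + q j + m (i + 1) (j + 1)" "m (i + 1) j = p (i + 1) + q j + m (i + 2) (j + 1)"
      "m i (j + 1) = p i + q (j + 1) + m (i + 1) (j + 2)"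
      "m (i + 1) (j + 1) = p (i + 1) + q (j + 1) + m (i + 2) (j + 2)"
      using ij by (simp_all add: minor_weight_rec[of _ n])
    define P Q where "P = m 1 (\<beta> + 1)" and "Q = m (\<alpha> + 1) 1"
    \<comment> \<open>The first modified diagonal can meet the neighbours below or left, above or right, and on the
      diagonal of \<open>(i + 1, j + 1)\<close>; primes mark the same for
      the second one, with rows and columns exchanged.\<close>
    define X Y Z where "X \<longleftrightarrow> i + 1 + \<alpha> = n + j" and "Y \<longleftrightarrow> i + \<alpha> = n + j + 1" and "Z \<longleftrightarrow> i + \<alpha> = n + j"
    define X' Y' Z' where "X' \<longleftrightarrow> j + 1 + \<beta> = n + i" and "Y' \<longleftrightarrow> j + \<beta> = n + i + 1" and "Z' \<longleftrightarrow> j + \<beta> = n + i"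
    note defs = X_def Y_def Z_def X'_def Y'_def Z'_def
    have c: "(i + 2 + \<alpha> = n + (j + 1) \<and> i + 2 \<le> n) = (X \<and> i + 1 \<noteq> n)"
      "(j + 1 + \<beta> = n + (i + 2) \<and> j + 1 \<le> n) = Y'"
      "(i + 1 + \<alpha> = n + (j + 2) \<and> i + 1 \<le> n) = Y"
      "(j + 2 + \<beta> = n + (i + 1) \<and> j + 2 \<le> n) = (X' \<and> j + 1 \<noteq> n)"
      "(i + \<alpha> = n + j \<and> i \<le> n) = Z" "(j + \<beta> = n + i \<and> j \<le> n) = Z'"
      "(i + \<alpha> = n + (j + 1) \<and> i \<le> n) = Y" "(j + 1 + \<beta> = n + i \<and> j + 1 \<le> n) = X'"
      "(i + 1 + \<alpha> = n + j \<and> i + 1 \<le> n) = X" "(j + \<beta> = n + (i + 1) \<and> j \<le> n) = Y'"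
      "(i + 2 + \<alpha> = n + (j + 2) \<and> i + 2 \<le> n) = (Z \<and> i + 1 \<noteq> n)"
      "(j + 2 + \<beta> = n + (i + 2) \<and> j + 2 \<le> n) = (Z' \<and> j + 1 \<noteq> n)"
      unfolding defs using ij by presburger+
    have e: "(i + 1 = n \<and> j = \<alpha>) = (i + 1 = n \<and> X)" "(i + 1 = n \<and> j + 1 = \<alpha>) = (i + 1 = n \<and> Z)"
      "(i = \<beta> \<and> j + 1 = n) = (X' \<and> j + 1 = n)" "(i + 1 = \<beta> \<and> j + 1 = n) = (Z' \<and> j + 1 = n)"
      unfolding defs by presburger+
    have w: "wt (i + 2, j + 1) = m (i + 2) (j + 1) + (if X \<and> i + 1 \<noteq> n then P else 0) + (if Y' then Q else 0)"
      "wt (i + 1, j + 2) = m (i + 1) (j + 2) + (if Y then P else 0) + (if X' \<and> j + 1 \<noteq> n then Q else 0)"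
      "wt (i, j) = m i j + (if Z then P else 0) + (if Z' then Q else 0)"
      "wt (i, j + 1) = m i (j + 1) + (if Y then P else 0) + (if X' then Q else 0)"
      "wt (i + 1, j) = m (i + 1) j + (if X then P else 0) + (if Y' then Q else 0)"
      "wt (i + 2, j + 2) = m (i + 2) (j + 2) + (if Z \<and> i + 1 \<noteq> n then P else 0)
        + (if Z' \<and> j + 1 \<noteq> n then Q else 0)"
      using ij
        wt_eq[of "i + 2" "j + 1", unfolded c, folded P_def Q_def]
        wt_eq[of "i + 1" "j + 2", unfolded c, folded P_def Q_def]
        wt_eq[of i j, unfolded c, folded P_def Q_def]
        wt_eq[of i "j + 1", unfolded c, folded P_def Q_def]
        wt_eq[of "i + 1" j, unfolded c, folded P_def Q_def]
        wt_eq[of "i + 2" "j + 2", unfolded c, folded P_def Q_def]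
      by simp_all
    show ?thesis
      unfolding wt_corners P_def[symmetric] Q_def[symmetric] w e m by simp
  qed
  finally show ?thesis .
qed

text \<open>
  The recursion for \<open>m\<close> reduces the sum to
  \<open>(p\<^sub>\<beta> - p\<^sub>\<beta>\<^sub>+\<^sub>1) - (p\<^sub>\<alpha> - p\<^sub>\<alpha>\<^sub>+\<^sub>1)\<close>; the additional summand at \<open>(\<beta>, n)\<close> supplies the weight of
  \<open>(\<alpha> + 1, 1)\<close> that is needed for this.
\<close>

lemma exchange_first_column:
  "(\<Sum>w\<in>set (vertices n). (of_bool (((\<alpha> + 1, 1), w) \<in> quiver n \<alpha> \<beta>)
    - of_bool ((w, (\<alpha> + 1, 1)) \<in> quiver n \<alpha> \<beta>)) * wt w) = 0"
proof -
  have v: "(\<alpha> + 1, 1) \<in> set (vertices n)" using \<alpha>\<beta> by (simp add: set_vertices)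
  have "of_bool (((\<alpha> + 1, 1), w) \<in> quiver n \<alpha> \<beta>) - of_bool ((w, (\<alpha> + 1, 1)) \<in> quiver n \<alpha> \<beta>) =
    of_bool (w = (\<alpha> + 1, 2)) + of_bool (w = (\<beta>, n))
    - (of_bool (w = (\<alpha>, 1)) + of_bool (w = (\<alpha> + 2, 2)) + (of_bool (w = (\<beta> + 1, n)) :: int))"
    if w: "w \<in> set (vertices n)" for w
  proof -
    obtain x y where xy: "w = (x, y)" by fastforce
    have z: "x \<noteq> 0" "y \<noteq> 0" "\<alpha> \<noteq> 0" "\<alpha> \<noteq> \<beta>" "\<beta> \<noteq> 0" "n \<noteq> 1" "n \<noteq> 2" using w \<alpha>\<beta> n by (auto simp: set_vertices xy)
    have "((\<alpha> + 1, 1), w) \<in> quiver n \<alpha> \<beta> \<longleftrightarrow> w = (\<alpha> + 1, 2) \<or> w = (\<beta>, n)"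
      using z unfolding xy quiver_iff[OF v w[unfolded xy]] border_def by auto
    moreover have "(w, (\<alpha> + 1, 1)) \<in> quiver n \<alpha> \<beta> \<longleftrightarrow> w = (\<alpha>, 1) \<or> w = (\<alpha> + 2, 2) \<or> w = (\<beta> + 1, n)"
      using z unfolding xy quiver_iff[OF w[unfolded xy] v] border_def by auto
    ultimately show ?thesis using z n by (auto simp: xy)
  qed
  then have "(\<Sum>w\<in>set (vertices n). (of_bool (((\<alpha> + 1, 1), w) \<in> quiver n \<alpha> \<beta>)
      - of_bool ((w, (\<alpha> + 1, 1)) \<in> quiver n \<alpha> \<beta>)) * wt w) =
    wt (\<alpha> + 1, 2) + wt (\<beta>, n) - (wt (\<alpha>, 1) + wt (\<alpha> + 2, 2) + wt (\<beta> + 1, n))"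
    by (simp only: left_diff_distrib distrib_right sum_subtractf sum.distrib sum_arrow_wt cong: sum.cong)
  also have "\<dots> = 0"
  proof -
    have m: "m \<alpha> 1 = p \<alpha> + q 1 + m (\<alpha> + 1) 2" "m (\<alpha> + 1) 1 = p (\<alpha> + 1) + q 1 + m (\<alpha> + 2) 2"
      "m \<beta> n = p \<beta> + q n" "m (\<beta> + 1) n = p (\<beta> + 1) + q n"
      using \<alpha>\<beta> minor_weight_rec[of \<alpha> n 1 p q] minor_weight_rec[of "\<alpha> + 1" n 1 p q]
        minor_weight_rec[of \<beta> n n p q] minor_weight_rec[of "\<beta> + 1" n n p q]
      by (simp_all add: minor_weight_outside numeral_2_eq_2)
    define P where "P = m 1 (\<beta> + 1)"
    have c: "(\<alpha> + 1 + \<alpha> = n + 2 \<and> \<alpha> + 1 \<le> n) = (2 * \<alpha> = n + 1)" "(2 + \<beta> = n + (\<alpha> + 1) \<and> 2 \<le> n) = False"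
      "(\<beta> + \<alpha> = n + n \<and> \<beta> \<le> n) = False" "(n + \<beta> = n + \<beta> \<and> n \<le> n) = True"
      "(\<alpha> + \<alpha> = n + 1 \<and> \<alpha> \<le> n) = (2 * \<alpha> = n + 1)" "(1 + \<beta> = n + \<alpha> \<and> 1 \<le> n) = False"
      "(\<alpha> + 2 + \<alpha> = n + 2 \<and> \<alpha> + 2 \<le> n) = False" "(2 + \<beta> = n + (\<alpha> + 2) \<and> 2 \<le> n) = False"
      "(\<beta> + 1 + \<alpha> = n + n \<and> \<beta> + 1 \<le> n) = False" "(n + \<beta> = n + (\<beta> + 1) \<and> n \<le> n) = False"
      using n \<alpha>\<beta> ne
      by - (rule iffI; (elim conjE FalseE)?; (intro conjI TrueI)?; linarith?)+
    have w1: "wt (\<alpha> + 1, 2) = m (\<alpha> + 1) 2 + (if 2 * \<alpha> = n + 1 then P else 0)"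
      by (rule wt_eq[of "\<alpha> + 1" 2, unfolded c if_False if_True add_0_right, folded P_def]) (use n \<alpha>\<beta> in linarith)+
    have w2: "wt (\<beta>, n) = m \<beta> n + m (\<alpha> + 1) 1"
      by (rule wt_eq[of \<beta> n, unfolded c if_False if_True add_0_right]) (use n \<alpha>\<beta> in linarith)+
    have w3: "wt (\<alpha>, 1) = m \<alpha> 1 + (if 2 * \<alpha> = n + 1 then P else 0)"
      by (rule wt_eq[of \<alpha> 1, unfolded c if_False if_True add_0_right, folded P_def]) (use n \<alpha>\<beta> in linarith)+
    have w4: "wt (\<alpha> + 2, 2) = m (\<alpha> + 2) 2"
      by (rule wt_eq[of "\<alpha> + 2" 2, unfolded c if_False if_True add_0_right]) (use n \<alpha>\<beta> in linarith)+
    have w5: "wt (\<beta> + 1, n) = m (\<beta> + 1) n"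
      by (rule wt_eq[of "\<beta> + 1" n, unfolded c if_False if_True add_0_right]) (use n \<alpha>\<beta> in linarith)+
    note w = w1 w2 w3 w4 w5
    show ?thesis unfolding w m using p by simp
  qed
  finally show ?thesis .
qed

text \<open>
  Symmetric to the preceding relation, with columns instead of rows.
\<close>

lemma exchange_first_row:
  "(\<Sum>w\<in>set (vertices n). (of_bool (((1, \<beta> + 1), w) \<in> quiver n \<alpha> \<beta>)
    - of_bool ((w, (1, \<beta> + 1)) \<in> quiver n \<alpha> \<beta>)) * wt w) = 0"
proof -
  have v: "(1, \<beta> + 1) \<in> set (vertices n)" using \<alpha>\<beta> by (simp add: set_vertices)
  have "of_bool (((1, \<beta> + 1), w) \<in> quiver n \<alpha> \<beta>) - of_bool ((w, (1, \<beta> + 1)) \<in> quiver n \<alpha> \<beta>) =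
    of_bool (w = (2, \<beta> + 1)) + of_bool (w = (n, \<alpha>))
    - (of_bool (w = (1, \<beta>)) + of_bool (w = (2, \<beta> + 2)) + (of_bool (w = (n, \<alpha> + 1)) :: int))"
    if w: "w \<in> set (vertices n)" for w
  proof -
    obtain x y where xy: "w = (x, y)" by fastforce
    have z: "x \<noteq> 0" "y \<noteq> 0" "\<alpha> \<noteq> 0" "\<alpha> \<noteq> \<beta>" "\<beta> \<noteq> 0" "\<beta> \<noteq> 1" "n \<noteq> 1" "n \<noteq> 2"
      using w \<alpha>\<beta> n by (auto simp: set_vertices xy)
    have "((1, \<beta> + 1), w) \<in> quiver n \<alpha> \<beta> \<longleftrightarrow> w = (2, \<beta> + 1) \<or> w = (n, \<alpha>)"
      using z unfolding xy quiver_iff[OF v w[unfolded xy]] border_def by auto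
    moreover have "(w, (1, \<beta> + 1)) \<in> quiver n \<alpha> \<beta> \<longleftrightarrow> w = (1, \<beta>) \<or> w = (2, \<beta> + 2) \<or> w = (n, \<alpha> + 1)"
      using z unfolding xy quiver_iff[OF w[unfolded xy] v] border_def by auto
    ultimately show ?thesis using z n by (auto simp: xy)
  qed
  then have "(\<Sum>w\<in>set (vertices n). (of_bool (((1, \<beta> + 1), w) \<in> quiver n \<alpha> \<beta>)
      - of_bool ((w, (1, \<beta> + 1)) \<in> quiver n \<alpha> \<beta>)) * wt w) =
    wt (2, \<beta> + 1) + wt (n, \<alpha>) - (wt (1, \<beta>) + wt (2, \<beta> + 2) + wt (n, \<alpha> + 1))"
    by (simp only: left_diff_distrib distrib_right sum_subtractf sum.distrib sum_arrow_wt cong: sum.cong)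
  also have "\<dots> = 0"
  proof -
    have m: "m 1 \<beta> = p 1 + q \<beta> + m 2 (\<beta> + 1)" "m 1 (\<beta> + 1) = p 1 + q (\<beta> + 1) + m 2 (\<beta> + 2)"
      "m n \<alpha> = p n + q \<alpha>" "m n (\<alpha> + 1) = p n + q (\<alpha> + 1)"
      using \<alpha>\<beta> minor_weight_rec[of 1 n \<beta> p q] minor_weight_rec[of 1 n "\<beta> + 1" p q]
        minor_weight_rec[of n n \<alpha> p q] minor_weight_rec[of n n "\<alpha> + 1" p q]
      by (simp_all add: minor_weight_outside numeral_2_eq_2)
    define Q where "Q = m (\<alpha> + 1) 1"
    have c: "(2 + \<alpha> = n + (\<beta> + 1) \<and> 2 \<le> n) = False" "(\<beta> + 1 + \<beta> = n + 2 \<and> \<beta> + 1 \<le> n) = (2 * \<beta> = n + 1)"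
      "(n + \<alpha> = n + \<alpha> \<and> n \<le> n) = True" "(\<alpha> + \<beta> = n + n \<and> \<alpha> \<le> n) = False"
      "(1 + \<alpha> = n + \<beta> \<and> 1 \<le> n) = False" "(\<beta> + \<beta> = n + 1 \<and> \<beta> \<le> n) = (2 * \<beta> = n + 1)"
      "(2 + \<alpha> = n + (\<beta> + 2) \<and> 2 \<le> n) = False" "(\<beta> + 2 + \<beta> = n + 2 \<and> \<beta> + 2 \<le> n) = False"
      "(n + \<alpha> = n + (\<alpha> + 1) \<and> n \<le> n) = False" "(\<alpha> + 1 + \<beta> = n + n \<and> \<alpha> + 1 \<le> n) = False"
      using n \<alpha>\<beta> ne
      by - (rule iffI; (elim conjE FalseE)?; (intro conjI TrueI)?; linarith?)+
    have w1: "wt (2, \<beta> + 1) = m 2 (\<beta> + 1) + (if 2 * \<beta> = n + 1 then Q else 0)"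
      by (rule wt_eq[of 2 "\<beta> + 1", unfolded c if_False if_True add_0_right, folded Q_def]) (use n \<alpha>\<beta> in linarith)+
    have w2: "wt (n, \<alpha>) = m n \<alpha> + m 1 (\<beta> + 1)"
      by (rule wt_eq[of n \<alpha>, unfolded c if_False if_True add_0_right]) (use n \<alpha>\<beta> in linarith)+
    have w3: "wt (1, \<beta>) = m 1 \<beta> + (if 2 * \<beta> = n + 1 then Q else 0)"
      by (rule wt_eq[of 1 \<beta>, unfolded c if_False if_True add_0_right, folded Q_def]) (use n \<alpha>\<beta> in linarith)+
    have w4: "wt (2, \<beta> + 2) = m 2 (\<beta> + 2)"
      by (rule wt_eq[of 2 "\<beta> + 2", unfolded c if_False if_True add_0_right]) (use n \<alpha>\<beta> in linarith)+
    have w5: "wt (n, \<alpha> + 1) = m n (\<alpha> + 1)"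
      by (rule wt_eq[of n "\<alpha> + 1", unfolded c if_False if_True add_0_right]) (use n \<alpha>\<beta> in linarith)+
    note w = w1 w2 w3 w4 w5
    show ?thesis unfolding w m using q by simp
  qed
  finally show ?thesis .
qed

lemma exchange_homogeneous:
  assumes "v \<in> mutable_vertices n \<alpha> \<beta>"
  shows "(\<Sum>w\<in>set (vertices n). (of_bool ((v, w) \<in> quiver n \<alpha> \<beta>) - of_bool ((w, v) \<in> quiver n \<alpha> \<beta>))
    * initial_weight n \<alpha> \<beta> p q (fst w) (snd w)) = 0"
proof -
  consider "v = (\<alpha> + 1, 1)" | "v = (1, \<beta> + 1)" | "v \<in> set (vertices n)" "\<not> border v"
    using assms by (auto simp: mutable_vertices_def)
  then have "(\<Sum>w\<in>set (vertices n). (of_bool ((v, w) \<in> quiver n \<alpha> \<beta>)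
    - of_bool ((w, v) \<in> quiver n \<alpha> \<beta>)) * wt w) = 0"
  proof cases
    case 3
    define i j where "i = fst v - 1" and "j = snd v - 1"
    obtain x y where xy: "v = (x, y)" by fastforce
    have "1 \<le> x" "1 \<le> y" "x \<le> n" "y \<le> n" "x \<noteq> 1" "y \<noteq> 1"
      using 3 by (auto simp: xy set_vertices border_def)
    then have "v = (i + 1, j + 1)" and ij: "1 \<le> i" "i < n" "1 \<le> j" "j < n"
      by (auto simp: xy i_def j_def)
    then show ?thesis using exchange_interior[OF ij] by (simp only:)
  qed (simp_all only: exchange_first_column exchange_first_row)
  then show ?thesis by (simp add: wt_def cong: sum.cong)
qed

end


section \<open>Faithfulness of the initial weights\<close>

text \<open>
  Differences along the main diagonal give \<open>p\<^sub>i + q\<^sub>i = 0\<close>, differences along the diagonal below it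
  give \<open>p\<^sub>i\<^sub>+\<^sub>1 + q\<^sub>i = 0\<close>. So all \<open>p\<^sub>i\<close> agree, and they sum to 0. Neither diagonal is modified,
  since \<open>\<alpha> \<le> n - 2\<close>.
\<close>

lemma initial_weights_trivial_kernel:
  fixes p q :: "nat \<Rightarrow> rat"
  assumes n: "3 \<le> n" and \<alpha>\<beta>: "1 \<le> \<alpha>" "\<alpha> < \<beta>" "\<beta> < n"
    and total: "(\<Sum>i=1..n. p i) = 0" "(\<Sum>i=1..n. q i) = 0"
    and zero: "\<And>i j. (i, j) \<in> set (vertices n) \<Longrightarrow> initial_weight n \<alpha> \<beta> p q i j = 0"
    and i: "1 \<le> i" "i \<le> n"
  shows "p i = 0" "q i = 0"
proof -
  have diag: "minor_weight n p q i i = 0" if i1: "1 \<le> i" for i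
  proof -
    consider "i = 1" | "1 < i" "i \<le> n" | "n < i" using i1 by linarith
    then show ?thesis
    proof cases
      case 1
      have "minor_weight n p q 1 1 = (\<Sum>t<n. p (Suc t)) + (\<Sum>t<n. q (Suc t))"
        by (simp add: minor_weight_def sum.distrib)
      then show ?thesis using total 1 by (simp add: sum.atLeast1_atMost_eq)
    next
      case 2
      then have "initial_weight n \<alpha> \<beta> p q i i = 0" by (intro zero) (simp add: set_vertices)
      then show ?thesis using \<alpha>\<beta> by (simp add: initial_weight_def)
    qed (simp add: minor_weight_outside)
  qed
  have sub: "minor_weight n p q (i + 1) i = 0" if "1 \<le> i" "i \<le> n" for i
  proof (cases "i = n")
    case False
    then have "initial_weight n \<alpha> \<beta> p q (i + 1) i = 0" using that by (intro zero) (simp add: set_vertices)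
    moreover have "i + 1 + \<alpha> \<noteq> n + i" "i + \<beta> \<noteq> n + (i + 1)" using \<alpha>\<beta> by linarith+
    ultimately show ?thesis by (simp add: initial_weight_def)
  qed (simp add: minor_weight_outside)
  have pq: "p i + q i = 0" if "1 \<le> i" "i \<le> n" for i
    using minor_weight_rec[of i n i p q] diag[of i] diag[of "i + 1"] that by simp
  have "p (i + 1) + q i = 0" if "1 \<le> i" "i < n" for i
    using minor_weight_rec[of "i + 1" n i p q] sub[of i] sub[of "i + 1"] that by simp
  then have step: "p (i + 1) = p i" if "1 \<le> i" "i < n" for i
    using pq[of i] that by (simp add: add_eq_0_iff2)
  have const: "p i = p 1" if "1 \<le> i" "i \<le> n" for i
    using that
  proof (induction i rule: dec_induct)
    case (step i)
    then show ?case using \<open>\<And>i. 1 \<le> i \<Longrightarrow> i < n \<Longrightarrow> p (i + 1) = p i\<close>[of i] by simp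
  qed simp
  have "(\<Sum>i=1..n. p i) = (\<Sum>i=1..n. p 1)" by (rule sum.cong[OF refl], rule const) simp_all
  then have "p 1 = 0" using total(1) n by simp
  then show "p i = 0" "q i = 0" using const[OF i] pq[OF i] by simp_all
qed

text \<open>
  Pairing with \<open>x\<close> turns vanishing weights into row and column weights that vanish on all vertices,
  so every row \<open>P i\<close> and \<open>Q i\<close> pairs to 0 with \<open>x\<close>, and then with an integral multiple of it.
\<close>

lemma initial_weights_separating:
  fixes P Q :: "nat \<Rightarrow> nat \<Rightarrow> int"
  assumes n: "3 \<le> n" and \<alpha>\<beta>: "1 \<le> \<alpha>" "\<alpha> < \<beta>" "\<beta> < n"
    and total: "(\<Sum>i=1..n. P i) = 0" "(\<Sum>i=1..n. Q i) = 0"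
    and faithful: "\<And>y :: nat \<Rightarrow> int. (\<And>i. 1 \<le> i \<Longrightarrow> i \<le> n \<Longrightarrow> (\<Sum>a<r. P i a * y a) = 0) \<Longrightarrow>
      (\<And>i. 1 \<le> i \<Longrightarrow> i \<le> n \<Longrightarrow> (\<Sum>a<r. Q i a * y a) = 0) \<Longrightarrow> \<forall>a<r. y a = 0"
  shows "separating_weights (set (vertices n)) r (\<lambda>v. initial_weight n \<alpha> \<beta> P Q (fst v) (snd v))"
  unfolding separating_weights_def
proof (intro allI impI)
  fix x :: "nat \<Rightarrow> rat" and a
  assume x: "\<forall>v\<in>set (vertices n). (\<Sum>a<r. of_int (initial_weight n \<alpha> \<beta> P Q (fst v) (snd v) a) * x a) = 0"
    and a: "a < r"
  define ev where "ev u = (\<Sum>a<r. of_int (u a) * x a)" for u :: "nat \<Rightarrow> int"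
  have ev_0: "ev 0 = 0" and ev_add: "ev (u + w) = ev u + ev w" for u w
    by (simp_all add: ev_def distrib_right sum.distrib)
  have ev_sum: "ev (\<Sum>i\<in>S. u i) = (\<Sum>i\<in>S. ev (u i))" for S :: "nat set" and u
    by (induction S rule: infinite_finite_induct) (simp_all add: ev_0[unfolded zero_fun_def] ev_add[unfolded plus_fun_def] ev_0 ev_add)
  have ker: "ev (P i) = 0" "ev (Q i) = 0" if "1 \<le> i" "i \<le> n" for i
  proof -
    have z: "(\<Sum>i=1..n. ev (P i)) = 0" "(\<Sum>i=1..n. ev (Q i)) = 0"
      using total by (simp_all add: ev_sum[symmetric] ev_0)
    have "initial_weight n \<alpha> \<beta> (\<lambda>i. ev (P i)) (\<lambda>i. ev (Q i)) i j = 0"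
      if "(i, j) \<in> set (vertices n)" for i j
      using bspec[OF x that] by (simp add: initial_weight_additive[of ev] ev_0 ev_add) (simp add: ev_def)
    from initial_weights_trivial_kernel[OF n \<alpha>\<beta> z this that]
    show "ev (P i) = 0" "ev (Q i) = 0" by auto
  qed
  obtain D y where D: "D > 0" and y: "\<And>a. a < r \<Longrightarrow> x a * of_nat D = of_int (y a)"
    using common_denominator[of r x] by blast
  have int: "(\<Sum>a<r. u a * y a) = 0" if "ev u = 0" for u :: "nat \<Rightarrow> int"
  proof -
    have "(of_int (\<Sum>a<r. u a * y a) :: rat) = (\<Sum>a<r. of_int (u a) * (x a * of_nat D))"
      by (simp add: y)
    also have "\<dots> = ev u * of_nat D" by (simp add: ev_def sum_distrib_right mult.assoc)
    finally have "(of_int (\<Sum>a<r. u a * y a) :: rat) = 0" by (simp only: that mult_zero_left)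
    then show ?thesis by (simp only: of_int_eq_0_iff)
  qed
  have "\<forall>a<r. y a = 0" using faithful[of y] int ker by blast
  then show "x a = 0" using y[OF a] D a by simp
qed


section \<open>The global toric action\<close>

theorem theorem3p2:
  fixes n k_T \<alpha> \<beta> :: nat
  assumes "n = CARD('n::finite)" and "3 \<le> n"
    and "1 \<le> \<alpha>" and "\<alpha> < \<beta>" and "\<beta> \<le> n - 1"
    and "2 * \<alpha> \<noteq> n" and "2 * \<beta> \<noteq> n"
    and "k_T = n - 2"
  shows "(\<exists>\<iota>. torus_identification n (2 * k_T) (H_T n \<alpha> \<beta> \<times> H_T n \<alpha> \<beta>) \<iota>) \<and>
    (\<forall>\<iota>. torus_identification n (2 * k_T) (H_T n \<alpha> \<beta> \<times> H_T n \<alpha> \<beta>) \<iota> \<longrightarrow>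
      global_toric_action (vertices n) (C_T \<alpha> \<beta>) (2 * k_T)
        (\<lambda>d. translate (fst (\<iota> d)) (snd (\<iota> d)) :: 'n ratfun \<Rightarrow> 'n ratfun))"
proof (intro conjI allI impI)
  have \<alpha>\<beta>: "1 \<le> \<alpha>" "\<alpha> < \<beta>" "\<beta> < n" using assms(2-5) by auto
  show "\<exists>\<iota>. torus_identification n (2 * k_T) (H_T n \<alpha> \<beta> \<times> H_T n \<alpha> \<beta>) \<iota>"
    unfolding assms(8) by (rule torus_identification_exists[OF assms(2) \<alpha>\<beta>])
  fix \<iota>
  define r where "r = 2 * k_T"
  assume "torus_identification n (2 * k_T) (H_T n \<alpha> \<beta> \<times> H_T n \<alpha> \<beta>) \<iota>"
  then have bij: "bij_betw \<iota> (torus r) (H_T n \<alpha> \<beta> \<times> H_T n \<alpha> \<beta>)"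
    and mult: "\<And>d e. d \<in> torus r \<Longrightarrow> e \<in> torus r \<Longrightarrow>
      \<iota> (torus_mult r d e) = (fst (\<iota> d) * fst (\<iota> e), snd (\<iota> d) * snd (\<iota> e))"
    and laurent: "\<And>i j. i < n \<Longrightarrow> j < n \<Longrightarrow>
      (\<exists>f\<in>laurent_polynomials r. \<forall>d\<in>torus r. fst (\<iota> d) $$ (i, j) = f d) \<and>
      (\<exists>f\<in>laurent_polynomials r. \<forall>d\<in>torus r. snd (\<iota> d) $$ (i, j) = f d)"
    unfolding torus_identification_def r_def by blast+
  have mem: "fst (\<iota> d) \<in> H_T n \<alpha> \<beta>" "snd (\<iota> d) \<in> H_T n \<alpha> \<beta>" if "d \<in> torus r" for d
    using bij_betwE[OF bij] that by (auto simp: mem_Times_iff)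
  have SL: "fst (\<iota> d) \<in> SL CARD('n)" "snd (\<iota> d) \<in> SL CARD('n)" if "d \<in> torus r" for d
    using H_T_properties(1)[OF \<alpha>\<beta>] mem[OF that] by (simp_all add: assms(1))
  obtain P where P: "\<And>d i. d \<in> torus r \<Longrightarrow> i < n \<Longrightarrow> fst (\<iota> d) $$ (i, i) = (\<Prod>a<r. d a powi P (i + 1) a)"
    "(\<Sum>i=1..n. P i) = 0" "P \<alpha> - P (\<alpha> + 1) = P \<beta> - P (\<beta> + 1)"
    by (rule H_T_exponents[OF \<alpha>\<beta>, of r "\<lambda>d. fst (\<iota> d)"]) (use mem mult laurent in simp_all)
  obtain Q where Q: "\<And>d i. d \<in> torus r \<Longrightarrow> i < n \<Longrightarrow> snd (\<iota> d) $$ (i, i) = (\<Prod>a<r. d a powi Q (i + 1) a)"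
    "(\<Sum>i=1..n. Q i) = 0" "Q \<alpha> - Q (\<alpha> + 1) = Q \<beta> - Q (\<beta> + 1)"
    by (rule H_T_exponents[OF \<alpha>\<beta>, of r "\<lambda>d. snd (\<iota> d)"]) (use mem mult laurent in simp_all)
  have \<iota>_eq: "\<iota> d = (mat_diag n (\<lambda>i. \<Prod>a<r. d a powi P (i + 1) a), mat_diag n (\<lambda>i. \<Prod>a<r. d a powi Q (i + 1) a))"
    if d: "d \<in> torus r" for d
  proof -
    have "fst (\<iota> d) = mat_diag n (\<lambda>i. fst (\<iota> d) $$ (i, i))" "snd (\<iota> d) = mat_diag n (\<lambda>i. snd (\<iota> d) $$ (i, i))"
      using H_T_properties(2)[OF \<alpha>\<beta>] mem[OF d] by blast+
    moreover have "mat_diag n f = mat_diag n g" if "\<And>i. i < n \<Longrightarrow> f i = g i" for f g :: "nat \<Rightarrow> complex"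
      using that by (auto simp: mat_diag_def)
    ultimately show ?thesis using P(1)[OF d] Q(1)[OF d] by (metis (no_types, lifting) prod.collapse)
  qed
  have \<iota>_one: "\<iota> (torus_one r) = (1\<^sub>m n, 1\<^sub>m n)"
    by (simp add: \<iota>_eq torus_one_torus)
  let ?\<rho> = "\<lambda>d. translate (fst (\<iota> d)) (snd (\<iota> d)) :: 'n ratfun \<Rightarrow> 'n ratfun"
  let ?w = "\<lambda>v. initial_weight n \<alpha> \<beta> P Q (fst v) (snd v)"
  have aut: "field_automorphism (?\<rho> d)" if "d \<in> torus r" for d
    by (intro field_automorphism_translate SL[OF that])
  have "separating_weights (set (vertices n)) r ?w"
  proof (rule initial_weights_separating[OF assms(2) \<alpha>\<beta> P(2) Q(2)])
    fix y :: "nat \<Rightarrow> int"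
    assume y: "\<And>i. 1 \<le> i \<Longrightarrow> i \<le> n \<Longrightarrow> (\<Sum>a<r. P i a * y a) = 0"
      "\<And>i. 1 \<le> i \<Longrightarrow> i \<le> n \<Longrightarrow> (\<Sum>a<r. Q i a * y a) = 0"
    \<comment> \<open>The one-parameter subgroup with exponents \<open>y\<close>, evaluated at 2.\<close>
    define l :: "nat \<Rightarrow> complex" where "l = (\<lambda>a\<in>{..<r}. 2 powi y a)"
    have l: "l \<in> torus r" by (simp add: l_def torus_def)
    have "(\<Prod>a<r. l a powi u a) = 2 powi (\<Sum>a<r. u a * y a)" for u
      by (simp add: l_def power_int_sum power_int_mult[symmetric] mult.commute)
    then have "\<iota> l = \<iota> (torus_one r)"
      unfolding \<iota>_eq[OF l] \<iota>_one using y by (auto simp: mat_diag_def)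
    then have "l = torus_one r"
      using bij l torus_one_torus by (auto simp: bij_betw_def inj_on_def)
    then have "(2::complex) powi y a = 1" if "a < r" for a
      using that by (metis (no_types, lifting) l_def lessThan_iff restrict_apply' torus_apply(2))
    then show "\<forall>a<r. y a = 0" using two_power_int_eq_1 by blast
  qed
  moreover have "?\<rho> d (fst (initial_seed \<alpha> \<beta>) v) = weight_char r d (?w v) * fst (initial_seed \<alpha> \<beta>) v"
    if "v \<in> set (vertices n)" "d \<in> torus r" for v d
    by (rule initial_cluster_semi_invariant[OF assms(1) \<alpha>\<beta> that(2) mem[OF that(2)] P(1)[OF that(2)]
          Q(1)[OF that(2)] P(3) Q(3) that(1)])
  moreover have "(\<Sum>j\<in>set (vertices n). snd (initial_seed \<alpha> \<beta> :: (_, 'n ratfun) seed) k j * ?w j a) = 0"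
    if k: "k \<in> mutable_vertices n \<alpha> \<beta>" for k a
  proof -
    have at: "(\<Sum>i\<in>S. f i) a = (\<Sum>i\<in>S. f i a)" for S :: "nat set" and f :: "nat \<Rightarrow> nat \<Rightarrow> int"
      by (induction S rule: infinite_finite_induct) simp_all
    have rel: "P \<alpha> a - P (\<alpha> + 1) a = P \<beta> a - P (\<beta> + 1) a" "Q \<alpha> a - Q (\<alpha> + 1) a = Q \<beta> a - Q (\<beta> + 1) a"
      using fun_cong[OF P(3), of a] fun_cong[OF Q(3), of a] by simp_all
    have total: "(\<Sum>i=1..n. P i a) = 0" "(\<Sum>i=1..n. Q i a) = 0"
      using fun_cong[OF P(2), of a] fun_cong[OF Q(2), of a] by (simp_all add: at)
    interpret initial_quiver n \<alpha> \<beta> "\<lambda>i. P i a" "\<lambda>i. Q i a"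
      by unfold_locales (fact assms \<alpha>\<beta> rel total)+
    have "?w v a = initial_weight n \<alpha> \<beta> (\<lambda>i. P i a) (\<lambda>i. Q i a) (fst v) (snd v)" for v
      using initial_weight_additive[of "\<lambda>u. u a" n \<alpha> \<beta> P Q] by simp
    then show ?thesis using exchange_homogeneous[OF k] k by (simp add: initial_seed_def assms(1)[symmetric])
  qed
  moreover have "snd (initial_seed \<alpha> \<beta> :: (_, 'n ratfun) seed) i j = - snd (initial_seed \<alpha> \<beta> :: (_, 'n ratfun) seed) j i"
    if "i \<in> mutable_vertices n \<alpha> \<beta>" "j \<in> mutable_vertices n \<alpha> \<beta>" for i j
    using that by (simp add: initial_seed_def assms(1)[symmetric])
  ultimately have initial: "compatible_weights (set (vertices n)) (mutable_vertices n \<alpha> \<beta>) r ?\<rho>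
      (initial_seed \<alpha> \<beta>) ?w"
    unfolding compatible_weights_def by blast
  have sub: "mutable_vertices n \<alpha> \<beta> \<subseteq> set (vertices n)"
    using \<alpha>\<beta> by (auto simp: mutable_vertices_def set_vertices)
  have seeds: "\<exists>w :: nat \<times> nat \<Rightarrow> nat \<Rightarrow> int. vec_space.rank (length (vertices n))
      (mat_of_rows r (map (\<lambda>v. vec r (\<lambda>a. of_int (w v a))) (vertices n)) :: rat mat) = r \<and>
      (\<forall>v\<in>set (vertices n). \<forall>d\<in>torus r. ?\<rho> d (y v) = const (\<Prod>a<r. d a powi w v a) * y v)"
    if yb: "(y, b) \<in> C_T \<alpha> \<beta>" for y :: "nat \<times> nat \<Rightarrow> 'n ratfun" and b
  proof -
    obtain w where w: "compatible_weights (set (vertices n)) (mutable_vertices n \<alpha> \<beta>) r ?\<rho> (y, b) w"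
      using compatible_weights_cluster_structure[where \<rho> = ?\<rho>, OF finite_set sub aut initial]
        yb[unfolded C_T_def, folded assms(1)] by blast
    then have "vec_space.rank (length (vertices n))
        (mat_of_rows r (map (\<lambda>v. vec r (\<lambda>a. of_int (w v a))) (vertices n)) :: rat mat) = r"
      by (intro rank_eq_of_trivial_kernel) (auto simp: compatible_weights_def separating_weights_def)
    then show ?thesis using w by (auto simp: compatible_weights_def weight_char_def)
  qed
  have "?\<rho> (torus_mult r d e) = ?\<rho> d \<circ> ?\<rho> e" if de: "d \<in> torus r" "e \<in> torus r" for d e
  proof -
    have "fst (\<iota> e) * fst (\<iota> d) = fst (\<iota> d) * fst (\<iota> e)"
      by (simp add: \<iota>_eq de mult.commute)
    then show ?thesis using SL[OF de(1)] SL[OF de(2)]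
      by (simp add: mult[OF de] fun_eq_iff translate_translate)
  qed
  moreover have "?\<rho> (torus_one r) = id"
    by (simp add: \<iota>_one assms(1) translate_one)
  ultimately show "global_toric_action (vertices n) (C_T \<alpha> \<beta>) (2 * k_T) ?\<rho>"
    unfolding global_toric_action_def r_def[symmetric] using aut seeds by auto
qed

end
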